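(* Let $k\ge 4$ be any fixed integer. Assume the Lindelöf Hypothesis: for every $\sigma\ge\frac12$ and every $\epsilon>0$, $\zeta(\sigma+it)\ll(|t|+10)^{\epsilon}$ for $|t|\ge 1$. Then $$\eta_k\le\frac{k+1}{k(2k+3)}.$$
   Context: A natural number $n$ is $k$-full if for every prime $p$, $p\mid n$ implies $p^k\mid n$ (so $n=1$ is $k$-full). Let $f_k(n)=1$ if $n$ is $k$-full and $f_k(n)=0$ otherwise, and let $F_k(s)=\sum_{n\ge1}f_k(n)n^{-s}$ for $\Re(s)>\frac1k$. One has $F_k(s)=G_k(s)\prod_{j=k}^{2k-1}\zeta(js)$, where $\zeta$ is the Riemann zeta function and $G_k(s)$ is a Dirichlet series converging absolutely for $\Re(s)>\frac1{2k+2}$; this gives the meromorphic continuation of $F_k$ to $\Re(s)>\frac1{2k+2}$. For $j=0,1,\dots,k-1$ let $c_{j,k}$ be the residue of $F_k(s)/s$ at $s=\frac1{k+j}$. Define the error term $E_k(x)$ by $$\sum_{n\le x}f_k(n)=\sum_{j=0}^{k-1}c_{j,k}\,x^{\frac1{k+j}}+E_k(x),$$ and define $$\eta_k:=\inf\{\eta>0:\ E_k(x)\ll x^{\eta}\},$$ where the bound is for all sufficiently large $x$ with implied constant possibly depending on $\eta$ and $k$. *)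

theory Defs
  imports
    "HOL-Complex_Analysis.Complex_Analysis"
    "HOL-Computational_Algebra.Primes"
    "HOL-Library.Landau_Symbols"
begin

text \<open>
  The Riemann zeta function, as the analytic continuation of its Dirichlet series to the complex
  plane without the point 1. The value 0 at the pole is a convention that makes the description
  unique.
\<close>

definition zeta :: "complex \<Rightarrow> complex" where
  "zeta = (THE Z. Z holomorphic_on - {1} \<and> Z 1 = 0 \<and>
             (\<forall>s. Re s > 1 \<longrightarrow> (\<lambda>n. of_nat (Suc n) powr (- s)) sums Z s))"

text \<open>The implied constant \<open>C\<close> may depend on both \<open>\<sigma>\<close> and \<open>\<epsilon>\<close>.\<close>

definition Lindelof_Hypothesis :: bool where
  "Lindelof_Hypothesis \<longleftrightarrow>
     (\<forall>\<sigma>\<ge>1/2. \<forall>\<epsilon>>0. \<exists>C. \<forall>t::real. \<bar>t\<bar> \<ge> 1 \<longrightarrow>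
        norm (zeta (Complex \<sigma> t)) \<le> C * (\<bar>t\<bar> + 10) powr \<epsilon>)"

definition kfull :: "nat \<Rightarrow> nat \<Rightarrow> bool" where
  "kfull k n \<longleftrightarrow> n > 0 \<and> (\<forall>p. prime p \<longrightarrow> p dvd n \<longrightarrow> p ^ k dvd n)"

definition kfull_ind :: "nat \<Rightarrow> nat \<Rightarrow> complex" where
  "kfull_ind k n = of_bool (kfull k n)"

definition kfull_series :: "nat \<Rightarrow> complex \<Rightarrow> complex" where
  "kfull_series k s = (\<Sum>n. kfull_ind k (Suc n) * of_nat (Suc n) powr (- s))"

text \<open>
  \<open>meromorphic_on\<close> does not constrain the values on a discrete set, so the continuation is
  determined on the half-plane only up to such a set. Residues do not depend on this choice.
\<close>

definition kfull_F :: "nat \<Rightarrow> complex \<Rightarrow> complex" where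
  "kfull_F k = (SOME F. F meromorphic_on {s. Re s > 1 / (2 * real k + 2)} \<and>
                  (\<forall>s. Re s > 1 / real k \<longrightarrow> F s = kfull_series k s))"

definition kfull_coeff :: "nat \<Rightarrow> nat \<Rightarrow> complex" where
  "kfull_coeff j k = residue (\<lambda>s. kfull_F k s / s) (1 / of_nat (k + j))"

text \<open>
  The coefficients are residues and hence typed as complex numbers (although their values are real),
  so the error term is complex-valued as well.
\<close>

definition kfull_error :: "nat \<Rightarrow> real \<Rightarrow> complex" where
  "kfull_error k x = (\<Sum>n | 1 \<le> n \<and> real n \<le> x. kfull_ind k n)
     - (\<Sum>j<k. kfull_coeff j k * of_real (x powr (1 / real (k + j))))"

definition kfull_eta :: "nat \<Rightarrow> real" where
  "kfull_eta k = Inf {\<eta>. \<eta> > 0 \<and> kfull_error k \<in> O[at_top](\<lambda>x. of_real (x powr \<eta>))}"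

end

theory Submission imports Defs begin

text \<open>
  The counting function of the \<open>k\<close>-full numbers is monotone, so it is squeezed between two values of
  its average over short multiplicative intervals of relative length \<open>\<delta>\<close>. A \<open>(3k + 1)\<close>-fold average
  has a Perron formula that converges absolutely, and its line of integration can be moved to
  \<open>Re s = 1 / (2k + 2) + e\<close>, past all the poles \<open>1 / (k + j)\<close> of \<open>F\<^sub>k(s) / s\<close>. On that line only the factor
  \<open>\<zeta>(ks)\<close> is evaluated to the left of the critical line; convexity between the critical line
  and lines far to the left, where \<open>\<zeta>\<close> has polynomial growth, together with the Lindelof
  Hypothesis gives \<open>F\<^sub>k(s) \<lless> |t|^(1 / (2k + 2))\<close>. The averaged count thus has error
  \<open>(x / \<delta>)^(1 / (2k + 2) + e)\<close>, the averaging itself costs \<open>\<delta> x^(1 / k)\<close>, and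
  \<open>\<delta> = x^(- (k + 2) / (k (2k + 3)))\<close> balances the two.
\<close>

section \<open>Analytic continuation of the zeta function\<close>

text \<open>No functional equation is used. Expanding \<open>(n + 2)^(1 - s)\<close> about
  \<open>n + 1\<close> and summing over \<open>n\<close> expresses \<open>(s - 1) * zeta s\<close>
  by its values at \<open>s + 1, s + 2, ...\<close>, and each unit step to the left costs one degree
  of growth. The resulting exponent \<open>A + 3\<close> on \<open>Re s = - A\<close> exceeds the
  true order \<open>A + 1/2\<close> by a constant, and convexity across a strip of width about
  \<open>A\<close> dilutes a constant to nothing. The same crude bound fixes the number of averages:
  each of the \<open>k\<close> zeta factors is \<open>O(|t|^3)\<close> for
  \<open>Re s \<ge> 0\<close>, moving the line needs decay \<open>1 / t^2\<close>, the factor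
  \<open>1 / s\<close> gives one power, and \<open>3k + 1\<close> averages give the rest. In the
  final estimate only one average is used for decay, raised to the power
  \<open>\<sigma> = 1 / (2k + 2) + e\<close>: together with \<open>1 / s\<close> and the growth of
  \<open>F\<close> it leaves \<open>(1 + |t|)^(-1 - e)\<close>, so
  \<open>(x / \<delta>)^\<sigma>\<close> comes out of a single absolutely convergent integral.
  Averaging is done in \<open>ln x\<close>, where it multiplies the Perron kernel by powers of
  \<open>(exp (\<delta> s) - 1) / (\<delta> s)\<close>. Since the continuation in the definition of
  the residues is an arbitrary choice, an identity theorem ties it to the explicit product.\<close>

lemma holomorphic_on_suminf_locally_dominated:
  fixes f :: "nat \<Rightarrow> complex \<Rightarrow> complex"
  assumes S: "open S" and holo: "\<And>n. f n holomorphic_on S"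
    and dom: "\<And>z. z \<in> S \<Longrightarrow> \<exists>d>0. \<exists>M. summable M \<and> (\<forall>n. \<forall>w\<in>S. dist z w \<le> d \<longrightarrow> norm (f n w) \<le> M n)"
  shows "(\<lambda>z. \<Sum>n. f n z) holomorphic_on S"
proof (rule holomorphic_uniform_sequence[OF S, of "\<lambda>N z. \<Sum>n<N. f n z"])
  show "(\<lambda>z. \<Sum>n<N. f n z) holomorphic_on S" for N
    by (intro holomorphic_intros holo)
next
  fix z assume z: "z \<in> S"
  obtain d M where d: "d > 0" "summable M" "\<And>n w. w \<in> S \<Longrightarrow> dist z w \<le> d \<Longrightarrow> norm (f n w) \<le> M n"
    using dom[OF z] by blast
  obtain e where e: "e > 0" "cball z e \<subseteq> S" using S z open_contains_cball_eq by blast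
  show "\<exists>d>0. cball z d \<subseteq> S \<and> uniform_limit (cball z d) (\<lambda>N z. \<Sum>n<N. f n z) (\<lambda>z. \<Sum>n. f n z) sequentially"
  proof (intro exI[of _ "min d e"] conjI)
    show "cball z (min d e) \<subseteq> S" using e by auto
    show "uniform_limit (cball z (min d e)) (\<lambda>N z. \<Sum>n<N. f n z) (\<lambda>z. \<Sum>n. f n z) sequentially"
      by (rule Weierstrass_m_test[OF _ d(2)]) (use d e in auto)
  qed (use d e in auto)
qed

lemma norm_of_nat_powr: "norm (of_nat (Suc n) powr (s::complex)) = real (Suc n) powr Re s"
  by (subst norm_powr_real_powr) auto

lemma summable_Suc_powr: "summable (\<lambda>n. real (Suc n) powr - \<sigma>)" if "\<sigma> > 1"
  using summable_real_powr_iff[of "-\<sigma>"] that by (subst summable_Suc_iff) simp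

definition dirichlet_zeta :: "complex \<Rightarrow> complex" where
  "dirichlet_zeta s = (\<Sum>n. of_nat (Suc n) powr (- s))"

lemma dirichlet_zeta_abs_summable:
  assumes "Re s > 1"
  shows "summable (\<lambda>n. norm (of_nat (Suc n) powr (- s)))"
  using summable_Suc_powr[OF assms] by (simp only: norm_of_nat_powr) simp

lemma dirichlet_zeta_sums:
  assumes "Re s > 1"
  shows "(\<lambda>n. of_nat (Suc n) powr (- s)) sums dirichlet_zeta s"
  unfolding dirichlet_zeta_def
  using summable_norm_cancel[OF dirichlet_zeta_abs_summable[OF assms]] by (rule summable_sums)

lemma norm_dirichlet_zeta_le:
  assumes "Re s \<ge> \<sigma>" "\<sigma> > 1"
  shows "norm (dirichlet_zeta s) \<le> (\<Sum>n. real (Suc n) powr - \<sigma>)"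
  unfolding dirichlet_zeta_def
proof (rule norm_suminf_le)
  show "norm (of_nat (Suc n) powr (- s)) \<le> real (Suc n) powr - \<sigma>" for n
    unfolding norm_of_nat_powr using assms by (intro powr_mono) auto
qed (rule summable_Suc_powr, fact)

lemma open_Re_gt: "open {s. Re s > c}"
  by (simp add: open_halfspace_Re_gt)

lemma connected_Re_gt: "connected {s. Re s > c}"
  by (intro convex_connected convex_halfspace_Re_gt)

lemma holomorphic_dirichlet_zeta: "dirichlet_zeta holomorphic_on {s. Re s > 1}"
  unfolding dirichlet_zeta_def [abs_def]
proof (rule holomorphic_on_suminf_locally_dominated[OF open_Re_gt])
  show "(\<lambda>s. of_nat (Suc n) powr - s) holomorphic_on {s. Re s > 1}" for n
    by (intro holomorphic_intros) (auto simp: complex_nonpos_Reals_iff)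
next
  fix z :: complex assume z: "z \<in> {s. Re s > 1}"
  define d where "d = (Re z - 1) / 2"
  show "\<exists>d>0. \<exists>M. summable M \<and> (\<forall>n. \<forall>w\<in>{s. Re s > 1}. dist z w \<le> d \<longrightarrow> norm (of_nat (Suc n) powr - w) \<le> M n)"
  proof (intro exI[of _ d] conjI exI[of _ "\<lambda>n. real (Suc n) powr - (Re z - d)"] allI ballI impI)
    show "d > 0" using z by (simp add: d_def)
    show "summable (\<lambda>n. real (Suc n) powr - (Re z - d))"
      by (rule summable_Suc_powr) (use z in \<open>simp add: d_def field_simps\<close>)
    fix n w assume "dist z w \<le> d"
    hence "Re w \<ge> Re z - d" using complex_Re_le_cmod[of "z - w"] by (simp add: dist_norm)
    thus "norm (of_nat (Suc n) powr - w) \<le> real (Suc n) powr - (Re z - d)"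
      unfolding norm_of_nat_powr by (intro powr_mono) auto
  qed
qed

text \<open>Growth is measured by \<open>norm s\<close> on whole half-planes, not by
  \<open>Im s\<close> in strips: in this form it passes through polynomial coefficients and through
  the shifts \<open>s + i\<close> of the recursion below, with degrees that simply add. The passage
  to strips is made in \<open>zeta_strip_bound\<close>.\<close>

definition polybound :: "nat \<Rightarrow> complex set \<Rightarrow> (complex \<Rightarrow> complex) \<Rightarrow> bool" where
  "polybound d A f \<longleftrightarrow> (\<exists>C. \<forall>s\<in>A. norm (f s) \<le> C * (1 + norm s) ^ d)"

lemma polyboundI: "(\<And>s. s \<in> A \<Longrightarrow> norm (f s) \<le> C * (1 + norm s) ^ d) \<Longrightarrow> polybound d A f"
  by (auto simp: polybound_def)

lemma polyboundE:
  assumes "polybound d A f"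
  obtains C where "C > 0" "\<And>s. s \<in> A \<Longrightarrow> norm (f s) \<le> C * (1 + norm s) ^ d"
proof -
  obtain C where C: "\<And>s. s \<in> A \<Longrightarrow> norm (f s) \<le> C * (1 + norm s) ^ d"
    using assms by (auto simp: polybound_def)
  have "norm (f s) \<le> max 1 C * (1 + norm s) ^ d" if "s \<in> A" for s
    using C[OF that] by (rule order_trans) (intro mult_right_mono, auto)
  thus ?thesis by (intro that[of "max 1 C"]) auto
qed

lemma polybound_mono:
  assumes "polybound d A f" "d \<le> e" "B \<subseteq> A"
  shows "polybound e B f"
proof -
  obtain C where C: "C > 0" "\<And>s. s \<in> A \<Longrightarrow> norm (f s) \<le> C * (1 + norm s) ^ d"
    using assms(1) by (rule polyboundE) blast
  show ?thesis
  proof (rule polyboundI)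
    fix s assume "s \<in> B"
    hence "norm (f s) \<le> C * (1 + norm s) ^ d" using C assms by blast
    also have "\<dots> \<le> C * (1 + norm s) ^ e"
      using C(1) assms(2) by (intro mult_left_mono power_increasing) auto
    finally show "norm (f s) \<le> C * (1 + norm s) ^ e" .
  qed
qed

lemma polybound_cong:
  "(\<And>s. s \<in> A \<Longrightarrow> f s = g s) \<Longrightarrow> polybound d A f = polybound d A g"
  by (simp add: polybound_def)

lemma polybound_const: "polybound d A (\<lambda>_. c)"
proof (rule polyboundI)
  fix s assume "s \<in> A"
  show "norm c \<le> norm c * (1 + norm s) ^ d"
    using mult_left_mono[of 1 "(1 + norm s) ^ d" "norm c"] by simp
qed

lemma polybound_add:
  assumes "polybound d A f" "polybound d A g"
  shows "polybound d A (\<lambda>s. f s + g s)"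
proof -
  obtain C where C: "C > 0" "\<And>s. s \<in> A \<Longrightarrow> norm (f s) \<le> C * (1 + norm s) ^ d"
    using assms(1) by (rule polyboundE) blast
  obtain D where D: "D > 0" "\<And>s. s \<in> A \<Longrightarrow> norm (g s) \<le> D * (1 + norm s) ^ d"
    using assms(2) by (rule polyboundE) blast
  show ?thesis
    by (rule polyboundI[of _ _ "C + D"])
       (use C D in \<open>auto simp: distrib_right intro!: norm_triangle_le add_mono\<close>)
qed

lemma polybound_uminus: "polybound d A f \<Longrightarrow> polybound d A (\<lambda>s. - f s)"
  by (simp add: polybound_def)

lemma polybound_diff:
  "polybound d A f \<Longrightarrow> polybound d A g \<Longrightarrow> polybound d A (\<lambda>s. f s - g s)"
  using polybound_add[of d A f "\<lambda>s. - g s"] polybound_uminus[of d A g] by simp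

lemma polybound_mult:
  assumes "polybound d A f" "polybound e A g"
  shows "polybound (d + e) A (\<lambda>s. f s * g s)"
proof -
  obtain C where C: "C > 0" "\<And>s. s \<in> A \<Longrightarrow> norm (f s) \<le> C * (1 + norm s) ^ d"
    using assms(1) by (rule polyboundE) blast
  obtain D where D: "D > 0" "\<And>s. s \<in> A \<Longrightarrow> norm (g s) \<le> D * (1 + norm s) ^ e"
    using assms(2) by (rule polyboundE) blast
  show ?thesis
  proof (rule polyboundI)
    fix s assume s: "s \<in> A"
    have "norm (f s * g s) \<le> (C * (1 + norm s) ^ d) * (D * (1 + norm s) ^ e)"
      unfolding norm_mult using C D s by (intro mult_mono) auto
    thus "norm (f s * g s) \<le> (C * D) * (1 + norm s) ^ (d + e)"
      by (simp add: power_add mult_ac)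
  qed
qed

lemma polybound_sum:
  "(\<And>i. i \<in> I \<Longrightarrow> polybound d A (f i)) \<Longrightarrow> polybound d A (\<lambda>s. \<Sum>i\<in>I. f i s)"
  by (induction I rule: infinite_finite_induct)
     (auto intro: polybound_add simp: polybound_const)

lemma polybound_id: "polybound 1 A (\<lambda>s. s)"
  by (rule polyboundI[of _ _ 1]) auto

lemma polybound_affine: "polybound 1 A (\<lambda>s. c * s + e)"
proof -
  have "polybound 1 A (\<lambda>s. c * s)"
    using polybound_mult[OF polybound_const[of 0 A c] polybound_id[of A]] by simp
  thus ?thesis by (rule polybound_add) (rule polybound_const)
qed

lemma polybound_prod:
  assumes "finite I" "\<And>i. i \<in> I \<Longrightarrow> polybound (d i) A (f i)"
  shows "polybound (\<Sum>i\<in>I. d i) A (\<lambda>s. \<Prod>i\<in>I. f i s)"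
  using assms by (induction I rule: finite_induct)
     (auto intro: polybound_mult simp: polybound_const)

lemma polybound_compose_affine:
  assumes "polybound d B f" "\<And>s. s \<in> A \<Longrightarrow> c * s + e \<in> B"
  shows "polybound d A (\<lambda>s. f (c * s + e))"
proof -
  obtain C where C: "C > 0" "\<And>s. s \<in> B \<Longrightarrow> norm (f s) \<le> C * (1 + norm s) ^ d"
    using assms(1) by (rule polyboundE) blast
  define K where "K = 1 + norm c + norm e"
  show ?thesis
  proof (rule polyboundI)
    fix s assume s: "s \<in> A"
    have "1 + norm (c * s + e) \<le> 1 + norm c * norm s + norm e"
      using norm_triangle_ineq[of "c * s" e] by (simp add: norm_mult)
    also have "\<dots> \<le> K * (1 + norm s)"
      by (simp add: K_def algebra_simps)
    finally have "(1 + norm (c * s + e)) ^ d \<le> (K * (1 + norm s)) ^ d"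
      by (intro power_mono) auto
    hence "C * (1 + norm (c * s + e)) ^ d \<le> C * (K * (1 + norm s)) ^ d"
      using C by (intro mult_left_mono) auto
    thus "norm (f (c * s + e)) \<le> (C * K ^ d) * (1 + norm s) ^ d"
      using C(2)[OF assms(2)[OF s]] by (simp add: power_mult_distrib mult_ac)
  qed
qed

lemma polybound_gchoose: "polybound i A (\<lambda>s. (1 - s) gchoose i)"
proof -
  have "polybound (\<Sum>j\<in>{0..<i}. 1) A (\<lambda>s. \<Prod>j\<in>{0..<i}. (- 1) * s + (1 - of_nat j))"
    by (rule polybound_prod) (auto simp only: polybound_affine finite_atLeastLessThan)
  from polybound_mult[OF this polybound_const[of 0 A "1 / fact i"]]
  show ?thesis
    by (simp add: gbinomial_prod_rev algebra_simps)
qed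

text \<open>The remainder after degree \<open>m + 1\<close> in the Taylor expansion of
  \<open>z powr (1 - s)\<close> about \<open>n + 1\<close>, evaluated at
  \<open>n + 2\<close>.\<close>

definition zeta_remainder :: "nat \<Rightarrow> nat \<Rightarrow> complex \<Rightarrow> complex" where
  "zeta_remainder m n s = of_nat (n + 2) powr (1 - s) -
     (\<Sum>i\<le>m+1. ((1 - s) gchoose i) * of_nat (n + 1) powr (1 - s - of_nat i))"

text \<open>The derivative of order \<open>m + 2\<close> has size
  \<open>(n + 1) powr (Re (1 - s) - (m + 2))\<close> up to a polynomial in \<open>s\<close>. The
  half-plane is chosen so that this exponent lies below \<open>- 3/2\<close>, which gives a
  convergent majorant whose dependence on \<open>s\<close> is confined to a polynomial of degree
  \<open>m + 2\<close>.\<close>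

lemma norm_zeta_remainder_le:
  assumes s: "Re s > 1 / 2 - real m"
  shows "norm (zeta_remainder m n s) \<le> norm (\<Prod>j<m+2. 1 - s - of_nat j) * real (Suc n) powr (- (3/2))"
proof -
  define a where "a = 1 - s"
  define f where "f = (\<lambda>i z. (\<Prod>j<i. a - of_nat j) * z powr (a - of_nat i))"
  define S where "S = closed_segment (of_nat (n+1)) (of_nat (n+2) :: complex)"
  have S: "\<exists>x::real. z = of_real x \<and> real (n+1) \<le> x \<and> x \<le> real (n + 2)" if z: "z \<in> S" for z
  proof -
    have "S = closed_segment (of_real (real (n+1))) (of_real (real (n+2)))"
      by (simp only: S_def of_real_of_nat_eq)
    also have "\<dots> = of_real ` {real (n+1)..real (n+2)}"
      by (subst closed_segment_of_real) (simp add: closed_segment_eq_real_ivl)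
    finally have "S = of_real ` {real (n+1)..real (n+2)}" .
    thus ?thesis using z by auto
  qed
  let ?B = "norm (\<Prod>j<m+2. 1 - s - of_nat j) * real (Suc n) powr (- (3/2))"
  have "norm (f 0 (of_nat (n+2)) - (\<Sum>i\<le>m+1. f i (of_nat (n+1)) * (of_nat (n+2) - of_nat (n+1)) ^ i / (fact i)))
     \<le> ?B * norm (of_nat (n+2) - of_nat (n+1) :: complex)^(Suc (m+1)) / fact (m+1)"
  proof (rule complex_Taylor[where S = S])
    show "convex S" by (simp add: S_def)
    show "of_nat (n+1) \<in> S" "of_nat (n+2) \<in> S" by (auto simp: S_def)
  next
    fix i z assume z: "z \<in> S"
    then obtain x :: real where x: "z = of_real x" "real (n+1) \<le> x" using S by blast
    hence "z \<notin> \<real>\<^sub>\<le>\<^sub>0" by (auto simp: complex_nonpos_Reals_iff)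
    hence "(f i has_field_derivative (\<Prod>j<i. a - of_nat j) * ((a - of_nat i) * z powr (a - of_nat i - 1))) (at z)"
      unfolding f_def by (intro DERIV_cmult has_field_derivative_powr)
    also have "(\<Prod>j<i. a - of_nat j) * ((a - of_nat i) * z powr (a - of_nat i - 1)) = f (Suc i) z"
      by (simp add: f_def algebra_simps)
    finally show "(f i has_field_derivative f (Suc i) z) (at z within S)"
      by (rule has_field_derivative_at_within)
  next
    fix z assume z: "z \<in> S"
    then obtain x :: real where x: "z = of_real x" "real (n+1) \<le> x" using S by blast
    have "norm (z powr (a - of_nat (m+2))) = x powr (Re a - real (m + 2))"
      using x by (subst norm_powr_real_powr) auto
    also have "\<dots> \<le> x powr (- (3/2))"
      using x s by (intro powr_mono) (auto simp: a_def)
    also have "\<dots> \<le> real (n+1) powr (- (3/2))"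
      using x by (intro powr_mono2') auto
    finally show "cmod (f (Suc (m + 1)) z) \<le> ?B"
      by (auto simp: f_def norm_mult a_def intro!: mult_left_mono)
  qed
  also have "f 0 (of_nat (n+2)) - (\<Sum>i\<le>m+1. f i (of_nat (n+1)) * (of_nat (n+2) - of_nat (n+1)) ^ i / (fact i))
      = zeta_remainder m n s"
  proof -
    have "f i (of_nat (n+1)) * (of_nat (n+2) - of_nat (n+1)) ^ i / (fact i)
        = (a gchoose i) * of_nat (n + 1) powr (a - of_nat i)" for i
      by (simp add: f_def gbinomial_prod_rev lessThan_atLeast0)
    thus ?thesis
      by (simp add: f_def zeta_remainder_def a_def del: of_nat_Suc sum.atMost_Suc)
  qed
  also have "?B * norm (of_nat (n+2) - of_nat (n+1) :: complex)^(Suc (m+1)) / fact (m+1) = ?B / fact (m+1)"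
    by simp
  also have "\<dots> \<le> ?B / 1"
    by (intro divide_left_mono) (auto simp del: fact_Suc)
  finally show ?thesis by simp
qed

lemma holomorphic_zeta_remainder_sum:
  "(\<lambda>s. \<Sum>n. zeta_remainder m n s) holomorphic_on {s. Re s > 1 / 2 - real m}"
proof (rule holomorphic_on_suminf_locally_dominated[OF open_Re_gt])
  show "zeta_remainder m n holomorphic_on {s. Re s > 1/2 - real m}" for n
    unfolding zeta_remainder_def [abs_def] gbinomial_prod_rev
    by (intro holomorphic_intros) (auto simp: complex_nonpos_Reals_iff)
next
  fix z :: complex assume z: "z \<in> {s. Re s > 1/2 - real m}"
  define p where "p = (\<lambda>s::complex. \<Prod>j<m+2. 1 - s - of_nat j)"
  have "continuous_on (cball z 1) p" unfolding p_def by (intro continuous_intros)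
  hence "bounded (p ` cball z 1)"
    by (intro compact_imp_bounded compact_continuous_image) auto
  then obtain K where K: "\<And>w. w \<in> cball z 1 \<Longrightarrow> norm (p w) \<le> K"
    by (auto simp: bounded_iff simp del: mem_cball)
  show "\<exists>d>0. \<exists>M. summable M \<and> (\<forall>n. \<forall>w\<in>{s. Re s > 1/2 - real m}. dist z w \<le> d \<longrightarrow> norm (zeta_remainder m n w) \<le> M n)"
  proof (intro exI[of _ 1] conjI exI[of _ "\<lambda>n. K * real (Suc n) powr - (3/2)"] allI ballI impI)
    show "summable (\<lambda>n. K * real (Suc n) powr - (3/2))"
      by (intro summable_mult summable_Suc_powr) auto
    fix n w assume w: "w \<in> {s. Re s > 1/2 - real m}" "dist z w \<le> 1"
    show "norm (zeta_remainder m n w) \<le> K * real (Suc n) powr - (3/2)"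
      using norm_zeta_remainder_le[of m w n] K[of w] w
      by (auto simp: p_def intro: order_trans[OF _ mult_right_mono])
  qed auto
qed

lemma polybound_zeta_remainder_sum:
  "polybound (m + 2) {s. Re s > 1 / 2 - real m} (\<lambda>s. \<Sum>n. zeta_remainder m n s)"
proof -
  define p where "p = (\<lambda>s::complex. \<Prod>j<m+2. (-1) * s + (1 - of_nat j))"
  have "polybound (\<Sum>j<m+2. 1) {s. Re s > 1 / 2 - real m} p" unfolding p_def
    by (rule polybound_prod) (auto simp only: polybound_affine finite_lessThan)
  hence "polybound (m + 2) {s. Re s > 1 / 2 - real m} p" by simp
  then obtain C where C: "\<And>s. Re s > 1/2 - real m \<Longrightarrow> norm (p s) \<le> C * (1 + norm s) ^ (m + 2)"
    by (rule polyboundE) auto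
  define Z where "Z = (\<Sum>n. real (Suc n) powr (- (3/2)))"
  show ?thesis
  proof (rule polyboundI)
    fix s assume s: "s \<in> {s. Re s > 1 / 2 - real m}"
    have "norm (\<Sum>n. zeta_remainder m n s) \<le> (\<Sum>n. norm (p s) * real (Suc n) powr (- (3/2)))"
      by (rule norm_suminf_le)
         (use norm_zeta_remainder_le[of m s] s in
           \<open>auto simp: p_def algebra_simps simp del: of_nat_Suc intro!: summable_mult2 summable_Suc_powr\<close>)
    also have "\<dots> = norm (p s) * Z" unfolding Z_def
      by (intro suminf_mult summable_Suc_powr) auto
    also have "\<dots> \<le> C * (1 + norm s) ^ (m + 2) * Z"
      using C[of s] s unfolding Z_def
      by (intro mult_right_mono suminf_nonneg summable_Suc_powr) auto
    finally show "norm (\<Sum>n. zeta_remainder m n s) \<le> (C * Z) * (1 + norm s) ^ (m + 2)"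
      by (simp add: mult_ac)
  qed
qed

text \<open>When the Taylor expansions are summed over \<open>n\<close>, the differences telescope
  to \<open>- 1\<close> (the powers tend to \<open>0\<close> as \<open>Re s > 1\<close>), the linear
  term gives \<open>(1 - s) * dirichlet_zeta s\<close>, and the term of degree \<open>i + 1\<close>
  gives \<open>dirichlet_zeta (s + i)\<close>. The last factor of its binomial coefficient is
  \<open>-(s + i - 1)\<close>; with it split off, only the pole-free function
  \<open>(s - 1) * dirichlet_zeta s\<close> at shifted arguments appears on the right.\<close>

lemma dirichlet_zeta_recursion:
  assumes s: "Re s > 1"
  shows "(s - 1) * dirichlet_zeta s =
    1 - (\<Sum>i=1..m. ((1 - s) gchoose i) / of_nat (i + 1) * ((s + of_nat i - 1) * dirichlet_zeta (s + of_nat i)))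
      + (\<Sum>n. zeta_remainder m n s)"
proof -
  define a where "a = 1 - s"
  have a: "Re a < 0" using s by (simp add: a_def)
  have lim: "(\<lambda>n. of_nat (Suc n) powr a) \<longlonglongrightarrow> (0::complex)"
  proof (rule tendsto_norm_zero_cancel)
    have "((\<lambda>x::real. x powr Re a) \<longlongrightarrow> 0) at_top"
      using a by (intro tendsto_neg_powr filterlim_ident) auto
    moreover have "filterlim (\<lambda>n. real (Suc n)) at_top sequentially"
      by (rule filterlim_compose[OF filterlim_real_sequentially filterlim_Suc])
    ultimately have "(\<lambda>n. real (Suc n) powr Re a) \<longlonglongrightarrow> 0"
      by (rule filterlim_compose)
    thus "(\<lambda>n. norm (of_nat (Suc n) powr a)) \<longlonglongrightarrow> 0"
      by (simp only: norm_of_nat_powr)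
  qed
  have tele: "(\<lambda>n. of_nat (Suc (Suc n)) powr a - of_nat (Suc n) powr a) sums (0 - of_nat (Suc 0) powr a)"
    by (rule telescope_sums) (rule lim)
  have each: "(\<lambda>n. (a gchoose i) * of_nat (Suc n) powr (a - of_nat i)) sums
               ((a gchoose i) * dirichlet_zeta (s + of_nat i - 1))" if "i \<ge> 1" for i
  proof (rule sums_mult)
    have "Re (s + of_nat i - 1) > 1" using s that by simp
    from dirichlet_zeta_sums[OF this]
    show "(\<lambda>n. of_nat (Suc n) powr (a - of_nat i)) sums dirichlet_zeta (s + of_nat i - 1)"
      by (simp add: a_def algebra_simps)
  qed
  have R: "zeta_remainder m n s = (of_nat (Suc (Suc n)) powr a - of_nat (Suc n) powr a)
      - (\<Sum>i=1..m+1. (a gchoose i) * of_nat (Suc n) powr (a - of_nat i))" for n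
  proof -
    have "{..m+1} = insert 0 {1..m+1}" by auto
    thus ?thesis by (simp add: zeta_remainder_def a_def algebra_simps del: of_nat_Suc)
  qed
  have "zeta_remainder m n s = (of_nat (Suc (Suc n)) powr a - of_nat (Suc n) powr a)
      - (\<Sum>i=1..m+1. (a gchoose i) * of_nat (Suc n) powr (a - of_nat i))" for n by (rule R)
  hence "(\<lambda>n. zeta_remainder m n s) sums ((0 - of_nat (Suc 0) powr a) - (\<Sum>i=1..m+1. (a gchoose i) * dirichlet_zeta (s + of_nat i - 1)))"
    by (simp only:) (intro sums_diff tele sums_sum each, auto)
  hence "(\<Sum>n. zeta_remainder m n s) = (0 - of_nat (Suc 0) powr a) - (\<Sum>i=1..m+1. (a gchoose i) * dirichlet_zeta (s + of_nat i - 1))"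
    by (simp add: sums_iff)
  also have "(\<Sum>i=1..m+1. (a gchoose i) * dirichlet_zeta (s + of_nat i - 1)) =
     a * dirichlet_zeta s + (\<Sum>i=2..m+1. (a gchoose i) * dirichlet_zeta (s + of_nat i - 1))"
    by (subst sum.atLeast_Suc_atMost) (auto simp: numeral_2_eq_2)
  also have "(\<Sum>i=2..m+1. (a gchoose i) * dirichlet_zeta (s + of_nat i - 1)) =
     (\<Sum>i=1..m. (a gchoose (i + 1)) * dirichlet_zeta (s + of_nat i))"
    by (rule sum.reindex_bij_witness[of _ "\<lambda>i. i + 1" "\<lambda>i. i - 1"]) (auto simp: of_nat_diff algebra_simps)
  also have "\<dots> = (\<Sum>i=1..m. - (((1 - s) gchoose i) / of_nat (i + 1) * ((s + of_nat i - 1) * dirichlet_zeta (s + of_nat i))))"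
  proof (rule sum.cong)
    fix i assume "i \<in> {1..m}"
    have "(a gchoose (i + 1)) = (a gchoose i) * (a - of_nat i) / of_nat (i + 1)"
      by (simp add: gbinomial_prod_rev)
    moreover have "a - of_nat i = - (s + of_nat i - 1)" by (simp add: a_def)
    ultimately have "(a gchoose (i + 1)) = (a gchoose i) * - (s + of_nat i - 1) / of_nat (i + 1)"
      by simp
    thus "(a gchoose (i + 1)) * dirichlet_zeta (s + of_nat i) =
      - (((1 - s) gchoose i) / of_nat (i + 1) * ((s + of_nat i - 1) * dirichlet_zeta (s + of_nat i)))"
      by (simp only: a_def) (simp only: mult_minus_right mult_minus_left minus_divide_left times_divide_eq_left mult.assoc)
  qed simp
  finally have *: "(\<Sum>n. zeta_remainder m n s) = (0 - of_nat (Suc 0) powr a) - (a * dirichlet_zeta s +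
      - (\<Sum>i=1..m. ((1 - s) gchoose i) / of_nat (i + 1) * ((s + of_nat i - 1) * dirichlet_zeta (s + of_nat i))))"
    by (simp only: sum_negf)
  show ?thesis unfolding * a_def by (simp only: of_nat_1 One_nat_def[symmetric] powr_one_eq_one) (simp add: left_diff_distrib)
qed

text \<open>\<open>Z\<close> stands for \<open>(s - 1) * zeta s\<close>, which has no pole. The
  bounds at all levels \<open>i \<le> m\<close> belong to the induction hypothesis because the
  recursion evaluates \<open>Z\<close> at several shifts \<open>s + i\<close>, each time with the
  best degree available there. The base line is \<open>3/2\<close> because the Dirichlet series is
  bounded to the right of it, but not on all of \<open>Re s > 1\<close>.\<close>

definition zeta_continuation :: "nat \<Rightarrow> (complex \<Rightarrow> complex) \<Rightarrow> bool" where
  "zeta_continuation m Z \<longleftrightarrow> Z holomorphic_on {s. Re s > 3 / 2 - real m} \<and>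
     (\<forall>s. Re s > 3 / 2 \<longrightarrow> Z s = (s - 1) * dirichlet_zeta s) \<and>
     (\<forall>i\<le>m. polybound (i + 1) {s. Re s > 3 / 2 - real i} Z)"

lemma zeta_continuation_unique:
  assumes "zeta_continuation m Y" "zeta_continuation n Z" "m \<le> n" "Re s > 3 / 2 - real m"
  shows "Y s = Z s"
proof (rule analytic_continuation_open[where f = Y and g = Z])
  show "{s::complex. Re s > 3/2} \<subseteq> {s. Re s > 3 / 2 - real m}" by auto
  show "Z holomorphic_on {s. Re s > 3 / 2 - real m}"
    by (rule holomorphic_on_subset) (use assms in \<open>auto simp: zeta_continuation_def\<close>)
  show "open {s::complex. Re s > 3/2}" by (rule open_Re_gt)
    show "{s::complex. Re s > 3/2} \<noteq> {}" by (auto intro!: exI[of _ 2])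
qed (use assms in \<open>auto simp: zeta_continuation_def open_Re_gt connected_Re_gt\<close>)

lemma zeta_continuation_exists: "\<exists>Z. zeta_continuation m Z"
proof (induction m)
  case 0
  have bd: "polybound 0 {s. Re s > 3 / 2} dirichlet_zeta"
    by (rule polyboundI[of _ _ "\<Sum>n. real (Suc n) powr - (3/2)"])
       (use norm_dirichlet_zeta_le[of "3/2"] in auto)
  have "zeta_continuation 0 (\<lambda>s. (s - 1) * dirichlet_zeta s)"
    unfolding zeta_continuation_def
    using polybound_mult[OF polybound_affine[of _ 1 "-1"] bd]
    by (auto intro!: holomorphic_intros holomorphic_on_subset[OF holomorphic_dirichlet_zeta])
  thus ?case by blast
next
  case (Suc m)
  then obtain Z where Z: "zeta_continuation m Z" by blast
  define Y where "Y = (\<lambda>s. 1 - (\<Sum>i=1..m. ((1 - s) gchoose i) / of_nat (i + 1) * Z (1 * s + of_nat i))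
      + (\<Sum>n. zeta_remainder m n s))"
  have holZ: "Z holomorphic_on {s. Re s > 3 / 2 - real m}"
    and Zeq: "\<And>s. Re s > 3 / 2 \<Longrightarrow> Z s = (s - 1) * dirichlet_zeta s"
    and Zbd: "\<And>i. i \<le> m \<Longrightarrow> polybound (i + 1) {s. Re s > 3 / 2 - real i} Z"
    using Z by (auto simp: zeta_continuation_def)
  have holY: "Y holomorphic_on {s. Re s > 1 / 2 - real m}"
    unfolding Y_def gbinomial_prod_rev
    by (intro holomorphic_intros holomorphic_zeta_remainder_sum holomorphic_on_compose_gen[OF _ holZ, unfolded o_def])
       (auto simp: image_subset_iff)
  have Yeq: "Y s = (s - 1) * dirichlet_zeta s" if "Re s > 3/2" for s
    using that unfolding Y_def by (subst dirichlet_zeta_recursion[of s m]) (auto simp: Zeq algebra_simps)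
  have YZ: "Y s = Z s" if "Re s > 3 / 2 - real m" for s
  proof (rule analytic_continuation_open[where f = Y and g = Z])
    show "{s::complex. Re s > 3/2} \<subseteq> {s. Re s > 3 / 2 - real m}" by auto
    show "open {s::complex. Re s > 3/2}" by (rule open_Re_gt)
    show "{s::complex. Re s > 3/2} \<noteq> {}" by (auto intro!: exI[of _ 2])
    show "Y holomorphic_on {s. Re s > 3 / 2 - real m}"
      by (rule holomorphic_on_subset[OF holY]) auto
  qed (use that holZ Zeq Yeq in \<open>auto simp: open_Re_gt connected_Re_gt\<close>)
  have "polybound (m + 2) {s. Re s > 1 / 2 - real m} Y"
    unfolding Y_def
  proof (intro polybound_add polybound_diff polybound_const polybound_sum polybound_zeta_remainder_sum)
    fix i assume i: "i \<in> {1..m}"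
    have 1: "polybound i {s. Re s > 1 / 2 - real m} (\<lambda>s. ((1 - s) gchoose i) / of_nat (i + 1))"
      using polybound_mult[OF polybound_gchoose polybound_const[of 0 _ "1 / of_nat (i + 1)"], of i "{s. Re s > 1 / 2 - real m}"]
      by simp
    \<comment> \<open>Degree count: \<open>i\<close> from the binomial coefficient and
      \<open>m + 2 - i\<close> from \<open>Z\<close> at \<open>s + i\<close> always add up to
      \<open>m + 2\<close>, which is also the degree of the remainder sum.\<close>
    have 2: "polybound (m + 1 - i + 1) {s. Re s > 1 / 2 - real m} (\<lambda>s. Z (1 * s + of_nat i))"
      by (rule polybound_compose_affine[OF Zbd]) (use i in \<open>auto simp: of_nat_diff\<close>)
    show "polybound (m + 2) {s. Re s > 1 / 2 - real m} (\<lambda>s. ((1 - s) gchoose i) / of_nat (i + 1) * Z (1 * s + of_nat i))"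
      by (rule polybound_mono[OF polybound_mult[OF 1 2]]) (use i in auto)
  qed
  moreover have "polybound (i + 1) {s. Re s > 3 / 2 - real i} Y" if "i \<le> m" for i
    using Zbd[OF that] by (subst polybound_cong[of _ Y Z]) (use YZ that in auto)
  ultimately have "zeta_continuation (Suc m) Y"
    unfolding zeta_continuation_def using holY Yeq
    by (auto simp: le_Suc_eq algebra_simps)
  thus ?case by blast
qed

theorem entire_zeta_continuation:
  obtains Z where "Z holomorphic_on UNIV"
    "\<And>s. Re s > 1 \<Longrightarrow> Z s = (s - 1) * dirichlet_zeta s"
    "\<And>i. polybound (i + 1) {s. Re s > 3 / 2 - real i} Z"
proof -
  obtain Y where Y: "\<And>m. zeta_continuation m (Y m)"
    using zeta_continuation_exists by metis
  \<comment> \<open>All indices \<open>m\<close> with \<open>Re s > 3/2 - m\<close> give the same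
    value at \<open>s\<close>; this choice satisfies that condition at every point because it is at
    least \<open>2 - Re s\<close>.\<close>
  define Z where "Z = (\<lambda>s. Y (nat \<lceil>2 - Re s\<rceil>) s)"
  have ZY: "Z s = Y m s" if "Re s > 3 / 2 - real m" for s m
  proof -
    have *: "Re s > 3 / 2 - real (nat \<lceil>2 - Re s\<rceil>)" by linarith
    show ?thesis unfolding Z_def
      using zeta_continuation_unique[OF Y Y, of m "nat \<lceil>2 - Re s\<rceil>" s]
            zeta_continuation_unique[OF Y Y, of "nat \<lceil>2 - Re s\<rceil>" m s] that *
      by (cases "m \<le> nat \<lceil>2 - Re s\<rceil>") auto
  qed
  show ?thesis
  proof (rule that)
    have "Z holomorphic_on (\<Union>m. {s. Re s > 3 / 2 - real m})"
    proof (rule holomorphic_on_UN_open)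
      show "Z holomorphic_on {s. Re s > 3 / 2 - real m}" for m
        using Y[of m] by (subst holomorphic_cong[OF refl ZY]) (auto simp: zeta_continuation_def)
    qed (rule open_Re_gt)
    also have "(\<Union>m. {s::complex. Re s > 3 / 2 - real m}) = UNIV"
    proof safe
      fix s :: complex
      obtain m where "real m > 3 / 2 - Re s" using reals_Archimedean2 by blast
      thus "s \<in> (\<Union>m. {s. Re s > 3 / 2 - real m})" by (auto intro!: exI[of _ m])
    qed auto
    finally show hol: "Z holomorphic_on UNIV" .
    fix s :: complex assume s: "Re s > 1"
    show "Z s = (s - 1) * dirichlet_zeta s"
    proof (rule analytic_continuation_open[where f = Z and g = "\<lambda>s. (s - 1) * dirichlet_zeta s"])
      show "{s::complex. Re s > 3/2} \<subseteq> {s. Re s > 1}" by auto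
      show "open {s::complex. Re s > 3/2}" by (rule open_Re_gt)
    show "{s::complex. Re s > 3/2} \<noteq> {}" by (auto intro!: exI[of _ 2])
      show "(\<lambda>s. (s - 1) * dirichlet_zeta s) holomorphic_on {s. Re s > 1}"
        by (intro holomorphic_intros holomorphic_dirichlet_zeta)
      show "Z z = (z - 1) * dirichlet_zeta z" if "z \<in> {s. Re s > 3/2}" for z
        using ZY[of 0 z] Y[of 0] that by (auto simp: zeta_continuation_def)
    qed (use s hol in \<open>auto simp: open_Re_gt connected_Re_gt intro: holomorphic_on_subset\<close>)
  next
    fix i :: nat
    have "polybound (i + 1) {s. Re s > 3 / 2 - real i} (Y i)"
      using Y[of i] by (auto simp: zeta_continuation_def)
    thus "polybound (i + 1) {s. Re s > 3 / 2 - real i} Z"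
      by (subst polybound_cong[of _ Z "Y i"]) (use ZY in auto)
  qed
qed

section \<open>Uniqueness of the continuation and its identification with
  \<open>zeta\<close>\<close>

definition zeta_spec :: "(complex \<Rightarrow> complex) \<Rightarrow> bool" where
  "zeta_spec Z \<longleftrightarrow> Z holomorphic_on - {1} \<and> Z 1 = 0 \<and>
     (\<forall>s. Re s > 1 \<longrightarrow> (\<lambda>n. of_nat (Suc n) powr (- s)) sums Z s)"

lemma zeta_spec_unique:
  assumes Y: "zeta_spec Y" and Z: "zeta_spec Z"
  shows "Y = Z"
proof
  fix s
  show "Y s = Z s"
  proof (cases "s = 1")
    case False
    show ?thesis
    proof (rule analytic_continuation_open[where f = Y and g = Z])
      show "{s::complex. Re s > 1} \<subseteq> - {1}" by auto
      show "{s::complex. Re s > 1} \<noteq> {}" by (auto intro!: exI[of _ 2])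
      show "connected (- {1::complex})" by (simp add: connected_punctured_universe)
      show "Y z = Z z" if "z \<in> {s. Re s > 1}" for z
        using Y Z that by (auto simp: zeta_spec_def intro: sums_unique2)
    qed (use Y Z False in \<open>auto simp: zeta_spec_def open_Re_gt\<close>)
  qed (use Y Z in \<open>simp add: zeta_spec_def\<close>)
qed

lemma zeta_eqI:
  assumes "zeta_spec Z"
  shows "zeta = Z"
  unfolding zeta_def zeta_spec_def [symmetric]
  by (rule the_equality) (use assms zeta_spec_unique in auto)

theorem zeta_entire_numerator:
  obtains Z where "Z holomorphic_on UNIV" "\<And>s. zeta s = Z s / (s - 1)"
    "\<And>i. polybound (i + 1) {s. Re s > 3 / 2 - real i} Z" "zeta_spec (\<lambda>s. Z s / (s - 1))"
proof -
  obtain Z where Z: "Z holomorphic_on UNIV" "\<And>s. Re s > 1 \<Longrightarrow> Z s = (s - 1) * dirichlet_zeta s"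
    "\<And>i. polybound (i + 1) {s. Re s > 3 / 2 - real i} Z"
    by (rule entire_zeta_continuation) blast
  \<comment> \<open>At \<open>s = 1\<close> the quotient is \<open>0\<close> by the convention for
    division by zero, which is the value prescribed at the pole.\<close>
  have spec: "zeta_spec (\<lambda>s. Z s / (s - 1))"
    unfolding zeta_spec_def
  proof (intro conjI allI impI)
    show "(\<lambda>s. Z s / (s - 1)) holomorphic_on - {1}"
      by (intro holomorphic_intros holomorphic_on_subset[OF Z(1)]) auto
    fix s :: complex assume s: "Re s > 1"
    hence "Z s / (s - 1) = dirichlet_zeta s" by (auto simp: Z)
    thus "(\<lambda>n. of_nat (Suc n) powr (- s)) sums (Z s / (s - 1))"
      using dirichlet_zeta_sums[OF s] by simp
  qed auto
  show ?thesis
    by (rule that[OF Z(1) _ Z(3) spec]) (simp add: zeta_eqI[OF spec])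
qed

lemma
  shows holomorphic_zeta: "zeta holomorphic_on - {1}"
    and zeta_sums: "\<And>s. Re s > 1 \<Longrightarrow> (\<lambda>n. of_nat (Suc n) powr (- s)) sums zeta s"
proof -
  have "zeta_spec zeta"
    by (rule zeta_entire_numerator) (use zeta_eqI in metis)
  thus "zeta holomorphic_on - {1}" "\<And>s. Re s > 1 \<Longrightarrow> (\<lambda>n. of_nat (Suc n) powr (- s)) sums zeta s"
    by (auto simp: zeta_spec_def)
qed

section \<open>Shifting vertical lines of integration\<close>

lemma integrable_powr_tail:
  assumes e: "e > 0"
  shows "integrable lborel (\<lambda>t::real. (1 + \<bar>t\<bar>) powr (- 1 - e))"
proof -
  define f where "f = (\<lambda>t::real. (1 + t) powr (- 1 - e) * indicator {0..} t)"
  have "(\<integral>\<^sup>+t. ennreal ((1 + \<bar>t\<bar>) powr (- 1 - e)) * indicator {0..} t \<partial>lborel) = ennreal (0 - (- (1 / e) * (1 + 0) powr (- e)))"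
  proof (rule nn_integral_FTC_atLeast)
    fix x :: real assume x: "0 \<le> x"
    have "((\<lambda>t. - (1 / e) * (1 + t) powr (- e)) has_real_derivative - (1 / e) * (- e * (1 + x) powr (- e - 1))) (at x)"
      using x by (auto intro!: derivative_eq_intros)
    moreover have "- (1 / e) * (- e * (1 + x) powr (- e - 1)) = (1 + \<bar>x\<bar>) powr (- 1 - e)"
    proof -
      have *: "- e - 1 = - 1 - e" by simp
      show ?thesis using x e unfolding * by simp
    qed
    ultimately show "((\<lambda>t. - (1 / e) * (1 + t) powr (- e)) has_real_derivative (1 + \<bar>x\<bar>) powr (- 1 - e)) (at x)"
      by simp
  next
    have "((\<lambda>t. (1 + t) powr (- e)) \<longlongrightarrow> 0) at_top"
      using e by (intro tendsto_neg_powr filterlim_tendsto_add_at_top[OF tendsto_const] filterlim_ident) auto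
    from tendsto_mult[OF tendsto_const[of "- (1/e)"] this]
    show "((\<lambda>t. - (1 / e) * (1 + t) powr (- e)) \<longlongrightarrow> 0) at_top" by simp
  qed auto
  hence "(\<integral>\<^sup>+t. ennreal (norm (f t)) \<partial>lborel) < \<infinity>"
    by (subst nn_integral_cong[of _ _ "\<lambda>t. ennreal ((1 + \<bar>t\<bar>) powr (- 1 - e)) * indicator {0..} t"])
       (auto simp: f_def indicator_def)
  hence f: "integrable lborel f"
    by (intro integrableI_bounded) (auto simp: f_def)
  from lborel_integrable_real_affine[OF f, of "-1" 0]
  have f': "integrable lborel (\<lambda>t. f (- t))" by simp
  show ?thesis
  proof (rule Bochner_Integration.integrable_bound[OF Bochner_Integration.integrable_add[OF f f']])
    show "AE t in lborel. norm ((1 + \<bar>t\<bar>) powr (- 1 - e)) \<le> norm (f t + f (- t))"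
      by (intro AE_I2) (auto simp: f_def indicator_def)
  qed auto
qed

lemma continuous_on_imp_borel_measurable_lborel:
  "continuous_on UNIV f \<Longrightarrow> f \<in> borel_measurable lborel"
  by (simp add: borel_measurable_continuous_onI)

lemma integrable_quadratic_decay:
  fixes f :: "real \<Rightarrow> complex"
  assumes cont: "continuous_on UNIV f" and bd: "\<And>t. \<bar>t\<bar> \<ge> T0 \<Longrightarrow> norm (f t) \<le> C / t ^ 2" and T0: "T0 \<ge> 1"
  shows "integrable lborel f"
proof -
  have "continuous_on {-T0..T0} f" by (rule continuous_on_subset[OF cont]) auto
  hence "bounded (f ` {-T0..T0})"
    by (intro compact_imp_bounded compact_continuous_image) auto
  then obtain M where M': "\<And>t. t \<in> {-T0..T0} \<Longrightarrow> norm (f t) \<le> M"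
    by (auto simp: bounded_iff simp del: atLeastAtMost_iff)
  have M: "norm (f t) \<le> M" if "\<bar>t\<bar> \<le> T0" for t using that by (intro M') auto
  have M0: "M \<ge> 0" using M[of 0] T0 norm_ge_zero[of "f 0"] by linarith
  define K where "K = max (M * (1 + T0) ^ 2) (4 * \<bar>C\<bar>)"
  have "norm (f t) \<le> K * (1 + \<bar>t\<bar>) powr (- 1 - 1)" for t
  proof (cases "\<bar>t\<bar> \<le> T0")
    case True
    have "norm (f t) * (1 + \<bar>t\<bar>) ^ 2 \<le> M * (1 + T0) ^ 2"
      using M[OF True] True M0 by (intro mult_mono power_mono) auto
    also have "\<dots> \<le> K" by (simp add: K_def)
    finally show ?thesis by (simp add: powr_minus field_simps)
  next
    case False
    hence t: "\<bar>t\<bar> \<ge> 1" "\<bar>t\<bar> \<ge> T0" using T0 by auto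
    have "(1 + \<bar>t\<bar>) ^ 2 \<le> (2 * \<bar>t\<bar>) ^ 2" using t by (intro power_mono) auto
    hence "norm (f t) * (1 + \<bar>t\<bar>) ^ 2 \<le> (\<bar>C\<bar> / t ^ 2) * (4 * t ^ 2)"
      using t bd[OF t(2)] by (intro mult_mono) (auto simp: divide_right_mono intro: order_trans)
    also have "\<dots> \<le> K" using t by (auto simp: K_def)
    finally show ?thesis by (simp add: powr_minus field_simps)
  qed
  thus ?thesis
    by (intro Bochner_Integration.integrable_bound[OF integrable_mult_right[OF integrable_powr_tail[of 1], of K]]
          continuous_on_imp_borel_measurable_lborel cont AE_I2)
       (auto intro: order_trans[OF _ abs_ge_self])
qed

text \<open>The centre \<open>u\<close> is free because the Gaussian-smoothed integrals below decay
  away from the height of a given point rather than away from \<open>0\<close>. Translation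
  invariance keeps \<open>u\<close> out of the constant.\<close>

lemma norm_integral_powr_tail_le:
  fixes f :: "real \<Rightarrow> complex"
  assumes e: "e > 0" and f: "\<And>t. norm (f t) \<le> B * (1 + \<bar>t - u\<bar>) powr (- 1 - e)"
  shows "norm (LINT t|lborel. f t) \<le> B * (LINT t|lborel. (1 + \<bar>t\<bar>) powr (- 1 - e))"
proof (cases "integrable lborel f")
  case True
  have "norm (LINT t|lborel. f t) \<le> (LINT t|lborel. B * (1 + \<bar>t - u\<bar>) powr (- 1 - e))"
    using lborel_integrable_real_affine[OF integrable_powr_tail[OF e], of 1 "- u"] f
    by (intro Bochner_Integration.integral_norm_bound_integral True integrable_mult_right) auto
  thus ?thesis
    using lborel_integral_real_affine[of 1 "\<lambda>t. (1 + \<bar>t\<bar>) powr (- 1 - e)" "- u"] by simp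
next
  \<comment> \<open>A function that is not integrable has integral \<open>0\<close>, so only
    \<open>B \<ge> 0\<close> has to be checked.\<close>
  case False
  have "0 \<le> B" using order_trans[OF norm_ge_zero f[of u]] by simp
  thus ?thesis using False by (simp add: not_integrable_integral_eq integral_nonneg)
qed

lemma tendsto_integral_symmetric:
  fixes f :: "real \<Rightarrow> complex"
  assumes f: "integrable lborel f"
  shows "(\<lambda>n. integral {- real n..real n} f) \<longlonglongrightarrow> (LINT t|lborel. f t)"
proof -
  have "(\<lambda>n. LINT t|lborel. indicator {- real n..real n} t *\<^sub>R f t) \<longlonglongrightarrow> (LINT t|lborel. f t)"
  proof (rule integral_dominated_convergence)
    show "integrable lborel (\<lambda>t. norm (f t))" using f by simp
    show "AE t in lborel. (\<lambda>n. indicator {- real n..real n} t *\<^sub>R f t) \<longlonglongrightarrow> f t"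
    proof (rule AE_I2, rule tendsto_eventually)
      fix t :: real
      show "eventually (\<lambda>n. indicator {- real n..real n} t *\<^sub>R f t = f t) sequentially"
        using eventually_ge_at_top[of "nat \<lceil>\<bar>t\<bar>\<rceil>"]
        by eventually_elim (auto simp: indicator_def abs_le_iff nat_le_iff ceiling_le_iff)
    qed
    show "AE t in lborel. norm (indicator {- real n..real n} t *\<^sub>R f t) \<le> norm (f t)" for n
      by (intro AE_I2) (auto simp: indicator_def)
  qed (use f in auto)
  moreover have "(LINT t|lborel. indicator {- real n..real n} t *\<^sub>R f t) = integral {- real n..real n} f" for n
  proof -
    have "set_integrable lborel {- real n..real n} f"
      unfolding set_integrable_def by (intro integrable_mult_indicator f) auto
    from set_borel_integral_eq_integral(2)[OF this] show ?thesis
      by (simp add: set_lebesgue_integral_def)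
  qed
  ultimately show ?thesis by simp
qed

text \<open>The residue theorem on the rectangles between \<open>Re s = a\<close> and
  \<open>Re s = b\<close> of height \<open>n\<close> in both directions. Quadratic decay makes the
  vertical integrals absolutely convergent and the horizontal sides \<open>O(1 / n^2)\<close>. The
  margins \<open>a' < a\<close> and \<open>b < b'\<close> supply the open connected domain.
  Integration is with respect to \<open>t\<close>, where \<open>ds = i dt\<close>, hence
  \<open>2 pi\<close> in place of \<open>2 pi i\<close>.\<close>

theorem vertical_line_shift:
  fixes H :: "complex \<Rightarrow> complex"
  assumes ab: "a' < a" "a < b" "b < b'"
    and P: "finite P" "\<And>p. p \<in> P \<Longrightarrow> a < Re p \<and> Re p < b"
    and H: "H holomorphic_on {s. a' < Re s \<and> Re s < b'} - P"
    and decay: "\<And>s. a \<le> Re s \<Longrightarrow> Re s \<le> b \<Longrightarrow> \<bar>Im s\<bar> \<ge> T0 \<Longrightarrow> norm (H s) \<le> C / Im s ^ 2"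
    and T0: "T0 \<ge> 1"
  shows "integrable lborel (\<lambda>t. H (Complex a t))" "integrable lborel (\<lambda>t. H (Complex b t))"
    "(LINT t|lborel. H (Complex b t)) - (LINT t|lborel. H (Complex a t)) = 2 * pi * (\<Sum>p\<in>P. residue H p)"
proof -
  define S where "S = {s. a' < Re s \<and> Re s < b'}"
  have S: "open S" "connected S"
  proof -
    have *: "S = {s. Re s > a'} \<inter> {s. Re s < b'}" by (auto simp: S_def)
    show "open S" unfolding * by (intro open_Int open_halfspace_Re_gt open_halfspace_Re_lt)
    show "connected S" unfolding *
      by (intro convex_connected convex_Int convex_halfspace_Re_gt convex_halfspace_Re_lt)
  qed
  have contH: "continuous_on (S - P) H"
    using H by (intro holomorphic_on_imp_continuous_on) (simp add: S_def)
  have int: "integrable lborel (\<lambda>t. H (Complex c t))" if c: "c = a \<or> c = b" for c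
  proof (rule integrable_quadratic_decay)
    show "continuous_on UNIV (\<lambda>t. H (Complex c t))"
    proof (rule continuous_on_compose2[OF contH])
      show "continuous_on UNIV (Complex c)" unfolding Complex_eq [abs_def] by (intro continuous_intros)
      have "Complex c t \<notin> P" for t using c P(2)[of "Complex c t"] by auto
      thus "range (Complex c) \<subseteq> S - P" using c ab by (auto simp: S_def)
    qed
    show "norm (H (Complex c t)) \<le> C / t\<^sup>2" if "\<bar>t\<bar> \<ge> T0" for t
      using decay[of "Complex c t"] that c ab by auto
  qed fact
  thus "integrable lborel (\<lambda>t. H (Complex a t))" "integrable lborel (\<lambda>t. H (Complex b t))" by auto
  define J where "J = (\<lambda>c (n::nat). integral {- real n..real n} (\<lambda>t. H (Complex c t)))"
  define hz where "hz = (\<lambda>n::nat. contour_integral (linepath (Complex a (- real n)) (Complex b (- real n))) H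
      + contour_integral (linepath (Complex b n) (Complex a n)) H)"
  have ev: "eventually (\<lambda>n. real n \<ge> T0 \<and> (\<forall>p\<in>P. \<bar>Im p\<bar> < real n)) sequentially"
  proof (intro eventually_conj eventually_ball_finite P(1) ballI)
    show "eventually (\<lambda>n. real n \<ge> T0) sequentially"
      using filterlim_real_sequentially by (auto simp: filterlim_at_top)
    show "eventually (\<lambda>n. \<bar>Im p\<bar> < real n) sequentially" for p
      using filterlim_real_sequentially by (auto simp: filterlim_at_top_dense)
  qed
  have C0: "C \<ge> 0"
    using order_trans[OF norm_ge_zero decay[of "Complex a T0"]] ab T0 by (auto simp: zero_le_divide_iff)
  have main: "\<i> * (J b n - J a n) + hz n = 2 * pi * \<i> * (\<Sum>p\<in>P. residue H p)
       \<and> norm (hz n) \<le> 2 * (C / real n ^ 2 * (b - a))"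
    if n: "real n \<ge> T0" "\<forall>p\<in>P. \<bar>Im p\<bar> < real n" for n
  proof -
    define z1 z2 z3 z4 where "z1 = Complex a (- real n)" and "z2 = Complex b (- real n)"
      and "z3 = Complex b (real n)" and "z4 = Complex a (real n)"
    note zs = z1_def z2_def z3_def z4_def
    have n0: "real n \<ge> 1" using n T0 by simp
    have rp: "rectpath z1 z3 = linepath z1 z2 +++ linepath z2 z3 +++ linepath z3 z4 +++ linepath z4 z1"
      by (simp add: rectpath_def Let_def zs)
    have img: "path_image (rectpath z1 z3) \<subseteq> S - P"
      using n n0 ab P(2) by (subst path_image_rectpath) (force simp: zs S_def)+
    have "contour_integral (rectpath z1 z3) H = 2 * pi * \<i> * (\<Sum>p\<in>P. winding_number (rectpath z1 z3) p * residue H p)"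
    proof (rule Residue_theorem[OF S P(1)])
      show "\<forall>z. z \<notin> S \<longrightarrow> winding_number (rectpath z1 z3) z = 0"
        using ab n0 by (auto intro!: winding_number_rectpath_outside simp: zs S_def in_cbox_complex_iff)
    qed (use H img in \<open>auto simp: S_def\<close>)
    also have "(\<Sum>p\<in>P. winding_number (rectpath z1 z3) p * residue H p) = (\<Sum>p\<in>P. residue H p)"
    proof (intro sum.cong refl)
      fix p assume "p \<in> P"
      hence "winding_number (rectpath z1 z3) p = 1"
        using P(2)[of p] n by (intro winding_number_rectpath) (auto simp: zs in_box_complex_iff abs_less_iff)
      thus "winding_number (rectpath z1 z3) p * residue H p = residue H p" by simp
    qed
    finally have 1: "contour_integral (rectpath z1 z3) H = 2 * pi * \<i> * (\<Sum>p\<in>P. residue H p)" .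
    have sub: "closed_segment z1 z2 \<subseteq> S - P" "closed_segment z2 z3 \<subseteq> S - P"
        "closed_segment z3 z4 \<subseteq> S - P" "closed_segment z4 z1 \<subseteq> S - P"
      using img unfolding rp by (auto simp: path_image_join)
    have ci: "H contour_integrable_on linepath z1 z2" "H contour_integrable_on linepath z2 z3"
        "H contour_integrable_on linepath z3 z4" "H contour_integrable_on linepath z4 z1"
      by (intro contour_integrable_continuous_linepath continuous_on_subset[OF contH] sub)+
    have "contour_integral (rectpath z1 z3) H = contour_integral (linepath z1 z2) H +
       (contour_integral (linepath z2 z3) H + (contour_integral (linepath z3 z4) H + contour_integral (linepath z4 z1) H))"
      unfolding rp using ci by (simp add: contour_integrable_joinI)
    moreover have "contour_integral (linepath z4 z1) H = - contour_integral (linepath z1 z4) H"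
      using sub(4) by (intro contour_integral_reverse_linepath continuous_on_subset[OF contH]) (auto simp: closed_segment_commute)
    moreover have "contour_integral (linepath z1 z4) H = \<i> * J a n"
      unfolding J_def using n0 by (intro contour_integral_linepath_same_Re) (auto simp: zs)
    moreover have "contour_integral (linepath z2 z3) H = \<i> * J b n"
      unfolding J_def using n0 by (intro contour_integral_linepath_same_Re) (auto simp: zs)
    moreover have "hz n = contour_integral (linepath z1 z2) H + contour_integral (linepath z3 z4) H"
      by (simp add: hz_def zs)
    ultimately have 2: "\<i> * (J b n - J a n) + hz n = 2 * pi * \<i> * (\<Sum>p\<in>P. residue H p)"
      using 1 by (simp add: algebra_simps)
    have bd: "norm (H s) \<le> C / real n ^ 2" if "s \<in> closed_segment z1 z2 \<union> closed_segment z3 z4" for s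
    proof -
      have s: "a \<le> Re s" "Re s \<le> b" "\<bar>Im s\<bar> = real n"
        using that ab by (auto simp: zs closed_segment_same_Im closed_segment_eq_real_ivl split: if_splits)
      hence "Im s ^ 2 = real n ^ 2" by (metis power2_abs)
      thus ?thesis using decay[of s] s n by simp
    qed
    have "norm (contour_integral (linepath z1 z2) H) \<le> C / real n ^ 2 * norm (z2 - z1)"
         "norm (contour_integral (linepath z3 z4) H) \<le> C / real n ^ 2 * norm (z4 - z3)"
      using bd C0 by (intro contour_integral_bound_linepath ci; auto)+
    moreover have "z2 - z1 = of_real (b - a)" "z4 - z3 = - of_real (b - a)"
      by (auto simp: zs complex_eq_iff)
    hence "norm (z2 - z1) = b - a" "norm (z4 - z3) = b - a"
      using ab by (simp_all only: norm_minus_cancel norm_of_real)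
    ultimately have "norm (hz n) \<le> 2 * (C / real n ^ 2 * (b - a))"
      unfolding \<open>hz n = _\<close> by (intro order_trans[OF norm_triangle_ineq]) simp
    with 2 show ?thesis by blast
  qed
  have hz0: "hz \<longlonglongrightarrow> 0"
  proof (rule Lim_null_comparison)
    show "eventually (\<lambda>n. norm (hz n) \<le> 2 * (C / real n ^ 2 * (b - a))) sequentially"
      using ev by eventually_elim (use main in blast)
    have "(\<lambda>n. 2 * (C / real n ^ 2 * (b - a))) \<longlonglongrightarrow> 2 * (0 * (b - a))"
      by (intro tendsto_intros real_tendsto_divide_at_top[OF tendsto_const] filterlim_pow_at_top filterlim_real_sequentially) auto
    thus "(\<lambda>n. 2 * (C / real n ^ 2 * (b - a))) \<longlonglongrightarrow> 0" by simp
  qed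
  have "(\<lambda>n. \<i> * (J b n - J a n) + hz n)
     \<longlonglongrightarrow> \<i> * ((LINT t|lborel. H (Complex b t)) - (LINT t|lborel. H (Complex a t))) + 0"
    unfolding J_def by (intro tendsto_intros tendsto_integral_symmetric hz0 int) auto
  moreover have "(\<lambda>n. \<i> * (J b n - J a n) + hz n)
     \<longlonglongrightarrow> 2 * pi * \<i> * (\<Sum>p\<in>P. residue H p)"
    by (rule tendsto_eventually) (use ev in \<open>eventually_elim, use main in blast\<close>)
  ultimately have "\<i> * ((LINT t|lborel. H (Complex b t)) - (LINT t|lborel. H (Complex a t))) + 0
      = 2 * pi * \<i> * (\<Sum>p\<in>P. residue H p)"
    by (rule LIMSEQ_unique)
  thus "(LINT t|lborel. H (Complex b t)) - (LINT t|lborel. H (Complex a t)) = 2 * pi * (\<Sum>p\<in>P. residue H p)"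
    by (simp add: mult_ac)
qed

section \<open>The Lindelof Hypothesis to the left of the critical line\<close>

lemma power_mult_exp_neg_square_le:
  "(1 + \<bar>w\<bar>) ^ d * exp (- (w ^ 2)) \<le> exp (real d ^ 2 / 4)" for w :: real
proof -
  have "(1 + \<bar>w\<bar>) ^ d \<le> exp \<bar>w\<bar> ^ d" by (intro power_mono exp_ge_add_one_self) auto
  also have "\<dots> = exp (real d * \<bar>w\<bar>)" by (rule exp_of_nat_mult[symmetric])
  finally have "(1 + \<bar>w\<bar>) ^ d * exp (- (w ^ 2)) \<le> exp (real d * \<bar>w\<bar>) * exp (- (w ^ 2))"
    by (intro mult_right_mono) auto
  also have "\<dots> = exp (real d * \<bar>w\<bar> - w ^ 2)" by (simp flip: exp_add)
  also have "real d * \<bar>w\<bar> - w ^ 2 \<le> real d ^ 2 / 4"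
  proof -
    have "0 \<le> (real d / 2 - \<bar>w\<bar>) ^ 2" by simp
    thus ?thesis by (simp add: power2_eq_square algebra_simps)
  qed
  finally show ?thesis by simp
qed

lemma continuous_on_zeta_vertical:
  assumes "\<sigma> \<noteq> 1"
  shows "continuous_on UNIV (\<lambda>t. zeta (Complex \<sigma> t))"
  by (rule continuous_on_compose2[OF holomorphic_on_imp_continuous_on[OF holomorphic_zeta]])
     (use assms in \<open>auto simp: Complex_eq complex_eq_iff intro!: continuous_intros\<close>)

text \<open>The hypothesis is silent for \<open>|t| < 1\<close>. There zeta is bounded by continuity
  on a compact segment, which is why the line through the pole is excluded.\<close>

lemma Lindelof_all_t:
  assumes "Lindelof_Hypothesis" "\<sigma> \<ge> 1/2" "\<sigma> \<noteq> 1" "e > 0"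
  obtains C where "C > 0" "\<And>t. norm (zeta (Complex \<sigma> t)) \<le> C * (\<bar>t\<bar> + 10) powr e"
proof -
  obtain C where C: "\<And>t. \<bar>t\<bar> \<ge> 1 \<Longrightarrow> norm (zeta (Complex \<sigma> t)) \<le> C * (\<bar>t\<bar> + 10) powr e"
    using assms unfolding Lindelof_Hypothesis_def by meson
  have "continuous_on {-1..1} (\<lambda>t. zeta (Complex \<sigma> t))"
    by (rule continuous_on_subset[OF continuous_on_zeta_vertical]) (use assms in auto)
  hence "bounded ((\<lambda>t. zeta (Complex \<sigma> t)) ` {-1..1})"
    by (intro compact_imp_bounded compact_continuous_image) auto
  then obtain M where M: "\<And>t. t \<in> {-1..1} \<Longrightarrow> norm (zeta (Complex \<sigma> t)) \<le> M"
    by (auto simp: bounded_iff simp del: atLeastAtMost_iff)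
  show ?thesis
  proof (rule that[of "max 1 (max C M)"])
    fix t :: real
    show "norm (zeta (Complex \<sigma> t)) \<le> max 1 (max C M) * (\<bar>t\<bar> + 10) powr e"
    proof (cases "\<bar>t\<bar> \<ge> 1")
      case True
      from C[OF this] show ?thesis by (rule order_trans) (intro mult_right_mono, auto)
    next
      case False
      have "1 \<le> (\<bar>t\<bar> + 10) powr e" using assms by (intro ge_one_powr_ge_zero) auto
      moreover have "norm (zeta (Complex \<sigma> t)) \<le> max 1 (max C M)"
        using M[of t] False by (simp add: le_max_iff_disj not_le abs_less_iff)
      ultimately show ?thesis
        using mult_mono[of "norm (zeta (Complex \<sigma> t))" "max 1 (max C M)" 1 "(\<bar>t\<bar> + 10) powr e"] by auto
    qed
  qed auto
qed

text \<open>Separates growth in the fixed height \<open>t\<close> from growth in the distance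
  \<open>v - t\<close>; the latter can be absorbed by a Gaussian centred at
  \<open>t\<close>.\<close>

lemma one_plus_abs_shift_le: "1 + \<bar>v\<bar> \<le> (1 + \<bar>t\<bar>) * (1 + \<bar>v - t\<bar>)" for v t :: real
proof -
  have "1 + \<bar>v\<bar> \<le> 1 + \<bar>t\<bar> + \<bar>v - t\<bar>" by linarith
  also have "\<dots> \<le> (1 + \<bar>t\<bar>) * (1 + \<bar>v - t\<bar>)" by (simp add: algebra_simps)
  finally show ?thesis .
qed

text \<open>Level \<open>A + 2\<close> of the continuation covers \<open>Re s > - A - 1/2\<close>
  with degree \<open>A + 3\<close>. Dividing by \<open>s - 1\<close> is harmless because either
  alternative, \<open>|Im s| \<ge> 1\<close> or \<open>Re s \<le> 0\<close>, keeps \<open>s\<close>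
  at distance at least \<open>1\<close> from the pole.\<close>

lemma zeta_strip_bound:
  obtains C where "C > 0"
    "\<And>s. Re s \<ge> - real A \<Longrightarrow> \<bar>Im s\<bar> \<ge> 1 \<or> Re s \<le> 0 \<Longrightarrow> Re s \<le> B \<Longrightarrow> norm (zeta s) \<le> C * (1 + \<bar>Im s\<bar>) ^ (A + 3)"
proof -
  obtain Z where Z: "\<And>s. zeta s = Z s / (s - 1)" "\<And>i. polybound (i + 1) {s. Re s > 3 / 2 - real i} Z"
    by (rule zeta_entire_numerator) blast
  from Z(2)[of "A + 2"] obtain C where C: "C > 0"
      "\<And>s. Re s > - real A - 1/2 \<Longrightarrow> norm (Z s) \<le> C * (1 + norm s) ^ (A + 3)"
    by (rule polyboundE) (auto simp: numeral_3_eq_3)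
  define K where "K = 1 + real A + \<bar>B\<bar>"
  show ?thesis
  proof (rule that[of "C * K ^ (A + 3)"])
    show "C * K ^ (A + 3) > 0" using C by (auto simp: K_def intro!: mult_pos_pos zero_less_power)
    fix s :: complex assume s: "Re s \<ge> - real A" "\<bar>Im s\<bar> \<ge> 1 \<or> Re s \<le> 0" "Re s \<le> B"
    have "1 \<le> norm (s - 1)"
    proof (cases "\<bar>Im s\<bar> \<ge> 1")
      case True thus ?thesis using abs_Im_le_cmod[of "s - 1"] by simp
    next
      case False thus ?thesis using abs_Re_le_cmod[of "s - 1"] s by auto
    qed
    hence "norm (zeta s) \<le> norm (Z s)"
      unfolding Z(1) norm_divide by (simp add: divide_le_eq mult_le_cancel_left1 order_trans[OF _ norm_ge_zero])
    also have "\<dots> \<le> C * (1 + norm s) ^ (A + 3)" by (rule C) (use s in auto)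
    also have "1 + norm s \<le> K * (1 + \<bar>Im s\<bar>)"
    proof -
      have "norm s \<le> \<bar>Re s\<bar> + \<bar>Im s\<bar>" by (rule cmod_le)
      also have "\<bar>Re s\<bar> \<le> real A + \<bar>B\<bar>" using s by auto
      finally have "1 + norm s \<le> K + \<bar>Im s\<bar>" by (simp add: K_def)
      also have "\<dots> \<le> K * (1 + \<bar>Im s\<bar>)" by (simp add: K_def algebra_simps)
      finally show ?thesis .
    qed
    hence "C * (1 + norm s) ^ (A + 3) \<le> C * (K * (1 + \<bar>Im s\<bar>)) ^ (A + 3)"
      using C by (intro mult_left_mono power_mono) auto
    finally show "norm (zeta s) \<le> (C * K ^ (A + 3)) * (1 + \<bar>Im s\<bar>) ^ (A + 3)"
      by (simp add: power_mult_distrib mult_ac)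
  qed
qed

text \<open>This is \<open>N^z exp (z^2)\<close>: it equals \<open>1\<close> at
  \<open>z = 0\<close>, so dividing by \<open>z\<close> reproduces a point value as a residue, it
  decays like a Gaussian in vertical strips, and \<open>N\<close> is a free weight that trades the
  right boundary line against the left one.\<close>

definition gauss_kernel :: "real \<Rightarrow> complex \<Rightarrow> complex" where
  "gauss_kernel N z = exp (of_real (ln N) * z + z ^ 2)"

lemma norm_gauss_kernel:
  "N > 0 \<Longrightarrow> norm (gauss_kernel N z) = N powr Re z * exp (Re z ^ 2) * exp (- (Im z ^ 2))"
  by (simp add: gauss_kernel_def norm_exp_eq_Re power2_eq_square powr_def mult.commute flip: exp_add)

text \<open>The hypothesis carries both a natural exponent \<open>d\<close> and a small real
  exponent \<open>e\<close> so that it fits the critical line (\<open>d = 0\<close>) and the far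
  left line (\<open>e = 0\<close>). All growth in \<open>v - t\<close> goes into the Gaussian, and
  what survives is the growth at height \<open>t\<close> times the weight
  \<open>N powr (c - \<sigma>)\<close>.\<close>

lemma smoothed_zeta_line_bound:
  fixes c :: real
  assumes zc: "\<And>v. norm (zeta (Complex c v)) \<le> K * (1 + \<bar>v\<bar>) ^ d * (\<bar>v\<bar> + 10) powr e"
    and e: "0 \<le> e" "e \<le> 1" and c: "c \<noteq> \<sigma>" and N: "N > 0"
  shows "norm (LINT v|lborel. zeta (Complex c v) * gauss_kernel N (Complex c v - Complex \<sigma> t) / (Complex c v - Complex \<sigma> t))
      \<le> (K * exp (real (d + 3) ^ 2 / 4) * exp ((c - \<sigma>) ^ 2) / \<bar>c - \<sigma>\<bar> * (LINT t|lborel. (1 + \<bar>t\<bar>) powr (- 1 - 1 :: real)))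
          * ((\<bar>t\<bar> + 10) powr (real d + e) * N powr (c - \<sigma>))"
proof -
  define E where "E = exp (real (d + 3) ^ 2 / 4)"
  define F where "F = exp ((c - \<sigma>) ^ 2) / \<bar>c - \<sigma>\<bar>"
  define \<tau> where "\<tau> = \<bar>t\<bar> + 10"
  have K0: "K \<ge> 0"
    using order_trans[OF norm_ge_zero zc[of 0]] by (simp add: zero_le_mult_iff)
  have "norm (zeta (Complex c v) * gauss_kernel N (Complex c v - Complex \<sigma> t) / (Complex c v - Complex \<sigma> t))
      \<le> (K * E * F * (\<tau> powr (real d + e) * N powr (c - \<sigma>))) * (1 + \<bar>v - t\<bar>) powr (- 1 - 1)" (is "norm ?L \<le> _") for v
  proof -
    define w where "w = v - t"
    have dif: "Complex c v - Complex \<sigma> t = Complex (c - \<sigma>) w" by (simp add: w_def complex_eq_iff)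
    have 1: "norm (gauss_kernel N (Complex c v - Complex \<sigma> t)) = N powr (c - \<sigma>) * exp ((c - \<sigma>) ^ 2) * exp (- (w ^ 2))"
      by (simp add: dif norm_gauss_kernel[OF N])
    have 2: "\<bar>c - \<sigma>\<bar> \<le> norm (Complex c v - Complex \<sigma> t)"
      unfolding dif using abs_Re_le_cmod[of "Complex (c - \<sigma>) w"] by simp
    have 3: "norm (zeta (Complex c v)) \<le> K * (\<tau> powr (real d + e) * (1 + \<bar>w\<bar>) ^ (d + 1))"
    proof -
      have "1 + \<bar>v\<bar> \<le> (1 + \<bar>t\<bar>) * (1 + \<bar>w\<bar>)" unfolding w_def by (rule one_plus_abs_shift_le)
      also have "\<dots> \<le> \<tau> * (1 + \<bar>w\<bar>)" by (intro mult_right_mono) (auto simp: \<tau>_def)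
      finally have a: "1 + \<bar>v\<bar> \<le> \<tau> * (1 + \<bar>w\<bar>)" .
      have "\<bar>v\<bar> + 10 \<le> \<tau> + \<bar>w\<bar>" by (auto simp: \<tau>_def w_def)
      also have "\<dots> \<le> \<tau> * (1 + \<bar>w\<bar>)" by (simp add: \<tau>_def algebra_simps)
      finally have b: "\<bar>v\<bar> + 10 \<le> \<tau> * (1 + \<bar>w\<bar>)" .
      have "(\<bar>v\<bar> + 10) powr e \<le> (\<tau> * (1 + \<bar>w\<bar>)) powr e"
        using b e by (intro powr_mono2) auto
      also have "\<dots> = \<tau> powr e * (1 + \<bar>w\<bar>) powr e" by (rule powr_mult)
      also have "\<dots> \<le> \<tau> powr e * (1 + \<bar>w\<bar>) powr 1"
        using e by (intro mult_left_mono powr_mono) auto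
      finally have c: "(\<bar>v\<bar> + 10) powr e \<le> \<tau> powr e * (1 + \<bar>w\<bar>)" by simp
      have "norm (zeta (Complex c v)) \<le> K * (1 + \<bar>v\<bar>) ^ d * (\<bar>v\<bar> + 10) powr e" by (rule zc)
      also have "\<dots> \<le> K * (\<tau> * (1 + \<bar>w\<bar>)) ^ d * (\<tau> powr e * (1 + \<bar>w\<bar>))"
        using a c K0 by (intro mult_mono power_mono) auto
      also have "\<dots> = K * (\<tau> powr (real d + e) * (1 + \<bar>w\<bar>) ^ (d + 1))"
        by (simp add: powr_add powr_realpow \<tau>_def power_mult_distrib mult_ac)
      finally show ?thesis .
    qed
    \<comment> \<open>The \<open>d + 1\<close> powers come from zeta, with \<open>e \<le> 1\<close>
      rounded up; two further powers are taken from the Gaussian for an integrable majorant, hence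
      \<open>d + 3\<close> in \<open>E\<close>.\<close>
    have 4: "(1 + \<bar>w\<bar>) ^ (d + 1) * exp (- (w ^ 2)) \<le> E * (1 + \<bar>w\<bar>) powr (- 1 - 1)"
    proof -
      have "((1 + \<bar>w\<bar>) ^ (d + 1) * exp (- (w ^ 2))) * (1 + \<bar>w\<bar>) ^ 2 = (1 + \<bar>w\<bar>) ^ (d + 3) * exp (- (w ^ 2))"
        by (simp add: power_add[symmetric] mult_ac numeral_3_eq_3 numeral_2_eq_2)
      also have "\<dots> \<le> E" unfolding E_def by (rule power_mult_exp_neg_square_le)
      finally have "(1 + \<bar>w\<bar>) ^ (d + 1) * exp (- (w ^ 2)) \<le> E / (1 + \<bar>w\<bar>) ^ 2"
        by (subst pos_le_divide_eq) auto
      thus ?thesis by (simp add: powr_minus divide_inverse)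
    qed
    have "norm ?L \<le> (K * (\<tau> powr (real d + e) * (1 + \<bar>w\<bar>) ^ (d + 1))) *
        (N powr (c - \<sigma>) * exp ((c - \<sigma>) ^ 2) * exp (- (w ^ 2))) / \<bar>c - \<sigma>\<bar>"
      unfolding norm_divide norm_mult 1
    proof (rule frac_le)
      show "norm (zeta (Complex c v)) * (N powr (c - \<sigma>) * exp ((c - \<sigma>) ^ 2) * exp (- (w ^ 2)))
          \<le> (K * (\<tau> powr (real d + e) * (1 + \<bar>w\<bar>) ^ (d + 1))) * (N powr (c - \<sigma>) * exp ((c - \<sigma>) ^ 2) * exp (- (w ^ 2)))"
        by (rule mult_right_mono[OF 3]) simp
      show "0 \<le> (K * (\<tau> powr (real d + e) * (1 + \<bar>w\<bar>) ^ (d + 1))) * (N powr (c - \<sigma>) * exp ((c - \<sigma>) ^ 2) * exp (- (w ^ 2)))"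
        using K0 by (intro mult_nonneg_nonneg) simp_all
    qed (use 2 c in auto)
    also have "\<dots> = K * \<tau> powr (real d + e) * N powr (c - \<sigma>) * F * ((1 + \<bar>w\<bar>) ^ (d + 1) * exp (- (w ^ 2)))"
      by (simp add: F_def)
    also have "\<dots> \<le> K * \<tau> powr (real d + e) * N powr (c - \<sigma>) * F * (E * (1 + \<bar>w\<bar>) powr (- 1 - 1))"
      using K0 4 by (intro mult_left_mono) (auto simp: F_def)
    finally show ?thesis by (simp add: w_def mult_ac)
  qed
  from norm_integral_powr_tail_le[OF zero_less_one this]
  show ?thesis by (simp add: E_def F_def \<tau>_def mult_ac)
qed

text \<open>The Gaussian factor makes the residue theorem applicable on the whole strip, so that the
  critical line and a line far to the left are interpolated with an exponent that tends to
  \<open>1/2 - \<sigma>\<close> as the left line moves to infinity. This replaces the functional equation.\<close>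

theorem Lindelof_left_of_critical_line:
  assumes LH: "Lindelof_Hypothesis" and \<sigma>: "0 < \<sigma>" "\<sigma> < 1/2" and e: "e > 0" "e \<le> 1"
  obtains C where "C > 0" "\<And>t. norm (zeta (Complex \<sigma> t)) \<le> C * (\<bar>t\<bar> + 10) powr (1/2 - \<sigma> + e)"
proof -
  define \<theta> where "\<theta> = e / 2"
  \<comment> \<open>On the left line the exponent of \<open>\<tau>\<close> will be
    \<open>(A + 3) - (1 + \<theta>) (A + \<sigma>)\<close>. Since \<open>\<theta> A \<ge> 3\<close>,
    the surplus \<open>3\<close> is absorbed.\<close>
  obtain A :: nat where A: "real A \<ge> 3 / \<theta>" using real_arch_simple by blast
  have A0: "A > 0" using A e by (auto simp: \<theta>_def intro!: Nat.gr0I)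
  obtain C1 where C1: "C1 > 0" "\<And>t. norm (zeta (Complex (1/2) t)) \<le> C1 * (\<bar>t\<bar> + 10) powr \<theta>"
    by (rule Lindelof_all_t[OF LH, of "1/2" \<theta>]) (use e in \<open>auto simp: \<theta>_def\<close>)
  obtain C2 where C2: "C2 > 0" "\<And>s. Re s \<ge> - real A \<Longrightarrow> \<bar>Im s\<bar> \<ge> 1 \<or> Re s \<le> 0 \<Longrightarrow> Re s \<le> 1 \<Longrightarrow> norm (zeta s) \<le> C2 * (1 + \<bar>Im s\<bar>) ^ (A + 3)"
    by (rule zeta_strip_bound[of A 1]) blast
  define I2 where "I2 = (LINT t|lborel. (1 + \<bar>t\<bar>) powr (- 1 - 1 :: real))"
  have I2: "I2 \<ge> 0" unfolding I2_def by (intro Bochner_Integration.integral_nonneg) auto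
  define D1 where "D1 = C1 * exp (real (0 + 3) ^ 2 / 4) * exp ((1/2 - \<sigma>) ^ 2) / \<bar>1/2 - \<sigma>\<bar> * I2"
  define D2 where "D2 = C2 * exp (real (A + 3 + 3) ^ 2 / 4) * exp ((- real A - \<sigma>) ^ 2) / \<bar>- real A - \<sigma>\<bar> * I2"
  have D: "D1 \<ge> 0" "D2 \<ge> 0" unfolding D1_def D2_def
    using I2 C1 C2 by (intro mult_nonneg_nonneg divide_nonneg_nonneg; simp)+
  have "norm (zeta (Complex \<sigma> t)) \<le> (D1 + D2) * (\<bar>t\<bar> + 10) powr (1/2 - \<sigma> + e)" for t
  proof -
    define \<tau> where "\<tau> = \<bar>t\<bar> + 10"
    have \<tau>: "\<tau> \<ge> 1" by (simp add: \<tau>_def)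
    \<comment> \<open>A weight \<open>\<tau>^1\<close> would give the sharp exponent
      \<open>1/2 - \<sigma>\<close> from the critical line but would leave the surplus on the left
      line. The extra \<open>\<theta>\<close> in the exponent removes that surplus and costs less
      than \<open>\<theta>\<close> on the critical line; together with the Lindelof loss
      \<open>\<theta>\<close> this stays within \<open>e\<close>.\<close>
    define N where "N = \<tau> powr (1 + \<theta>)"
    have N: "N > 0" "N \<ge> 1" using \<tau> e by (auto simp: N_def \<theta>_def intro!: ge_one_powr_ge_zero)
    define s0 where "s0 = Complex \<sigma> t"
    define H where "H = (\<lambda>s. zeta s * gauss_kernel N (s - s0) / (s - s0))"
    \<comment> \<open>Staying to the left of \<open>Re s = 1\<close> keeps the pole of zeta outside,
      so that \<open>s0\<close> is the only singularity of \<open>H\<close>.\<close>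
    define S where "S = {s. - real A - 1 < Re s \<and> Re s < 1}"
    have opS: "open S"
    proof -
      have "S = {s. Re s > - real A - 1} \<inter> {s. Re s < 1}" by (auto simp: S_def)
      thus ?thesis by (auto intro!: open_Int open_halfspace_Re_gt open_halfspace_Re_lt)
    qed
    have holn: "(\<lambda>s. zeta s * gauss_kernel N (s - s0)) holomorphic_on S"
      unfolding gauss_kernel_def
      by (intro holomorphic_intros holomorphic_on_subset[OF holomorphic_zeta]) (auto simp: S_def)
    have res: "residue H s0 = zeta s0"
      unfolding H_def by (subst residue_simple[OF opS _ holn]) (use \<sigma> in \<open>auto simp: s0_def S_def gauss_kernel_def\<close>)
    have "(LINT v|lborel. H (Complex (1/2) v)) - (LINT v|lborel. H (Complex (- real A) v)) = 2 * pi * (\<Sum>p\<in>{s0}. residue H p)"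
    proof (rule vertical_line_shift(3))
      show "H holomorphic_on {s. - real A - 1 < Re s \<and> Re s < 1} - {s0}"
        unfolding H_def by (intro holomorphic_intros holomorphic_on_subset[OF holn]) (auto simp: S_def)
      \<comment> \<open>\<open>Q\<close> may depend on \<open>t\<close> and on \<open>N\<close>: it
        only justifies the contour shift and does not enter the final bound.\<close>
      define Q where "Q = C2 * exp (real (A + 5) ^ 2 / 4) * \<tau> ^ (A + 5) * (N powr 1 * exp ((real A + 1) ^ 2))"
      fix s assume s: "- real A \<le> Re s" "Re s \<le> 1/2" "\<bar>Im s\<bar> \<ge> \<bar>t\<bar> + 1"
      define w where "w = Im s - t"
      have 1: "norm (zeta s) \<le> C2 * (1 + \<bar>Im s\<bar>) ^ (A + 3)" by (rule C2) (use s in auto)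
      have "norm (gauss_kernel N (s - s0)) = N powr (Re s - \<sigma>) * exp ((Re s - \<sigma>) ^ 2) * exp (- (w ^ 2))"
        by (simp add: norm_gauss_kernel[OF N(1)] w_def s0_def)
      also have "\<dots> \<le> N powr 1 * exp ((real A + 1) ^ 2) * exp (- (w ^ 2))"
      proof (intro mult_right_mono mult_mono)
        show "N powr (Re s - \<sigma>) \<le> N powr 1" using N s \<sigma> by (intro powr_mono) auto
        have "\<bar>Re s - \<sigma>\<bar> \<le> \<bar>real A + 1\<bar>" using s \<sigma> by auto
        thus "exp ((Re s - \<sigma>) ^ 2) \<le> exp ((real A + 1) ^ 2)" by (simp only: exp_le_cancel_iff abs_le_square_iff)
      qed auto
      finally have 2: "norm (gauss_kernel N (s - s0)) \<le> N powr 1 * exp ((real A + 1) ^ 2) * exp (- (w ^ 2))" .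
      have "\<bar>Im s - t\<bar> \<ge> 1" using s by linarith
      hence 3: "1 \<le> norm (s - s0)" using abs_Im_le_cmod[of "s - s0"] by (simp add: s0_def)
      have "norm (H s) \<le> (C2 * (1 + \<bar>Im s\<bar>) ^ (A + 3)) * (N powr 1 * exp ((real A + 1) ^ 2) * exp (- (w ^ 2))) / 1"
        unfolding H_def norm_divide norm_mult using 1 2 3 C2(1) by (intro frac_le mult_mono) auto
      moreover have "(1 + \<bar>Im s\<bar>) ^ (A + 3) * exp (- (w ^ 2)) * Im s ^ 2 \<le> exp (real (A + 5) ^ 2 / 4) * \<tau> ^ (A + 5)"
      proof -
        have "Im s ^ 2 \<le> (1 + \<bar>Im s\<bar>) ^ 2" by (simp add: power2_eq_square algebra_simps)
        hence "(1 + \<bar>Im s\<bar>) ^ (A + 3) * exp (- (w ^ 2)) * Im s ^ 2 \<le> (1 + \<bar>Im s\<bar>) ^ (A + 3) * exp (- (w ^ 2)) * (1 + \<bar>Im s\<bar>) ^ 2"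
          by (intro mult_left_mono) auto
        also have "\<dots> = (1 + \<bar>Im s\<bar>) ^ (A + 5) * exp (- (w ^ 2))"
          by (simp add: power_add[symmetric] mult_ac add.commute)
        also have "\<dots> \<le> (\<tau> * (1 + \<bar>w\<bar>)) ^ (A + 5) * exp (- (w ^ 2))"
        proof (intro mult_right_mono power_mono)
          have "(1 + \<bar>t\<bar>) * (1 + \<bar>w\<bar>) \<le> \<tau> * (1 + \<bar>w\<bar>)" by (intro mult_right_mono) (auto simp: \<tau>_def)
          thus "1 + \<bar>Im s\<bar> \<le> \<tau> * (1 + \<bar>w\<bar>)"
            using one_plus_abs_shift_le[of "Im s" t] by (simp add: w_def)
        qed auto
        also have "\<dots> = \<tau> ^ (A + 5) * ((1 + \<bar>w\<bar>) ^ (A + 5) * exp (- (w ^ 2)))" by (simp only: power_mult_distrib mult.assoc)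
        also have "\<dots> \<le> \<tau> ^ (A + 5) * exp (real (A + 5) ^ 2 / 4)"
          using \<tau> by (intro mult_left_mono power_mult_exp_neg_square_le) auto
        finally show ?thesis by (simp only: mult.commute)
      qed
      hence "C2 * (N powr 1 * exp ((real A + 1) ^ 2)) * ((1 + \<bar>Im s\<bar>) ^ (A + 3) * exp (- (w ^ 2)) * Im s ^ 2)
          \<le> C2 * (N powr 1 * exp ((real A + 1) ^ 2)) * (exp (real (A + 5) ^ 2 / 4) * \<tau> ^ (A + 5))"
        using C2(1) by (intro mult_left_mono) auto
      ultimately have "norm (H s) * Im s ^ 2 \<le> Q"
        using mult_right_mono[of "norm (H s)" "(C2 * (1 + \<bar>Im s\<bar>) ^ (A + 3)) * (N powr 1 * exp ((real A + 1) ^ 2) * exp (- (w ^ 2)))" "Im s ^ 2"]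
        by (simp add: Q_def mult_ac)
      moreover have "Im s ^ 2 > 0" using s by auto
      ultimately show "norm (H s) \<le> Q / Im s ^ 2" by (simp add: field_simps)
    qed (use \<sigma> in \<open>auto simp: s0_def\<close>)
    hence "2 * pi * norm (zeta s0) = norm ((LINT v|lborel. H (Complex (1/2) v)) - (LINT v|lborel. H (Complex (- real A) v)))"
      by (simp add: res norm_mult)
    also have "\<dots> \<le> norm (LINT v|lborel. H (Complex (1/2) v)) + norm (LINT v|lborel. H (Complex (- real A) v))"
      by (rule norm_triangle_ineq4)
    also have "norm (LINT v|lborel. H (Complex (1/2) v)) \<le> D1 * (\<tau> powr (real 0 + \<theta>) * N powr (1/2 - \<sigma>))"
      unfolding H_def s0_def D1_def I2_def \<tau>_def
      by (rule smoothed_zeta_line_bound) (use C1 \<sigma> N e in \<open>auto simp: \<theta>_def\<close>)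
    also have "norm (LINT v|lborel. H (Complex (- real A) v)) \<le> D2 * (\<tau> powr (real (A + 3) + 0) * N powr (- real A - \<sigma>))"
      unfolding H_def s0_def D2_def I2_def \<tau>_def
      by (rule smoothed_zeta_line_bound) (use C2(2)[of "Complex (- real A) _"] \<sigma> N e A0 in auto)
    also have "\<tau> powr (real 0 + \<theta>) * N powr (1/2 - \<sigma>) = \<tau> powr (\<theta> + (1 + \<theta>) * (1/2 - \<sigma>))"
      unfolding N_def powr_powr powr_add[symmetric] by simp
    also have "\<tau> powr (real (A + 3) + 0) * N powr (- real A - \<sigma>) = \<tau> powr (real (A + 3) + (1 + \<theta>) * (- real A - \<sigma>))"
      by (simp only: N_def powr_powr powr_add[symmetric] add_0_right)
    also have "D1 * \<tau> powr (\<theta> + (1 + \<theta>) * (1/2 - \<sigma>)) \<le> D1 * \<tau> powr (1/2 - \<sigma> + e)"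
    proof (intro mult_left_mono powr_mono D)
      have "\<theta> * (1/2 - \<sigma>) \<le> \<theta> * 1" using \<sigma> e by (intro mult_left_mono) (auto simp: \<theta>_def)
      thus "\<theta> + (1 + \<theta>) * (1/2 - \<sigma>) \<le> 1/2 - \<sigma> + e" by (simp add: \<theta>_def algebra_simps)
    qed (use \<tau> in auto)
    also have "D2 * \<tau> powr (real (A + 3) + (1 + \<theta>) * (- real A - \<sigma>)) \<le> D2 * \<tau> powr (1/2 - \<sigma> + e)"
    proof (intro mult_left_mono powr_mono D)
      have "3 \<le> \<theta> * real A" using A e by (simp add: \<theta>_def field_simps)
      moreover have "\<theta> * \<sigma> \<ge> 0" using \<sigma> e by (simp add: \<theta>_def)
      ultimately show "real (A + 3) + (1 + \<theta>) * (- real A - \<sigma>) \<le> 1/2 - \<sigma> + e"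
        using \<sigma> e by (simp add: algebra_simps)
    qed (use \<tau> in auto)
    finally have "2 * pi * norm (zeta s0) \<le> (D1 + D2) * \<tau> powr (1/2 - \<sigma> + e)"
      by (simp only: distrib_right)
    moreover have "1 * norm (zeta s0) \<le> 2 * pi * norm (zeta s0)"
      using pi_gt3 by (intro mult_right_mono) auto
    ultimately show ?thesis by (simp add: s0_def \<tau>_def)
  qed
  hence "norm (zeta (Complex \<sigma> t)) \<le> (D1 + D2 + 1) * (\<bar>t\<bar> + 10) powr (1/2 - \<sigma> + e)" for t
    by (rule order_trans) (intro mult_right_mono, auto)
  moreover have "D1 + D2 + 1 > 0" using D by simp
  ultimately show ?thesis using that by blast
qed

section \<open>A smoothed Perron formula\<close>

text \<open>The average of \<open>exp (w s)\<close> over \<open>w\<close> in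
  \<open>[0, \<delta>]\<close>. The removable singularity at \<open>s = 0\<close> is not filled in,
  so the value there is \<open>0\<close>.\<close>

definition step_factor :: "real \<Rightarrow> complex \<Rightarrow> complex" where
  "step_factor \<delta> s = (exp (of_real \<delta> * s) - 1) / (of_real \<delta> * s)"

text \<open>The unit step at \<open>0\<close>, averaged over \<open>[u, u + \<delta>]\<close>
  repeatedly. Level \<open>0\<close> is already one average, written in closed form so that every
  level is continuous; level \<open>m\<close> therefore corresponds to \<open>Suc m\<close> factors
  \<open>step_factor\<close>.\<close>

primrec smooth_step :: "real \<Rightarrow> nat \<Rightarrow> real \<Rightarrow> real" where
  "smooth_step \<delta> 0 = (\<lambda>u. (max (u + \<delta>) 0 - max u 0) / \<delta>)"
| "smooth_step \<delta> (Suc m) = (\<lambda>u. integral {0..1} (\<lambda>w. smooth_step \<delta> m (u + \<delta> * w)))"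

lemma continuous_smooth_step: "continuous_on UNIV (smooth_step \<delta> m)" if "\<delta> > 0"
proof (induction m)
  case 0
  show ?case using that by (auto intro!: continuous_intros)
next
  case (Suc m)
  have "continuous_on UNIV (\<lambda>u. integral (cbox 0 1) (\<lambda>w. smooth_step \<delta> m (u + \<delta> * w)))"
    by (rule integral_continuous_on_param)
       (auto simp: case_prod_unfold intro!: continuous_intros continuous_on_compose2[OF Suc])
  thus ?case by simp
qed

lemma smooth_step_integrable:
  "\<delta> > 0 \<Longrightarrow> (\<lambda>w. smooth_step \<delta> m (u + \<delta> * w)) integrable_on {0..1}"
  by (intro integrable_continuous_interval continuous_on_compose2[OF continuous_smooth_step])
     (auto intro!: continuous_intros)

lemma smooth_step_mono: "\<delta> > 0 \<Longrightarrow> u \<le> v \<Longrightarrow> smooth_step \<delta> m u \<le> smooth_step \<delta> m v"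
proof (induction m arbitrary: u v)
  case 0
  thus ?case by (auto simp: max_def intro!: divide_right_mono)
next
  case (Suc m)
  show ?case
    by (auto intro!: integral_le smooth_step_integrable Suc)
qed

lemma smooth_step_eq_1: "\<delta> > 0 \<Longrightarrow> u \<ge> 0 \<Longrightarrow> smooth_step \<delta> m u = 1"
proof (induction m arbitrary: u)
  case 0
  thus ?case by simp
next
  case (Suc m)
  have "integral {0..1} (\<lambda>w. smooth_step \<delta> m (u + \<delta> * w)) = integral {0..1::real} (\<lambda>w. 1)"
    using Suc by (intro integral_cong) auto
  thus ?case by simp
qed

lemma smooth_step_eq_0: "\<delta> > 0 \<Longrightarrow> u \<le> - (real m + 1) * \<delta> \<Longrightarrow> smooth_step \<delta> m u = 0"
proof (induction m arbitrary: u)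
  case 0
  thus ?case by simp
next
  case (Suc m)
  have "integral {0..1} (\<lambda>w. smooth_step \<delta> m (u + \<delta> * w)) = integral {0..1::real} (\<lambda>w. 0)"
  proof (intro integral_cong Suc.IH)
    fix w :: real assume w: "w \<in> {0..1}"
    have "\<delta> * w \<le> \<delta>" using w Suc.prems by (auto intro: mult_left_le)
    moreover have "- (real (Suc m) + 1) * \<delta> = - (real m + 1) * \<delta> - \<delta>" by (simp add: algebra_simps)
    ultimately show "u + \<delta> * w \<le> - (real m + 1) * \<delta>" using Suc.prems by linarith
  qed (use Suc.prems in auto)
  thus ?case by simp
qed

lemma smooth_step_range:
  assumes "\<delta> > 0" shows "0 \<le> smooth_step \<delta> m u" "smooth_step \<delta> m u \<le> 1"
proof -
  show "0 \<le> smooth_step \<delta> m u"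
    using smooth_step_mono[OF assms, of "min u (- (real m + 1) * \<delta>)" u m] smooth_step_eq_0[OF assms, of "min u (- (real m + 1) * \<delta>)" m]
    by simp
  show "smooth_step \<delta> m u \<le> 1"
    using smooth_step_mono[OF assms, of u "max u 0" m] smooth_step_eq_1[OF assms, of "max u 0" m]
    by simp
qed

lemma has_integral_exp_segment:
  assumes "\<delta> > 0" "s \<noteq> 0"
  shows "((\<lambda>w. exp (of_real (u + \<delta> * w) * s)) has_integral (exp (of_real u * s) * step_factor \<delta> s)) {0..1}"
proof -
  have "((\<lambda>w. exp (of_real (u + \<delta> * w) * s)) has_integral
      (exp (of_real (u + \<delta> * 1) * s) / (of_real \<delta> * s) - exp (of_real (u + \<delta> * 0) * s) / (of_real \<delta> * s))) {0..1}"
  proof (rule fundamental_theorem_of_calculus)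
    fix x :: real
    have "((\<lambda>z. exp ((of_real u + of_real \<delta> * z) * s) / (of_real \<delta> * s)) has_field_derivative
        (exp ((of_real u + of_real \<delta> * of_real x) * s))) (at (of_real x))"
      using assms by (auto intro!: derivative_eq_intros)
    from has_vector_derivative_real_field[OF this]
    show "((\<lambda>w. exp (of_real (u + \<delta> * w) * s) / (of_real \<delta> * s)) has_vector_derivative
            exp (of_real (u + \<delta> * x) * s)) (at x within {0..1})"
      by (simp add: o_def)
  qed auto
  also have "(exp (of_real (u + \<delta> * 1) * s) / (of_real \<delta> * s) - exp (of_real (u + \<delta> * 0) * s) / (of_real \<delta> * s))
      = exp (of_real u * s) * step_factor \<delta> s"
    by (simp add: step_factor_def exp_add distrib_right right_diff_distrib diff_divide_distrib)
  finally show ?thesis .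
qed

text \<open>Two regimes: an average of exponentials is no larger than the largest of them, and the
  closed form decays once \<open>|s|\<close> exceeds about \<open>1 / \<delta>\<close>. The first
  bound is free of \<open>\<delta>\<close>, which matters for all but one of the factors in the
  final estimate.\<close>

lemma norm_step_factor_le:
  assumes "\<delta> > 0" "\<delta> \<le> 1" "s \<noteq> 0" "\<bar>Re s\<bar> \<le> R"
  shows "norm (step_factor \<delta> s) \<le> exp R" "norm (step_factor \<delta> s) \<le> 2 * exp R / (\<delta> * norm s)"
proof -
  have le: "\<delta> * w * Re s \<le> R" if "0 \<le> w" "w \<le> 1" for w
  proof -
    have "\<bar>\<delta> * w\<bar> * \<bar>Re s\<bar> \<le> 1 * R"
      using that assms mult_mono[of \<delta> 1 w 1] by (intro mult_mono) (auto simp: abs_mult)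
    thus ?thesis by (metis abs_le_D1 abs_mult mult_1)
  qed
  have "norm (exp (of_real 0 * s) * step_factor \<delta> s) \<le> exp R * measure lborel (cbox 0 (1::real))"
  proof (rule has_integral_bound)
    show "((\<lambda>w. exp (of_real (0 + \<delta> * w) * s)) has_integral (exp (of_real 0 * s) * step_factor \<delta> s)) (cbox 0 1)"
      using has_integral_exp_segment[OF assms(1,3), of 0] by simp
  qed (use le in \<open>auto simp: norm_exp_eq_Re\<close>)
  thus "norm (step_factor \<delta> s) \<le> exp R" by simp
  have "norm (exp (of_real \<delta> * s) - 1) \<le> exp (\<delta> * Re s) + 1"
    using norm_triangle_ineq4[of "exp (of_real \<delta> * s)" 1] by (simp add: norm_exp_eq_Re)
  also have "\<dots> \<le> 2 * exp R"
  proof -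
    have "exp (\<delta> * Re s) \<le> exp R" using le[of 1] by simp
    moreover have "R \<ge> 0" using assms(4) by linarith
    hence "1 \<le> exp R" by simp
    ultimately show ?thesis by linarith
  qed
  finally show "norm (step_factor \<delta> s) \<le> 2 * exp R / (\<delta> * norm s)"
    using assms by (simp add: step_factor_def norm_divide norm_mult divide_right_mono)
qed

lemma norm_Complex_ge: "(1 + \<bar>t\<bar>) / 2 \<le> norm (Complex c t)" if "\<bar>c\<bar> \<ge> 1"
  using abs_Im_le_cmod[of "Complex c t"] abs_Re_le_cmod[of "Complex c t"] that by simp

text \<open>Split \<open>|s|^(-2)\<close> as \<open>|s|^(-1/2)\<close> times
  \<open>|s|^(-3/2)\<close>: the first factor is at most \<open>(n + 1)^(-1/2)\<close> because the
  line is far from \<open>0\<close>, and the second is integrable along the line uniformly in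
  \<open>n\<close>.\<close>

lemma inverse_square_line_tendsto_0:
  assumes g: "\<And>n t. norm (g n t) \<le> 1 / norm (Complex (c n) t) ^ 2"
    and c: "\<And>n. \<bar>c n\<bar> \<ge> real n + 1"
  shows "(\<lambda>n. LINT t|lborel. g n t) \<longlonglongrightarrow> (0 :: complex)"
proof (rule Lim_null_comparison)
  define I where "I = (LINT t|lborel. (1 + \<bar>t\<bar>) powr (- 1 - 1/2 :: real))"
  have "norm (LINT t|lborel. g n t) \<le> (real n + 1) powr (- (1/2)) * (4 * I)" for n
  proof (cases "integrable lborel (g n)")
    case True
    have "norm (LINT t|lborel. g n t) \<le> (LINT t|lborel. (real n + 1) powr (- (1/2)) * (4 * (1 + \<bar>t\<bar>) powr (- 1 - 1/2 :: real)))"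
    proof (intro Bochner_Integration.integral_norm_bound_integral True integrable_mult_right integrable_powr_tail)
      fix t :: real
      define r where "r = norm (Complex (c n) t)"
      have r1: "r \<ge> real n + 1" using abs_Re_le_cmod[of "Complex (c n) t"] c[of n] by (simp add: r_def)
      have r2: "r \<ge> (1 + \<bar>t\<bar>) / 2" unfolding r_def by (rule norm_Complex_ge) (use c[of n] in auto)
      have "1 / r ^ 2 = r powr (- (1/2)) * r powr (- (3/2))"
      proof -
        have "r powr (- (1/2)) * r powr (- (3/2)) = r powr (- 2)" by (simp flip: powr_add)
        thus ?thesis using r1 by (simp add: powr_minus_divide)
      qed
      also have "\<dots> \<le> (real n + 1) powr (- (1/2)) * ((1 + \<bar>t\<bar>) / 2) powr (- (3/2))"
        using r1 r2 by (intro mult_mono powr_mono2') auto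
      also have "((1 + \<bar>t\<bar>) / 2) powr (- (3/2)) = (1 + \<bar>t\<bar>) powr (- (3/2)) * 2 powr (3/2)"
        by (simp add: powr_divide powr_minus_divide)
      also have "2 powr (3/2::real) \<le> 2 powr 2" by (intro powr_mono) auto
      hence "(real n + 1) powr (- (1/2)) * ((1 + \<bar>t\<bar>) powr (- (3/2)) * 2 powr (3/2)) \<le>
          (real n + 1) powr (- (1/2)) * ((1 + \<bar>t\<bar>) powr (- (3/2)) * 4)"
        by (intro mult_left_mono) auto
      finally show "norm (g n t) \<le> (real n + 1) powr (- (1/2)) * (4 * (1 + \<bar>t\<bar>) powr (- 1 - 1/2 :: real))"
        using g[of n t] by (simp add: r_def mult_ac)
    qed auto
    thus ?thesis by (simp add: I_def)
  next
    case False
    have "I \<ge> 0" unfolding I_def by (intro Bochner_Integration.integral_nonneg) auto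
    thus ?thesis using False by (simp add: not_integrable_integral_eq)
  qed
  thus "eventually (\<lambda>n. norm (LINT t|lborel. g n t) \<le> (real n + 1) powr (- (1/2)) * (4 * I)) sequentially"
    by simp
  have "(\<lambda>n. (real n + 1) powr (- (1/2))) \<longlonglongrightarrow> 0"
    by (intro tendsto_neg_powr filterlim_tendsto_add_at_top[OF tendsto_const, of _ _ 1, unfolded add.commute[of 1]] filterlim_real_sequentially) auto
  from tendsto_mult[OF this tendsto_const[of "4 * I"]]
  show "(\<lambda>n. (real n + 1) powr (- (1/2)) * (4 * I)) \<longlonglongrightarrow> 0" by simp
qed

text \<open>For \<open>u \<ge> 0\<close> the line is pushed to minus infinity, where
  \<open>exp (u s)\<close> has modulus at most \<open>1\<close>, and the double pole at
  \<open>0\<close> contributes the residue \<open>u\<close>. For \<open>u < 0\<close> it is pushed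
  to plus infinity without meeting a pole.\<close>

lemma perron_inverse_square:
  assumes c: "c > 0"
  shows "integrable lborel (\<lambda>t. exp (of_real u * Complex c t) / Complex c t ^ 2)" (is ?int)
    "(LINT t|lborel. exp (of_real u * Complex c t) / Complex c t ^ 2) = 2 * pi * max u 0" (is ?val)
proof -
  define H where "H = (\<lambda>s::complex. exp (of_real u * s) / s ^ 2)"
  have bound: "norm (H s) \<le> exp (\<bar>u\<bar> * B) / Im s ^ 2" if "\<bar>Re s\<bar> \<le> B" "\<bar>Im s\<bar> \<ge> 1" for s B
  proof -
    have "u * Re s \<le> \<bar>u\<bar> * \<bar>Re s\<bar>" by (metis abs_ge_self abs_mult)
    also have "\<dots> \<le> \<bar>u\<bar> * B" using that by (intro mult_left_mono) auto
    finally have "u * Re s \<le> \<bar>u\<bar> * B" .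
    moreover have "Im s ^ 2 \<le> norm s ^ 2" using abs_Im_le_cmod[of s] by (metis abs_ge_zero power2_abs power_mono)
    moreover have "Im s ^ 2 > 0" using that by auto
    ultimately show ?thesis
      unfolding H_def norm_divide norm_power by (intro frac_le) (auto simp: norm_exp_eq_Re)
  qed
  have shift_right: "integrable lborel (\<lambda>t. H (Complex c t))"
     "(LINT t|lborel. H (Complex b t)) = (LINT t|lborel. H (Complex c t))" if "b > c" for b
  proof -
    have "H holomorphic_on {s. c / 2 < Re s \<and> Re s < b + 1} - {}"
      unfolding H_def using c by (auto intro!: holomorphic_intros)
    note * = vertical_line_shift[OF _ that _ _ _ this, of 1 "exp (\<bar>u\<bar> * b)"]
    show "integrable lborel (\<lambda>t. H (Complex c t))" by (rule *) (use c that bound in auto)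
    have "(LINT t|lborel. H (Complex b t)) - (LINT t|lborel. H (Complex c t)) = 2 * pi * (\<Sum>p\<in>{}. residue H p)"
      by (rule *) (use c that bound in auto)
    thus "(LINT t|lborel. H (Complex b t)) = (LINT t|lborel. H (Complex c t))" by simp
  qed
  show ?int using shift_right(1)[of "c + 1"] by (simp add: H_def)
  have res: "residue H 0 = of_real u"
  proof -
    have "residue (\<lambda>s. exp (of_real u * s) / s ^ Suc 1) 0 = (deriv ^^ 1) (\<lambda>s. exp (of_real u * s)) 0 / fact 1"
      by (rule residue_holomorphic_over_power'[of UNIV]) (auto intro!: holomorphic_intros)
    also have "deriv (\<lambda>s. exp (of_real u * s)) 0 = of_real u"
      by (rule DERIV_imp_deriv) (auto intro!: derivative_eq_intros)
    ultimately show ?thesis by (simp add: H_def numeral_2_eq_2)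
  qed
  have shift_left: "(LINT t|lborel. H (Complex c t)) - (LINT t|lborel. H (Complex a t)) = 2 * pi * of_real u" if "a < 0" for a
  proof -
    have ac: "a < c" using c that by simp
    have "H holomorphic_on {s. a - 1 < Re s \<and> Re s < c + 1} - {0}"
      unfolding H_def by (auto intro!: holomorphic_intros)
    note * = vertical_line_shift(3)[OF _ ac _ _ _ this, of 1 "exp (\<bar>u\<bar> * (c - a))"]
    have "(LINT t|lborel. H (Complex c t)) - (LINT t|lborel. H (Complex a t)) = 2 * pi * (\<Sum>p\<in>{0}. residue H p)"
      by (rule *) (use c that in \<open>auto intro!: bound\<close>)
    thus ?thesis using res by simp
  qed
  show ?val
  proof (cases "u \<ge> 0")
    case True
    have "(\<lambda>n. LINT t|lborel. H (Complex (- real n - 1) t)) \<longlonglongrightarrow> 0"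
    proof (rule inverse_square_line_tendsto_0)
      show "norm (H (Complex (- real n - 1) t)) \<le> 1 / norm (Complex (- real n - 1) t) ^ 2" for n t
        unfolding H_def norm_divide norm_power using True
        by (intro divide_right_mono) (auto simp: norm_exp_eq_Re mult_nonneg_nonpos)
    qed auto
    moreover have "(LINT t|lborel. H (Complex (- real n - 1) t)) = (LINT t|lborel. H (Complex c t)) - 2 * pi * of_real u" for n
      using shift_left[of "- real n - 1"] by (simp add: algebra_simps)
    ultimately have "(\<lambda>n::nat. (LINT t|lborel. H (Complex c t)) - 2 * pi * of_real u) \<longlonglongrightarrow> 0" by simp
    hence "(LINT t|lborel. H (Complex c t)) = 2 * pi * of_real u"
      by (simp add: LIMSEQ_const_iff)
    thus ?thesis using True by (simp add: H_def)
  next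
    case False
    have "(\<lambda>n. LINT t|lborel. H (Complex (c + real n + 1) t)) \<longlonglongrightarrow> 0"
    proof (rule inverse_square_line_tendsto_0)
      show "norm (H (Complex (c + real n + 1) t)) \<le> 1 / norm (Complex (c + real n + 1) t) ^ 2" for n t
        unfolding H_def norm_divide norm_power using False c
        by (intro divide_right_mono) (auto simp: norm_exp_eq_Re mult_nonpos_nonneg)
    qed (use c in auto)
    moreover have "(LINT t|lborel. H (Complex (c + real n + 1) t)) = (LINT t|lborel. H (Complex c t))" for n
      by (rule shift_right(2)) auto
    ultimately have "(\<lambda>n::nat. LINT t|lborel. H (Complex c t)) \<longlonglongrightarrow> 0" by simp
    hence "(LINT t|lborel. H (Complex c t)) = 0"
      by (simp add: LIMSEQ_const_iff)
    thus ?thesis using False by (simp add: H_def)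
  qed
qed

lemma continuous_on_Complex_line: "continuous_on A (Complex c)"
  unfolding Complex_eq [abs_def] by (intro continuous_intros)

lemma Complex_line_nz: "c > 0 \<Longrightarrow> Complex c t \<noteq> 0"
  by (simp add: complex_eq_iff)

lemma integrable_step_kernel:
  assumes c: "c > 0" and \<delta>: "\<delta> > 0" "\<delta> \<le> 1"
  shows "integrable lborel (\<lambda>t. exp (of_real u * Complex c t) * step_factor \<delta> (Complex c t) ^ Suc m / Complex c t)"
proof (rule integrable_quadratic_decay[where ?T0.0 = 1 and C = "exp (u * c) * (exp c ^ m * (2 * exp c / \<delta>))"])
  show "continuous_on UNIV (\<lambda>t. exp (of_real u * Complex c t) * step_factor \<delta> (Complex c t) ^ Suc m / Complex c t)"
    unfolding step_factor_def using Complex_line_nz[OF c] \<delta>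
    by (intro continuous_intros continuous_on_Complex_line) auto
next
  fix t :: real assume t: "1 \<le> \<bar>t\<bar>"
  define s where "s = Complex c t"
  have s: "s \<noteq> 0" "\<bar>Re s\<bar> \<le> c" "\<bar>t\<bar> \<le> norm s"
    using Complex_line_nz[OF c, of t] c abs_Im_le_cmod[of s] by (auto simp: s_def)
  have "norm (exp (of_real u * s) * step_factor \<delta> s ^ Suc m / s)
      \<le> exp (u * c) * (exp c ^ m * (2 * exp c / (\<delta> * norm s))) / norm s"
    unfolding norm_divide norm_mult norm_power power_Suc2 using norm_step_factor_le[OF \<delta> s(1,2)] s(1)
    by (intro divide_right_mono mult_mono power_mono) (auto simp: norm_exp_eq_Re s_def)
  also have "\<dots> = exp (u * c) * (exp c ^ m * (2 * exp c / \<delta>)) / (norm s) ^ 2"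
    by (simp add: power2_eq_square)
  also have "\<dots> \<le> exp (u * c) * (exp c ^ m * (2 * exp c / \<delta>)) / t ^ 2"
  proof (intro divide_left_mono)
    have "\<bar>t\<bar> ^ 2 \<le> norm s ^ 2" using s by (intro power_mono) auto
    thus "t ^ 2 \<le> norm s ^ 2" by simp
  qed (use t s \<delta> in auto)
  finally show "norm (exp (of_real u * Complex c t) * step_factor \<delta> (Complex c t) ^ Suc m / Complex c t)
      \<le> exp (u * c) * (exp c ^ m * (2 * exp c / \<delta>)) / t\<^sup>2" by (simp add: s_def)
qed auto

text \<open>One more average in \<open>u\<close> is one more \<open>step_factor\<close> under the
  integral. The base case is the difference quotient of \<open>perron_inverse_square\<close> with
  step \<open>\<delta>\<close>, which turns \<open>max u 0\<close> into the averaged step.\<close>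

theorem smooth_step_perron:
  assumes c: "c > 0" and \<delta>: "\<delta> > 0" "\<delta> \<le> 1"
  shows "(LINT t|lborel. exp (of_real u * Complex c t) * step_factor \<delta> (Complex c t) ^ Suc m / Complex c t)
       = 2 * pi * smooth_step \<delta> m u"
proof (induction m arbitrary: u)
  case 0
  have "exp (of_real u * Complex c t) * step_factor \<delta> (Complex c t) ^ Suc 0 / Complex c t =
     (exp (of_real (u + \<delta>) * Complex c t) / Complex c t ^ 2 - exp (of_real u * Complex c t) / Complex c t ^ 2) / of_real \<delta>" for t
    using \<delta> by (simp add: step_factor_def exp_add distrib_right divide_simps power2_eq_square right_diff_distrib)
  hence "(LINT t|lborel. exp (of_real u * Complex c t) * step_factor \<delta> (Complex c t) ^ Suc 0 / Complex c t)
      = ((LINT t|lborel. exp (of_real (u + \<delta>) * Complex c t) / Complex c t ^ 2)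
         - (LINT t|lborel. exp (of_real u * Complex c t) / Complex c t ^ 2)) / of_real \<delta>"
    using perron_inverse_square(1)[OF c] by (simp del: of_real_add)
  also have "\<dots> = 2 * pi * smooth_step \<delta> 0 u"
    unfolding perron_inverse_square(2)[OF c] by (simp add: diff_divide_distrib right_diff_distrib)
  finally show ?case .
next
  case (Suc m)
  define g where "g = (\<lambda>t. step_factor \<delta> (Complex c t) ^ Suc m / Complex c t)"
  define f where "f = (\<lambda>w t. indicator {0..1} w *\<^sub>R (exp (of_real (u + \<delta> * w) * Complex c t) * g t))"
  have cg: "continuous_on UNIV g"
    unfolding g_def step_factor_def using Complex_line_nz[OF c] \<delta>
    by (intro continuous_intros continuous_on_Complex_line) auto
  have intg: "integrable lborel (\<lambda>t. exp (of_real v * Complex c t) * g t)" for v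
    using integrable_step_kernel[OF c \<delta>, of v m] by (simp add: g_def)
  have IH: "(LINT t|lborel. exp (of_real v * Complex c t) * g t) = 2 * pi * smooth_step \<delta> m v" for v
    using Suc.IH[of v] by (simp add: g_def)
  \<comment> \<open>On the line the exponential has modulus independent of \<open>t\<close>, so the
    double integral of the norm splits into a compactly supported function of \<open>w\<close> and
    the integral of \<open>norm (g t)\<close>.\<close>
  have F: "integrable (lborel \<Otimes>\<^sub>M lborel) (case_prod f)"
  proof (rule lborel_pair.Fubini_integrable)
    have "continuous_on UNIV (\<lambda>x::real\<times>real. exp (of_real (u + \<delta> * fst x) * Complex c (snd x)) * g (snd x))"
      by (intro continuous_intros continuous_on_compose2[OF cg] continuous_on_compose2[OF continuous_on_Complex_line[of UNIV]]) auto
    hence "(\<lambda>x::real\<times>real. exp (of_real (u + \<delta> * fst x) * Complex c (snd x)) * g (snd x)) \<in> borel_measurable borel"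
      by (rule borel_measurable_continuous_onI)
    hence "(\<lambda>x::real\<times>real. indicator {0..1} (fst x) *\<^sub>R (exp (of_real (u + \<delta> * fst x) * Complex c (snd x)) * g (snd x))) \<in> borel_measurable borel"
    proof (rule borel_measurable_scaleR[rotated])
      have "(\<lambda>x. indicator {0..1} (fst x)) = (indicator ({0..1} \<times> UNIV) :: real \<times> real \<Rightarrow> real)"
        by (auto simp: indicator_def fun_eq_iff)
      moreover have "closed ({0..1::real} \<times> (UNIV :: real set))" by (intro closed_Times) auto
      ultimately show "(\<lambda>x::real\<times>real. indicator {0..1} (fst x) :: real) \<in> borel_measurable borel"
        by (simp add: borel_measurable_indicator borel_closed)
    qed
    thus "case_prod f \<in> borel_measurable (lborel \<Otimes>\<^sub>M lborel)"
      by (simp add: lborel_prod f_def case_prod_unfold)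
    show "AE x in lborel. integrable lborel (\<lambda>y. case (x, y) of (x, y) \<Rightarrow> f x y)"
      by (intro AE_I2) (simp add: f_def intg del: of_real_add of_real_mult)
    have "(LINT y|lborel. norm (case (w, y) of (x, y) \<Rightarrow> f x y)) = indicator {0..1} w *\<^sub>R (exp ((u + \<delta> * w) * c) * (LINT t|lborel. norm (g t)))" for w
      by (simp add: f_def norm_mult norm_exp_eq_Re)
    moreover have "integrable lborel (\<lambda>w. indicator {0..1} w *\<^sub>R (exp ((u + \<delta> * w) * c) * (LINT t|lborel. norm (g t))))"
      by (rule borel_integrable_compact) (auto intro!: continuous_intros)
    ultimately show "integrable lborel (\<lambda>x. LINT y|lborel. norm (case (x, y) of (x, y) \<Rightarrow> f x y))" by simp
  qed
  have seg: "(LINT w|lborel. indicator {0..1} w *\<^sub>R h w) = integral {0..1} h" if "continuous_on {0..1} h" for h :: "real \<Rightarrow> complex"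
    using set_borel_integral_eq_integral(2)[of "{0..1}" h] borel_integrable_compact[of "{0..1}" h] that
    by (simp add: set_lebesgue_integral_def set_integrable_def)
  have "(LINT t|lborel. exp (of_real u * Complex c t) * step_factor \<delta> (Complex c t) ^ Suc (Suc m) / Complex c t)
      = (LINT t|lborel. LINT w|lborel. f w t)"
  proof (intro Bochner_Integration.integral_cong refl)
    fix t :: real
    have "(LINT w|lborel. f w t) = integral {0..1} (\<lambda>w. exp (of_real (u + \<delta> * w) * Complex c t) * g t)"
      unfolding f_def by (rule seg) (intro continuous_intros)
    also have "\<dots> = integral {0..1} (\<lambda>w. exp (of_real (u + \<delta> * w) * Complex c t)) * g t"
      by simp
    also have "integral {0..1} (\<lambda>w. exp (of_real (u + \<delta> * w) * Complex c t)) = exp (of_real u * Complex c t) * step_factor \<delta> (Complex c t)"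
      by (rule integral_unique[OF has_integral_exp_segment]) (use \<delta> Complex_line_nz[OF c] in auto)
    finally show "exp (of_real u * Complex c t) * step_factor \<delta> (Complex c t) ^ Suc (Suc m) / Complex c t = (LINT w|lborel. f w t)"
      by (simp add: g_def)
  qed
  also have "\<dots> = (LINT w|lborel. LINT t|lborel. f w t)"
    by (rule lborel_pair.Fubini_integral[OF F])
  also have "\<dots> = (LINT w|lborel. indicator {0..1} w *\<^sub>R complex_of_real (2 * pi * smooth_step \<delta> m (u + \<delta> * w)))"
    by (intro Bochner_Integration.integral_cong refl) (simp only: f_def integral_scaleR_right IH)
  also have "\<dots> = integral {0..1} (\<lambda>w. complex_of_real (2 * pi * smooth_step \<delta> m (u + \<delta> * w)))"
    by (rule seg) (intro continuous_intros continuous_on_compose2[OF continuous_smooth_step[OF \<delta>(1)]], auto)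
  also have "\<dots> = of_real (integral {0..1} (\<lambda>w. 2 * pi * smooth_step \<delta> m (u + \<delta> * w)))"
    by (intro integral_unique has_integral_of_real integrable_integral integrable_continuous_interval
          continuous_intros continuous_on_compose2[OF continuous_smooth_step[OF \<delta>(1)]]) auto
  finally show ?case by simp
qed

section \<open>Euler products\<close>

lemma has_sum_product_abs:
  fixes f :: "'a \<Rightarrow> complex" and g :: "'b \<Rightarrow> complex"
  assumes f: "(\<lambda>x. norm (f x)) summable_on A" "(f has_sum a) A"
    and g: "(\<lambda>y. norm (g y)) summable_on B" "(g has_sum b) B"
  shows "(\<lambda>z. norm (f (fst z) * g (snd z))) summable_on A \<times> B"
    "((\<lambda>z. f (fst z) * g (snd z)) has_sum a * b) (A \<times> B)"
proof -
  show 1: "(\<lambda>z. norm (f (fst z) * g (snd z))) summable_on A \<times> B"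
  proof (rule summable_on_SigmaI)
    show "((\<lambda>y. norm (f (fst (x, y)) * g (snd (x, y)))) has_sum (norm (f x) * infsum (\<lambda>y. norm (g y)) B)) B" for x
      using has_sum_cmult_right[OF has_sum_infsum[OF g(1)], of "norm (f x)"] by (simp add: norm_mult)
    show "(\<lambda>x. norm (f x) * infsum (\<lambda>y. norm (g y)) B) summable_on A"
      by (intro summable_on_cmult_left f)
  qed auto
  show "((\<lambda>z. f (fst z) * g (snd z)) has_sum a * b) (A \<times> B)"
  proof (rule has_sum_SigmaI)
    show "((\<lambda>y. f (fst (x, y)) * g (snd (x, y))) has_sum (f x * b)) B" for x
      using has_sum_cmult_right[OF g(2), of "f x"] by simp
    show "((\<lambda>x. f x * b) has_sum a * b) A" by (rule has_sum_cmult_left[OF f(2)])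
    show "(\<lambda>z. f (fst z) * g (snd z)) summable_on A \<times> B" using 1 by (rule abs_summable_summable)
  qed
qed

section \<open>Finite Euler products over numbers with bounded prime factors\<close>

definition smooth_numbers :: "nat \<Rightarrow> nat set" where
  "smooth_numbers N = {n. n > 0 \<and> (\<forall>p. prime p \<longrightarrow> p dvd n \<longrightarrow> p \<le> N)}"

lemma smooth_numbers_0: "smooth_numbers 0 = {1}"
proof -
  have "n = 1" if "n \<in> smooth_numbers 0" for n
  proof (rule ccontr)
    assume "n \<noteq> 1"
    then obtain p where "prime p" "p dvd n" using prime_factor_nat by blast
    thus False using that prime_gt_0_nat[of p] by (auto simp: smooth_numbers_def)
  qed
  thus ?thesis by (auto simp: smooth_numbers_def)
qed

lemma smooth_numbers_superset: "{1..N} \<subseteq> smooth_numbers N"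
  by (auto simp: smooth_numbers_def dest: dvd_imp_le)

lemma smooth_numbers_Suc_not_prime: "\<not> prime (Suc N) \<Longrightarrow> smooth_numbers (Suc N) = smooth_numbers N"
  by (auto simp: smooth_numbers_def le_Suc_eq)

lemma smooth_numbers_Suc_prime:
  assumes p: "prime (Suc N)"
  shows "bij_betw (\<lambda>z. Suc N ^ fst z * snd z) (UNIV \<times> smooth_numbers N) (smooth_numbers (Suc N))"
    "\<And>m. m \<in> smooth_numbers N \<Longrightarrow> coprime (Suc N ^ i) m"
proof -
  have nd: "\<not> Suc N dvd m" if "m \<in> smooth_numbers N" for m
    using that p by (auto simp: smooth_numbers_def)
  show cop: "coprime (Suc N ^ i) m" if "m \<in> smooth_numbers N" for m i
    using nd[OF that] p by (metis coprime_power_left_iff prime_imp_coprime)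
  have inj: "inj_on (\<lambda>z. Suc N ^ fst z * snd z) (UNIV \<times> smooth_numbers N)"
  proof (rule inj_onI)
    fix x y assume xy: "x \<in> UNIV \<times> smooth_numbers N" "y \<in> UNIV \<times> smooth_numbers N"
      "Suc N ^ fst x * snd x = Suc N ^ fst y * snd y"
    have mult: "multiplicity (Suc N) (Suc N ^ fst z * snd z) = fst z" if "z \<in> UNIV \<times> smooth_numbers N" for z
    proof (rule multiplicity_eqI)
      show "Suc N ^ fst z dvd Suc N ^ fst z * snd z" by simp
      show "\<not> Suc N ^ Suc (fst z) dvd Suc N ^ fst z * snd z"
        unfolding power_Suc2 nat_mult_dvd_cancel_disj using nd[of "snd z"] that by auto
    qed
    have "fst x = fst y" using mult[OF xy(1)] mult[OF xy(2)] xy(3) by simp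
    with xy(3) show "x = y" by (auto simp: prod_eq_iff)
  qed
  have "(\<lambda>z. Suc N ^ fst z * snd z) ` (UNIV \<times> smooth_numbers N) = smooth_numbers (Suc N)"
  proof safe
    fix i m :: nat assume m: "m \<in> smooth_numbers N"
    have "q \<le> Suc N" if q: "prime q" "q dvd Suc N ^ i * m" for q
    proof (cases "q dvd m")
      case True thus ?thesis using q m by (auto simp: smooth_numbers_def intro: le_SucI)
    next
      case False
      hence "q dvd Suc N ^ i" using q prime_dvd_mult_iff by blast
      hence "q dvd Suc N" using q prime_dvd_power by blast
      thus ?thesis by (auto dest: dvd_imp_le)
    qed
    thus "Suc N ^ fst (i, m) * snd (i, m) \<in> smooth_numbers (Suc N)"
      using m by (auto simp: smooth_numbers_def)
  next
    fix n assume n: "n \<in> smooth_numbers (Suc N)"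
    hence n0: "n \<noteq> 0" by (auto simp: smooth_numbers_def)
    have "\<not> is_unit (Suc N)" using p by (auto dest: prime_gt_1_nat)
    then obtain i m where m: "n = Suc N ^ i * m" "\<not> Suc N dvd m"
      using multiplicity_decompose'[of n "Suc N"] n0 by metis
    have "m \<in> smooth_numbers N"
      unfolding smooth_numbers_def
    proof safe
      show "m > 0" using m(1) n0 by (auto intro: Nat.gr0I)
      fix q assume q: "prime q" "q dvd m"
      have "q dvd n" using q m(1) by (metis dvd_mult)
      hence "q \<le> Suc N" using n q by (auto simp: smooth_numbers_def)
      moreover have "q \<noteq> Suc N" using q m(2) by auto
      ultimately show "q \<le> N" by simp
    qed
    thus "n \<in> (\<lambda>z. Suc N ^ fst z * snd z) ` (UNIV \<times> smooth_numbers N)"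
      by (intro image_eqI[of _ _ "(i, m)"]) (simp_all add: m(1))
  qed
  with inj show "bij_betw (\<lambda>z. Suc N ^ fst z * snd z) (UNIV \<times> smooth_numbers N) (smooth_numbers (Suc N))"
    by (simp add: bij_betw_def)
qed

definition multiplicative :: "(nat \<Rightarrow> complex) \<Rightarrow> bool" where
  "multiplicative f \<longleftrightarrow> f 1 = 1 \<and> (\<forall>m>0. \<forall>n>0. coprime m n \<longrightarrow> f (m * n) = f m * f n)"

text \<open>Admitting a new prime \<open>p\<close> writes every number uniquely as a power of
  \<open>p\<close> times one built from the earlier primes, so the sum gains the local series at
  \<open>p\<close> as a factor. Absolute summability is carried along because the product of the two
  sums requires it at each step.\<close>

lemma smooth_numbers_has_sum:
  assumes f: "multiplicative f"
    and loc: "\<And>p. prime p \<Longrightarrow> summable (\<lambda>i. norm (f (p ^ i)))"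
  shows "(\<lambda>n. norm (f n)) summable_on smooth_numbers N \<and>
     (f has_sum (\<Prod>p | prime p \<and> p \<le> N. \<Sum>i. f (p ^ i))) (smooth_numbers N)"
proof (induction N)
  case 0
  have e: "{p. prime p \<and> p \<le> (0::nat)} = {}" by (auto dest: prime_gt_0_nat)
  have "f 1 = 1" using f by (simp add: multiplicative_def)
  thus ?case unfolding smooth_numbers_0 e using has_sum_finite[of "{1}" f] by simp
next
  case (Suc N)
  show ?case
  proof (cases "prime (Suc N)")
    case False
    have "{p. prime p \<and> p \<le> Suc N} = {p. prime p \<and> p \<le> N}" using False by (auto simp: le_Suc_eq)
    thus ?thesis using Suc by (simp add: smooth_numbers_Suc_not_prime[OF False])
  next
    case True
    let ?p = "Suc N"
    have pf: "{p. prime p \<and> p \<le> Suc N} = insert ?p {p. prime p \<and> p \<le> N}" using True by (auto simp: le_Suc_eq)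
    have fin: "finite {p. prime p \<and> p \<le> N}" by simp
    have l1: "(\<lambda>i. norm (f (?p ^ i))) summable_on UNIV"
      using norm_summable_imp_summable_on[of "\<lambda>i. norm (f (?p ^ i))"] loc[OF True] by simp
    have l2: "((\<lambda>i. f (?p ^ i)) has_sum (\<Sum>i. f (?p ^ i))) UNIV"
      by (rule norm_summable_imp_has_sum[OF loc[OF True]])
         (intro summable_sums summable_norm_cancel[OF loc[OF True]])
    note prod = has_sum_product_abs[OF l1 l2 conjunct1[OF Suc] conjunct2[OF Suc]]
    have eq: "f (?p ^ fst z) * f (snd z) = f (?p ^ fst z * snd z)" if "z \<in> UNIV \<times> smooth_numbers N" for z
      using f smooth_numbers_Suc_prime(2)[OF True, of "snd z" "fst z"] that
      by (auto simp: multiplicative_def smooth_numbers_def)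
    have "(\<lambda>z. norm (f (?p ^ fst z * snd z))) summable_on UNIV \<times> smooth_numbers N"
      using prod(1) by (subst summable_on_cong[of _ _ "\<lambda>z. norm (f (?p ^ fst z) * f (snd z))"]) (auto simp: eq)
    hence "(\<lambda>n. norm (f n)) summable_on smooth_numbers (Suc N)"
      by (subst (asm) summable_on_reindex_bij_betw[OF smooth_numbers_Suc_prime(1)[OF True], of "\<lambda>n. norm (f n)"])
    moreover have "((\<lambda>z. f (?p ^ fst z * snd z)) has_sum (\<Sum>i. f (?p ^ i)) * (\<Prod>p | prime p \<and> p \<le> N. \<Sum>i. f (p ^ i)))
       (UNIV \<times> smooth_numbers N)"
      using prod(2) by (subst has_sum_cong[of _ _ "\<lambda>z. f (?p ^ fst z) * f (snd z)"]) (auto simp: eq)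
    hence "(f has_sum (\<Sum>i. f (?p ^ i)) * (\<Prod>p | prime p \<and> p \<le> N. \<Sum>i. f (p ^ i))) (smooth_numbers (Suc N))"
      by (subst (asm) has_sum_reindex_bij_betw[OF smooth_numbers_Suc_prime(1)[OF True], of f])
    hence "(f has_sum (\<Prod>p | prime p \<and> p \<le> Suc N. \<Sum>i. f (p ^ i))) (smooth_numbers (Suc N))"
      unfolding pf using fin by (subst prod.insert) auto
    ultimately show ?thesis by blast
  qed
qed

text \<open>The finite product over \<open>p \<le> N\<close> is exactly the sum over the numbers
  with all prime factors at most \<open>N\<close>. These sets contain \<open>{1..N}\<close>, so
  unconditional convergence forces their sums towards the full sum, and no estimate of an infinite
  product is needed.\<close>

lemma euler_product:
  assumes f: "multiplicative f" and sm: "summable (\<lambda>n. norm (f (Suc n)))"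
  shows "(\<lambda>N. \<Prod>p | prime p \<and> p \<le> N. \<Sum>i. f (p ^ i)) \<longlonglongrightarrow> (\<Sum>n. f (Suc n))"
proof -
  have loc: "summable (\<lambda>i. norm (f (p ^ i)))" if p: "prime p" for p
  proof -
    have inj: "inj (\<lambda>i. p ^ i - 1)"
    proof (rule injI)
      fix i j assume "p ^ i - 1 = p ^ j - 1"
      moreover have "p ^ i > 0" "p ^ j > 0" using prime_gt_0_nat[OF p] by simp_all
      ultimately have "p ^ i = p ^ j" by linarith
      thus "i = j" using prime_gt_1_nat[OF p] by (simp add: power_inject_exp)
    qed
    have "summable ((\<lambda>n. norm (f (Suc n))) \<circ> (\<lambda>i. p ^ i - 1))"
      by (rule summable_reindex[OF sm inj]) auto
    moreover have "Suc (p ^ i - 1) = p ^ i" for i using prime_gt_0_nat[OF p] by (intro Suc_diff_1) simp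
    ultimately show ?thesis by (simp only: o_def)
  qed
  note smooth = smooth_numbers_has_sum[OF f loc]
  have bij: "bij_betw Suc UNIV {1..}"
    by (rule bij_betwI[of _ _ _ "\<lambda>n. n - 1"]) auto
  have "((\<lambda>n. f (Suc n)) has_sum (\<Sum>n. f (Suc n))) UNIV"
    by (rule norm_summable_imp_has_sum[OF sm]) (intro summable_sums summable_norm_cancel[OF sm])
  hence tot: "(f has_sum (\<Sum>n. f (Suc n))) {1..}"
    by (subst (asm) has_sum_reindex_bij_betw[OF bij, of f])
  show ?thesis
  proof (rule LIMSEQ_I)
    fix r :: real assume r: "r > 0"
    \<comment> \<open>Half of \<open>r\<close>, because the limit over finite subsets of the
      infinite set \<open>smooth_numbers N\<close> preserves only a non-strict inequality.\<close>
    have "eventually (\<lambda>X. dist (sum f X) (\<Sum>n. f (Suc n)) < r / 2) (finite_subsets_at_top {1..})"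
      using tot r unfolding has_sum_def by (intro tendstoD) auto
    then obtain X where X': "finite X \<and> X \<subseteq> {1..} \<and>
        (\<forall>Y. finite Y \<and> X \<subseteq> Y \<and> Y \<subseteq> {1..} \<longrightarrow> dist (sum f Y) (\<Sum>n. f (Suc n)) < r / 2)"
      unfolding eventually_finite_subsets_at_top by (rule exE)
    have X: "finite X" "X \<subseteq> {1..}" using X' by blast+
    have X3: "dist (sum f Y) (\<Sum>n. f (Suc n)) < r / 2" if "finite Y" "X \<subseteq> Y" "Y \<subseteq> {1..}" for Y
      using X' that by blast
    define N0 where "N0 = Max X"
    have N0: "x \<le> N0" if "x \<in> X" for x using Max_ge[OF X(1) that] by (simp add: N0_def)
    show "\<exists>no. \<forall>N\<ge>no. norm ((\<Prod>p | prime p \<and> p \<le> N. \<Sum>i. f (p ^ i)) - (\<Sum>n. f (Suc n))) < r"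
    proof (intro exI[of _ N0] allI impI)
      fix N assume N: "N \<ge> N0"
      have XN: "X \<subseteq> smooth_numbers N"
      proof -
        have "x \<in> {1..N}" if "x \<in> X" for x using that X(2) N0[OF that] N by auto
        thus ?thesis using smooth_numbers_superset by blast
      qed
      have sub: "smooth_numbers N \<subseteq> {1..}" by (auto simp: smooth_numbers_def)
      have "(sum f \<longlongrightarrow> (\<Prod>p | prime p \<and> p \<le> N. \<Sum>i. f (p ^ i))) (finite_subsets_at_top (smooth_numbers N))"
        using smooth[of N] by (simp add: has_sum_def)
      hence "((\<lambda>Y. dist (sum f Y) (\<Sum>n. f (Suc n))) \<longlongrightarrow> dist (\<Prod>p | prime p \<and> p \<le> N. \<Sum>i. f (p ^ i)) (\<Sum>n. f (Suc n)))
          (finite_subsets_at_top (smooth_numbers N))"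
        by (rule tendsto_dist[OF _ tendsto_const])
      moreover have "eventually (\<lambda>Y. dist (sum f Y) (\<Sum>n. f (Suc n)) \<le> r / 2) (finite_subsets_at_top (smooth_numbers N))"
        unfolding eventually_finite_subsets_at_top
      proof (intro exI[of _ X] conjI allI impI)
        fix Y assume "finite Y \<and> X \<subseteq> Y \<and> Y \<subseteq> smooth_numbers N"
        thus "dist (sum f Y) (\<Sum>n. f (Suc n)) \<le> r / 2"
          using X3[of Y] order_trans[OF _ sub, of Y] less_imp_le by blast
      qed (rule X(1), rule XN)
      ultimately have "dist (\<Prod>p | prime p \<and> p \<le> N. \<Sum>i. f (p ^ i)) (\<Sum>n. f (Suc n)) \<le> r / 2"
        by (rule tendsto_upperbound) (rule finite_subsets_at_top_neq_bot)
      thus "norm ((\<Prod>p | prime p \<and> p \<le> N. \<Sum>i. f (p ^ i)) - (\<Sum>n. f (Suc n))) < r"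
        using r by (simp add: dist_norm)
    qed
  qed
qed

lemma multiplicative_norm: "multiplicative f \<Longrightarrow> multiplicative (\<lambda>n. of_real (norm (f n)))"
  by (simp add: multiplicative_def norm_mult)

text \<open>Partial sums of the norms are dominated by the sum over numbers with bounded prime
  factors, that is, by a finite product of local sums, which is at most
  \<open>exp (suminf b)\<close>. Global absolute convergence thus follows from local data
  alone.\<close>

lemma multiplicative_summable:
  assumes f: "multiplicative f"
    and loc: "\<And>p. prime p \<Longrightarrow> summable (\<lambda>i. norm (f (p ^ i)))"
    and bd: "\<And>p. prime p \<Longrightarrow> (\<Sum>i. norm (f (p ^ i))) \<le> 1 + b p"
    and b: "\<And>p. b p \<ge> 0" "summable b"
  shows "summable (\<lambda>n. norm (f (Suc n)))"
proof (rule bounded_imp_summable)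
  fix n
  let ?h = "\<lambda>n. complex_of_real (norm (f n))"
  let ?P = "{p. prime p \<and> p \<le> Suc n}"
  have "(?h has_sum (\<Prod>p\<in>?P. \<Sum>i. ?h (p ^ i))) (smooth_numbers (Suc n))"
    using smooth_numbers_has_sum[OF multiplicative_norm[OF f], of "Suc n"] loc by simp
  also have "(\<Prod>p\<in>?P. \<Sum>i. ?h (p ^ i)) = of_real (\<Prod>p\<in>?P. \<Sum>i. norm (f (p ^ i)))"
    using loc by (simp add: suminf_of_real)
  finally have S: "((\<lambda>n. norm (f n)) has_sum (\<Prod>p\<in>?P. \<Sum>i. norm (f (p ^ i)))) (smooth_numbers (Suc n))"
    by (subst (asm) has_sum_of_real_iff)
  have "(\<Sum>i\<le>n. norm (f (Suc i))) = (\<Sum>m\<in>{1..Suc n}. norm (f m))"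
    by (rule sum.reindex_bij_witness[of _ "\<lambda>m. m - 1" Suc]) auto
  also have "\<dots> \<le> (\<Prod>p\<in>?P. \<Sum>i. norm (f (p ^ i)))"
    by (rule has_sum_mono_neutral[OF has_sum_finite S]) (use smooth_numbers_superset[of "Suc n"] in auto)
  also have "\<dots> \<le> (\<Prod>p\<in>?P. 1 + b p)"
    using loc bd by (intro prod_mono conjI suminf_nonneg) auto
  also have "\<dots> \<le> exp (\<Sum>p\<in>?P. b p)" by (rule prod_le_exp_sum) (use b in auto)
  also have "(\<Sum>p\<in>?P. b p) \<le> suminf b" by (rule sum_le_suminf) (use b in auto)
  finally show "(\<Sum>i\<le>n. norm (f (Suc i))) \<le> exp (suminf b)" by simp
qed auto

lemma of_nat_powr_power:
  fixes s :: complex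
  assumes "p > 0"
  shows "of_nat (p ^ i) powr s = (of_nat p powr s) ^ i"
    "of_nat p powr (of_nat j * s) = (of_nat p powr s) ^ j"
proof -
  show "of_nat p powr (of_nat j * s) = (of_nat p powr s) ^ j"
    using assms by (simp add: powr_def exp_of_nat_mult[symmetric] mult_ac)
  have "of_nat (p ^ i) powr s = exp (s * of_real (ln (real (p ^ i))))"
    using assms by (simp only: powr_def of_nat_eq_0_iff) (simp add: Ln_of_nat flip: of_nat_power)
  also have "\<dots> = (exp (s * of_real (ln (real p)))) ^ i"
    using assms by (simp add: ln_realpow exp_of_nat_mult[symmetric] mult_ac)
  also have "exp (s * of_real (ln (real p))) = of_nat p powr s"
    using assms by (simp add: powr_def Ln_of_nat)
  finally show "of_nat (p ^ i) powr s = (of_nat p powr s) ^ i" .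
qed

lemma of_nat_mult_powr:
  "of_nat (m * n) powr s = of_nat m powr s * (of_nat n powr s :: complex)"
  unfolding of_nat_mult by (rule powr_times_real) auto

lemma norm_prime_powr_less_1:
  assumes "prime p" "Re s > 0"
  shows "norm (of_nat p powr (- s)) = real p powr (- Re s)" "real p powr (- Re s) < 1"
  using assms prime_gt_1_nat[of p] by (auto simp: norm_powr_real_powr powr_less_one)

section \<open>Euler factors of the \<open>k\<close>-full indicator and of zeta\<close>

lemma multiplicative_kfull: "multiplicative (\<lambda>n. kfull_ind k n * of_nat n powr (- s))"
proof -
  have "kfull k (m * n) \<longleftrightarrow> kfull k m \<and> kfull k n" if mn: "m > 0" "n > 0" "coprime m n" for m n
  proof -
    have sp: "p ^ k dvd a" if p: "prime p" "p dvd a" "p ^ k dvd a * b" "coprime a b" for p a b :: nat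
    proof -
      have "coprime (p ^ k) b"
        using p by (metis coprime_common_divisor coprime_power_left_iff not_prime_unit prime_imp_coprime)
      thus ?thesis using p(3) by (simp add: coprime_dvd_mult_left_iff)
    qed
    show ?thesis
    proof safe
      assume K: "kfull k (m * n)"
      thus "kfull k m" using mn sp[of _ m n] by (auto simp: kfull_def)
      have "p ^ k dvd n" if "prime p" "p dvd n" for p
        using K that mn sp[of p n m] by (auto simp: kfull_def mult.commute coprime_commute)
      thus "kfull k n" using mn by (auto simp: kfull_def)
    next
      assume "kfull k m" "kfull k n"
      thus "kfull k (m * n)" using mn by (auto simp: kfull_def prime_dvd_mult_iff)
    qed
  qed
  moreover have "kfull k 1" by (auto simp: kfull_def)
  ultimately show ?thesis
    by (auto simp: multiplicative_def kfull_ind_def of_nat_mult_powr simp del: of_nat_mult)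
qed

lemma kfull_prime_power:
  assumes "prime p"
  shows "kfull k (p ^ i) \<longleftrightarrow> i = 0 \<or> k \<le> i"
proof (cases "i = 0")
  case True
  thus ?thesis by (auto simp: kfull_def)
next
  case False
  have "p ^ k dvd p ^ i \<longleftrightarrow> k \<le> i"
    using assms prime_gt_1_nat[of p] by (simp add: dvd_power_iff_le)
  moreover have "kfull k (p ^ i) \<longleftrightarrow> p ^ k dvd p ^ i"
  proof
    assume "kfull k (p ^ i)"
    thus "p ^ k dvd p ^ i" using assms False by (simp add: kfull_def)
  next
    assume dv: "p ^ k dvd p ^ i"
    have "q = p" if "prime q" "q dvd p ^ i" for q
      using that assms prime_dvd_power primes_dvd_imp_eq by blast
    thus "kfull k (p ^ i)" using dv prime_gt_0_nat[OF assms] by (auto simp: kfull_def)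
  qed
  ultimately show ?thesis using False by simp
qed

text \<open>Stated over a general normed field because it is applied both to
  \<open>u = p^(-s)\<close> and to the real number \<open>norm u\<close>.\<close>

lemma kfull_local_series:
  fixes u :: "'a :: {real_normed_field, banach}"
  assumes "norm u < 1" "k > 0"
  shows "(\<lambda>i. of_bool (i = 0 \<or> k \<le> i) * u ^ i) sums (1 + u ^ k / (1 - u))"
proof -
  have "(\<lambda>i. u ^ k * u ^ i) sums (u ^ k * (1 / (1 - u)))"
    by (intro sums_mult geometric_sums assms)
  hence "(\<lambda>i. of_bool (i + k = 0 \<or> k \<le> i + k) * u ^ (i + k)) sums (u ^ k / (1 - u))"
    by (simp add: power_add mult.commute)
  hence "(\<lambda>i. of_bool (i = 0 \<or> k \<le> i) * u ^ i) sums (u ^ k / (1 - u) + (\<Sum>i<k. of_bool (i = 0 \<or> k \<le> i) * u ^ i))"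
    by (subst (asm) sums_iff_shift)
  also have "(\<Sum>i<k. of_bool (i = 0 \<or> k \<le> i) * u ^ i) = (\<Sum>i<k. if i = 0 then 1 else 0)"
    by (intro sum.cong) auto
  also have "\<dots> = 1" using assms by simp
  finally show ?thesis by (simp add: add.commute)
qed

lemma kfull_local_term:
  assumes "prime p"
  shows "kfull_ind k (p ^ i) * of_nat (p ^ i) powr (- s) = of_bool (i = 0 \<or> k \<le> i) * (of_nat p powr (- s)) ^ i"
  using of_nat_powr_power(1)[of p i "- s"] prime_gt_0_nat[OF assms]
  by (simp add: kfull_ind_def kfull_prime_power[OF assms] del: of_nat_power)

lemma kfull_local_summable:
  assumes "prime p" "Re s > 0" "k > 0"
  shows "summable (\<lambda>i. norm (kfull_ind k (p ^ i) * of_nat (p ^ i) powr (- s)))"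
    "(\<Sum>i. norm (kfull_ind k (p ^ i) * of_nat (p ^ i) powr (- s)))
        = 1 + (real p powr (- Re s)) ^ k / (1 - real p powr (- Re s))"
    "(\<Sum>i. kfull_ind k (p ^ i) * of_nat (p ^ i) powr (- s))
        = 1 + (of_nat p powr (- s)) ^ k / (1 - of_nat p powr (- s))"
proof -
  define u where "u = of_nat p powr (- s)"
  have u: "norm u = real p powr (- Re s)" "norm u < 1" using norm_prime_powr_less_1[OF assms(1,2)] by (auto simp: u_def)
  have "(\<lambda>i. of_bool (i = 0 \<or> k \<le> i) * norm u ^ i) sums (1 + norm u ^ k / (1 - norm u))"
    by (rule kfull_local_series) (use u assms in auto)
  moreover have "norm (kfull_ind k (p ^ i) * of_nat (p ^ i) powr (- s)) = of_bool (i = 0 \<or> k \<le> i) * norm u ^ i" for i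
    unfolding kfull_local_term[OF assms(1)] by (simp add: norm_mult norm_power u_def)
  ultimately have "(\<lambda>i. norm (kfull_ind k (p ^ i) * of_nat (p ^ i) powr (- s))) sums (1 + norm u ^ k / (1 - norm u))"
    by simp
  thus "summable (\<lambda>i. norm (kfull_ind k (p ^ i) * of_nat (p ^ i) powr (- s)))"
    "(\<Sum>i. norm (kfull_ind k (p ^ i) * of_nat (p ^ i) powr (- s)))
        = 1 + (real p powr (- Re s)) ^ k / (1 - real p powr (- Re s))"
    unfolding u(1) by (auto simp: sums_iff)
  show "(\<Sum>i. kfull_ind k (p ^ i) * of_nat (p ^ i) powr (- s))
        = 1 + (of_nat p powr (- s)) ^ k / (1 - of_nat p powr (- s))"
    unfolding kfull_local_term[OF assms(1)]
    using kfull_local_series[of u k] u assms by (simp add: sums_iff u_def)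
qed

lemma kfull_series_abs_summable:
  assumes k: "k > 0" and s: "Re s > 1 / real k"
  shows "summable (\<lambda>n. norm (kfull_ind k (Suc n) * of_nat (Suc n) powr (- s)))"
proof -
  have s0: "Re s > 0" using k s by (meson divide_pos_pos less_trans of_nat_0_less_iff zero_less_one)
  \<comment> \<open>The local norm sum is \<open>1 + p^(-k Re s) / (1 - p^(-Re s))\<close>, and the
    denominator is smallest at \<open>p = 2\<close>; \<open>q\<close> is the resulting uniform
    factor in the majorant \<open>b\<close>.\<close>
  define q where "q = 1 / (1 - 2 powr (- Re s))"
  have "2 powr (- Re s) < (1::real)" using s0 by (simp add: powr_less_one)
  hence q: "q > 0" by (simp add: q_def)
  define b where "b = (\<lambda>p::nat. q * real p powr (- (real k * Re s)))"
  show ?thesis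
  proof (rule multiplicative_summable[OF multiplicative_kfull, where b = b])
    fix p :: nat assume p: "prime p"
    show "summable (\<lambda>i. norm (kfull_ind k (p ^ i) * of_nat (p ^ i) powr (- s)))"
      by (rule kfull_local_summable) (use p s0 k in auto)
    have p2: "real p \<ge> 2" using prime_ge_2_nat[OF p] by simp
    have "real p powr (- Re s) \<le> 2 powr (- Re s)" using p2 s0 by (intro powr_mono2') auto
    hence "(real p powr (- Re s)) ^ k / (1 - real p powr (- Re s)) \<le> (real p powr (- Re s)) ^ k / (1 - 2 powr (- Re s))"
      using \<open>2 powr (- Re s) < (1::real)\<close> by (intro divide_left_mono mult_pos_pos) auto
    moreover have "(real p powr (- Re s)) ^ k = real p powr (- (real k * Re s))"
      using p2 by (simp add: powr_realpow[symmetric] powr_powr mult.commute)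
    ultimately show "(\<Sum>i. norm (kfull_ind k (p ^ i) * of_nat (p ^ i) powr (- s))) \<le> 1 + b p"
      unfolding kfull_local_summable(2)[OF p s0 k] by (simp add: b_def q_def)
  next
    have "real k * Re s > 1" using k s by (simp add: field_simps)
    thus "summable b" unfolding b_def by (intro summable_mult) (simp add: summable_real_powr_iff)
  qed (use q in \<open>auto simp: b_def\<close>)
qed

lemma euler_product_kfull:
  assumes k: "k > 0" and s: "Re s > 1 / real k"
  shows "(\<lambda>N. \<Prod>p | prime p \<and> p \<le> N. 1 + (of_nat p powr (- s)) ^ k / (1 - of_nat p powr (- s))) \<longlonglongrightarrow> kfull_series k s"
proof -
  have s0: "Re s > 0" using k s by (meson divide_pos_pos less_trans of_nat_0_less_iff zero_less_one)
  have "(\<Prod>p | prime p \<and> p \<le> N. \<Sum>i. kfull_ind k (p ^ i) * of_nat (p ^ i) powr (- s)) =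
     (\<Prod>p | prime p \<and> p \<le> N. 1 + (of_nat p powr (- s)) ^ k / (1 - of_nat p powr (- s)))" for N
    by (intro prod.cong refl kfull_local_summable(3)) (use s0 k in auto)
  thus ?thesis
    using euler_product[OF multiplicative_kfull kfull_series_abs_summable[OF assms]]
    by (simp add: kfull_series_def)
qed

lemma multiplicative_powr: "multiplicative (\<lambda>n. of_nat n powr (- s))"
  by (auto simp: multiplicative_def of_nat_mult_powr simp del: of_nat_mult)

lemma euler_product_zeta:
  assumes s: "Re s > 1"
  shows "(\<lambda>N. \<Prod>p | prime p \<and> p \<le> N. 1 / (1 - of_nat p powr (- s))) \<longlonglongrightarrow> zeta s"
proof -
  have "(\<Prod>p | prime p \<and> p \<le> N. \<Sum>i. of_nat (p ^ i) powr (- s)) = (\<Prod>p | prime p \<and> p \<le> N. 1 / (1 - of_nat p powr (- s)))" for N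
  proof (intro prod.cong refl)
    fix p assume p: "p \<in> {p. prime p \<and> p \<le> N}"
    hence "norm (of_nat p powr (- s)) < 1" using norm_prime_powr_less_1[of p s] s by simp
    hence "(\<lambda>i. (of_nat p powr (- s)) ^ i) sums (1 / (1 - of_nat p powr (- s)))" by (rule geometric_sums)
    moreover have "p > 0" using p by (auto dest: prime_gt_0_nat)
    ultimately show "(\<Sum>i. of_nat (p ^ i) powr (- s)) = 1 / (1 - of_nat p powr (- s))"
      by (simp add: of_nat_powr_power(1) sums_iff del: of_nat_power)
  qed
  moreover have "(\<Sum>n. of_nat (Suc n) powr (- s)) = zeta s"
    using zeta_sums[OF s] by (simp add: sums_iff)
  ultimately show ?thesis
    using euler_product[OF multiplicative_powr dirichlet_zeta_abs_summable[OF s]] by simp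
qed

section \<open>The factor \<open>G\<^sub>k\<close>\<close>

text \<open>With \<open>u = p^(-s)\<close> this is the Euler factor of \<open>F_k\<close> at
  \<open>p\<close>, divided by those of \<open>zeta (j * s)\<close> for
  \<open>k \<le> j < 2k\<close>.\<close>

definition local_factor :: "nat \<Rightarrow> complex \<Rightarrow> complex" where
  "local_factor k u = (1 + u ^ k / (1 - u)) * (\<Prod>j\<in>{k..<2*k}. 1 - u ^ j)"

text \<open>Every term omitted from the linear part is a product of at least two of the powers
  \<open>u ^ j\<close>, each of degree at least \<open>m\<close>.\<close>

lemma prod_one_minus_power_expansion:
  assumes "finite A" "\<And>j. j \<in> A \<Longrightarrow> m \<le> j"
  shows "\<exists>K\<ge>0. \<forall>u::complex. norm u \<le> 1 \<longrightarrow>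
    norm ((\<Prod>j\<in>A. 1 - u ^ j) - (1 - (\<Sum>j\<in>A. u ^ j))) \<le> K * norm u ^ (2 * m)"
  using assms
proof (induction A rule: finite_induct)
  case empty
  show ?case by (auto intro: exI[of _ 0])
next
  case (insert a A)
  then obtain K where K: "K \<ge> 0" "\<And>u::complex. norm u \<le> 1 \<Longrightarrow>
    norm ((\<Prod>j\<in>A. 1 - u ^ j) - (1 - (\<Sum>j\<in>A. u ^ j))) \<le> K * norm u ^ (2 * m)" by blast
  show ?case
  proof (intro exI[of _ "2 * K + real (card A)"] conjI allI impI)
    fix u :: complex assume u: "norm u \<le> 1"
    define E where "E = (\<Prod>j\<in>A. 1 - u ^ j) - (1 - (\<Sum>j\<in>A. u ^ j))"
    have E: "norm E \<le> K * norm u ^ (2 * m)" unfolding E_def by (rule K(2)[OF u])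
    have S: "norm (\<Sum>j\<in>A. u ^ j) \<le> real (card A) * norm u ^ m"
    proof (rule sum_norm_bound)
      fix j assume "j \<in> A"
      thus "norm (u ^ j) \<le> norm u ^ m" using insert.prems u by (auto simp: norm_power intro!: power_decreasing)
    qed
    have ua: "norm (u ^ a) \<le> norm u ^ m" "norm (u ^ a) \<le> 1"
      using insert.prems u by (auto simp: norm_power power_le_one intro!: power_decreasing)
    have "(\<Prod>j\<in>insert a A. 1 - u ^ j) - (1 - (\<Sum>j\<in>insert a A. u ^ j)) = E * (1 - u ^ a) + u ^ a * (\<Sum>j\<in>A. u ^ j)"
      using insert.hyps by (simp add: E_def algebra_simps)
    also have "norm \<dots> \<le> norm E * norm (1 - u ^ a) + norm (u ^ a) * norm (\<Sum>j\<in>A. u ^ j)"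
      by (intro norm_triangle_le) (simp add: norm_mult)
    also have "norm (1 - u ^ a) \<le> 2" using norm_triangle_ineq4[of 1 "u ^ a"] ua by simp
    hence "norm E * norm (1 - u ^ a) \<le> K * norm u ^ (2 * m) * 2" using E K(1) by (intro mult_mono) auto
    also have "norm (u ^ a) * norm (\<Sum>j\<in>A. u ^ j) \<le> norm u ^ m * (real (card A) * norm u ^ m)"
      using ua S by (intro mult_mono) auto
    also have "K * norm u ^ (2 * m) * 2 + norm u ^ m * (real (card A) * norm u ^ m) = (2 * K + real (card A)) * norm u ^ (2 * m)"
    proof -
      have "norm u ^ (2 * m) = norm u ^ m * norm u ^ m" by (simp add: mult_2 power_add)
      thus ?thesis by (simp add: algebra_simps)
    qed
    finally show "norm ((\<Prod>j\<in>insert a A. 1 - u ^ j) - (1 - (\<Sum>j\<in>insert a A. u ^ j))) \<le> (2 * K + real (card A)) * norm u ^ (2 * m)"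
      by simp
  qed (use K in auto)
qed

lemma one_minus_times_geometric_sum:
  fixes u :: "'a :: comm_ring_1"
  assumes "a \<le> b"
  shows "(1 - u) * (\<Sum>j\<in>{a..<b}. u ^ j) = u ^ a - u ^ b"
  using assms by (induction b rule: dec_induct) (simp_all add: distrib_left, simp add: algebra_simps)

lemma pos_if_mult_gt_one:
  fixes x :: real
  assumes "a \<ge> 0" "a * x > 1"
  shows "x > 0"
proof (rule ccontr)
  assume "\<not> x > 0"
  hence "a * x \<le> 0" using assms by (intro mult_nonneg_nonpos) auto
  thus False using assms by simp
qed

text \<open>Here \<open>v\<close> is \<open>u ^ k\<close> and \<open>W\<close> is
  \<open>1 - u\<close> times the sum of \<open>u ^ j\<close> over \<open>k + 2 \<le> j < 2k\<close>,
  summed geometrically. The left side is \<open>(1 - u)^2 (local_factor k u - 1)\<close> with the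
  product over those \<open>j\<close> linearised. On the right every term contains
  \<open>u^2 v^2 = u^(2k + 2)\<close> or \<open>v^3 = u^(3k)\<close>: all lower powers
  cancel.\<close>

lemma local_factor_identity:
  fixes u v :: complex
  defines "W \<equiv> u ^ 2 * v - v ^ 2"
  shows "(1 - u + v) * (1 - v) * (1 - u * v) * ((1 - u) - W) - (1 - u) ^ 2
     = u ^ 2 * v ^ 2 * (- (u ^ 2) - ((1 - u) - W)) + v ^ 3 * (2 * u ^ 2 - v + u * ((1 - u) - W))"
  unfolding W_def by algebra

text \<open>The order \<open>2k + 2\<close> is what gives \<open>G_k\<close> its abscissa
  \<open>1 / (2k + 2)\<close>. Only the factors for \<open>j = k\<close> and
  \<open>j = k + 1\<close> can contribute to products of degree \<open>2k\<close> or
  \<open>2k + 1\<close>, so these two are kept exactly, while the others are linearised with an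
  error of degree \<open>2k + 4\<close>. Multiplication by \<open>(1 - u)^2\<close> clears the
  denominator and closes the geometric sum; it is undone at the end with
  \<open>|1 - u| \<ge> 1 - r\<close>.\<close>

lemma local_factor_bound:
  assumes k: "k \<ge> 2" and r: "r < 1"
  obtains C where "C \<ge> 0" "\<And>u. norm u \<le> r \<Longrightarrow> norm (local_factor k u - 1) \<le> C * norm u ^ (2 * k + 2)"
proof -
  obtain K where K: "K \<ge> 0" "\<And>u::complex. norm u \<le> 1 \<Longrightarrow>
    norm ((\<Prod>j\<in>{k+2..<2*k}. 1 - u ^ j) - (1 - (\<Sum>j\<in>{k+2..<2*k}. u ^ j))) \<le> K * norm u ^ (2 * (k + 2))"
    using prod_one_minus_power_expansion[of "{k+2..<2*k}" "k + 2"] by auto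
  have bound: "norm (local_factor k u - 1) \<le> (12 + 24 * K) / (1 - r) ^ 2 * norm u ^ (2 * k + 2)" if u: "norm u \<le> r" for u
  proof -
    define v where "v = u ^ k"
    define W where "W = u ^ 2 * v - v ^ 2"
    define P where "P = (\<Prod>j\<in>{k+2..<2*k}. 1 - u ^ j)"
    define E where "E = P - (1 - (\<Sum>j\<in>{k+2..<2*k}. u ^ j))"
    define n where "n = norm u ^ (2 * k + 2)"
    have n: "n \<ge> 0" by (simp add: n_def)
    have u1: "norm u \<le> 1" and v1: "norm v \<le> 1"
      using u r by (auto simp: v_def norm_power power_le_one)
    have W2: "norm W \<le> 2"
    proof -
      have "norm W \<le> norm (u ^ 2 * v) + norm (v ^ 2)" unfolding W_def by (rule norm_triangle_ineq4)
      also have "norm (u ^ 2 * v) \<le> 1 * 1" unfolding norm_mult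
        using u1 v1 by (intro mult_mono) (auto simp: norm_power power_le_one)
      also have "norm (v ^ 2) \<le> 1" using v1 by (simp add: norm_power power_le_one)
      finally show ?thesis by simp
    qed
    have one_u: "norm (1 - u) \<le> 2" using norm_triangle_ineq4[of 1 u] u1 by simp
    have Y4: "norm ((1 - u) - W) \<le> 4" using norm_triangle_ineq4[of "1 - u" W] one_u W2 by simp
    have nz: "u \<noteq> 1" using u r by auto
    have split: "{k..<2*k} = insert k (insert (k + 1) {k+2..<2*k})" using k by auto
    have prod: "(\<Prod>j\<in>{k..<2*k}. 1 - u ^ j) = (1 - v) * ((1 - u * v) * P)"
      unfolding split by (subst prod.insert; simp)+ (simp add: P_def v_def)
    have geo: "(1 - u) * (\<Sum>j\<in>{k+2..<2*k}. u ^ j) = W"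
    proof -
      have "(1 - u) * (\<Sum>j\<in>{k+2..<2*k}. u ^ j) = u ^ (k + 2) - u ^ (2 * k)"
        by (rule one_minus_times_geometric_sum) (use k in auto)
      moreover have "u ^ (k + 2) = u ^ 2 * v" unfolding v_def power_add by (rule mult.commute)
      moreover have "u ^ (2 * k) = v ^ 2" by (simp add: v_def mult.commute flip: power_mult)
      ultimately show ?thesis by (simp add: W_def)
    qed
    have PY: "(1 - u) * P = (1 - u) - W + (1 - u) * E"
      by (simp add: E_def geo[symmetric] algebra_simps)
    have lf: "(1 - u) ^ 2 * (local_factor k u - 1) = (1 - u + v) * (1 - v) * (1 - u * v) * ((1 - u) * P) - (1 - u) ^ 2"
    proof -
      have 1: "(1 - u) ^ 2 * ((1 + w) * ((1 - v) * ((1 - u * v) * P)) - 1)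
          = ((1 - u) * (1 + w)) * (1 - v) * (1 - u * v) * ((1 - u) * P) - (1 - u) ^ 2" for w
        by algebra
      have 2: "(1 - u) * (1 + v / (1 - u)) = 1 - u + v" using nz by (simp add: distrib_left)
      show ?thesis unfolding local_factor_def prod v_def[symmetric] by (simp only: 1 2)
    qed
    have "(1 - u) ^ 2 * (local_factor k u - 1)
        = (u ^ 2 * v ^ 2 * (- (u ^ 2) - ((1 - u) - W)) + v ^ 3 * (2 * u ^ 2 - v + u * ((1 - u) - W)))
          + (1 - u + v) * (1 - v) * (1 - u * v) * ((1 - u) * E)"
    proof -
      have "X * ((1 - u) - W + (1 - u) * E) - (1 - u) ^ 2 = (X * ((1 - u) - W) - (1 - u) ^ 2) + X * ((1 - u) * E)" for X
        by algebra
      thus ?thesis unfolding lf PY by (simp only: local_factor_identity[of u v, folded W_def])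
    qed
    also have "norm \<dots> \<le> norm (u ^ 2 * v ^ 2 * (- (u ^ 2) - ((1 - u) - W))) + norm (v ^ 3 * (2 * u ^ 2 - v + u * ((1 - u) - W)))
          + norm ((1 - u + v) * (1 - v) * (1 - u * v) * ((1 - u) * E))"
      by (intro order_trans[OF norm_triangle_ineq] add_mono norm_triangle_ineq order_refl)
    also have "norm (u ^ 2 * v ^ 2 * (- (u ^ 2) - ((1 - u) - W))) \<le> n * 5"
      unfolding norm_mult
    proof (rule mult_mono)
      have "norm (- (u ^ 2) - ((1 - u) - W)) \<le> norm (- (u ^ 2)) + norm ((1 - u) - W)" by (rule norm_triangle_ineq4)
      moreover have "norm (- (u ^ 2)) \<le> 1" using u1 by (simp add: norm_power power_le_one)
      ultimately show "norm (- (u ^ 2) - ((1 - u) - W)) \<le> 5" using Y4 by linarith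
      have "norm (u ^ 2) * norm (v ^ 2) = n"
        by (simp add: n_def v_def norm_power power_mult[symmetric] power_add[symmetric] mult.commute)
      thus "norm (u\<^sup>2) * norm (v\<^sup>2) \<le> n" by simp
    qed (use n in auto)
    also have "norm (v ^ 3 * (2 * u ^ 2 - v + u * ((1 - u) - W))) \<le> n * 7"
      unfolding norm_mult
    proof (rule mult_mono)
      have "norm (v ^ 3) = norm u ^ (3 * k)" by (simp add: v_def norm_power power_mult[symmetric] mult.commute)
      also have "\<dots> \<le> n" unfolding n_def using u1 k by (intro power_decreasing) auto
      finally show "norm (v ^ 3) \<le> n" .
      have "norm (2 * u ^ 2 - v + u * ((1 - u) - W)) \<le> norm (2 * u ^ 2) + norm v + norm (u * ((1 - u) - W))"
        by (intro order_trans[OF norm_triangle_ineq] add_mono norm_triangle_ineq4 order_refl)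
      also have "norm (2 * u ^ 2) \<le> 2" using u1 by (simp add: norm_mult norm_power power_le_one)
      also have "norm (u * ((1 - u) - W)) \<le> 1 * 4" unfolding norm_mult using u1 Y4 by (intro mult_mono) auto
      finally show "norm (2 * u ^ 2 - v + u * ((1 - u) - W)) \<le> 7" using v1 by simp
    qed (use n in auto)
    also have "norm ((1 - u + v) * (1 - v) * (1 - u * v) * ((1 - u) * E)) \<le> 3 * 2 * 2 * (2 * (K * n))"
      unfolding norm_mult
    proof (intro mult_mono)
      show "norm (1 - u + v) \<le> 3" using norm_triangle_ineq[of "1 - u" v] one_u v1 by simp
      show "norm (1 - v) \<le> 2" using norm_triangle_ineq4[of 1 v] v1 by simp
      have "norm (u * v) \<le> 1" unfolding norm_mult using mult_mono[OF u1 v1] by simp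
      thus "norm (1 - u * v) \<le> 2" using norm_triangle_ineq4[of 1 "u * v"] by simp
      have "norm E \<le> K * norm u ^ (2 * (k + 2))" unfolding E_def P_def by (rule K(2)[OF u1])
      also have "\<dots> \<le> K * n" unfolding n_def using K(1) u1 by (intro mult_left_mono power_decreasing) auto
      finally show "norm E \<le> K * n" .
    qed (use one_u in auto)
    also have "n * 5 + n * 7 + 3 * 2 * 2 * (2 * (K * n)) = (12 + 24 * K) * n" by (simp add: algebra_simps)
    finally have 1: "norm (1 - u) ^ 2 * norm (local_factor k u - 1) \<le> (12 + 24 * K) * n"
      by (simp add: norm_mult norm_power)
    have "1 - r \<le> norm (1 - u)" using norm_triangle_ineq2[of 1 u] u by simp
    hence "(1 - r) ^ 2 \<le> norm (1 - u) ^ 2" using r by (intro power_mono) auto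
    hence "(1 - r) ^ 2 * norm (local_factor k u - 1) \<le> (12 + 24 * K) * n"
      using 1 by (intro order_trans[OF mult_right_mono 1]) auto
    thus ?thesis using r by (simp add: n_def field_simps)
  qed
  show ?thesis
    by (rule that[OF _ bound]) (use K r in auto)
qed

section \<open>The infinite product for \<open>G_k\<close>: convergence, holomorphy,
  boundedness\<close>

definition kfull_G_term :: "nat \<Rightarrow> nat \<Rightarrow> complex \<Rightarrow> complex" where
  "kfull_G_term k n s = (if prime n then local_factor k (of_nat n powr (- s)) else 1)"

definition kfull_G :: "nat \<Rightarrow> complex \<Rightarrow> complex" where
  "kfull_G k s = lim (\<lambda>N. \<Prod>n<N. kfull_G_term k n s)"

lemma kfull_G_term_bound:
  assumes k: "k \<ge> 2" and \<sigma>: "\<sigma> > 0"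
  obtains C where "C \<ge> 0" "\<And>n s. Re s \<ge> \<sigma> \<Longrightarrow> norm (kfull_G_term k n s - 1) \<le> C * real n powr (- (real (2 * k + 2) * \<sigma>))"
proof -
  \<comment> \<open>Since every prime is at least \<open>2\<close>, the single radius
    \<open>2 powr (- \<sigma>)\<close> contains \<open>p^(-s)\<close> for all primes at
    once.\<close>
  have "2 powr (- \<sigma>) < (1::real)" using \<sigma> by (simp add: powr_less_one)
  then obtain C where C: "C \<ge> 0" "\<And>u. norm u \<le> 2 powr (- \<sigma>) \<Longrightarrow> norm (local_factor k u - 1) \<le> C * norm u ^ (2 * k + 2)"
    using local_factor_bound[OF k] by blast
  show ?thesis
  proof (rule that[OF C(1)])
    fix n s assume s: "Re s \<ge> \<sigma>"
    show "norm (kfull_G_term k n s - 1) \<le> C * real n powr (- (real (2 * k + 2) * \<sigma>))"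
    proof (cases "prime n")
      case True
      have n2: "real n \<ge> 2" using prime_ge_2_nat[OF True] by simp
      have nu: "norm (of_nat n powr (- s)) = real n powr (- Re s)"
        by (rule norm_prime_powr_less_1) (use True s \<sigma> in auto)
      have le: "real n powr (- Re s) \<le> real n powr (- \<sigma>)" using n2 s by (intro powr_mono) auto
      also have "\<dots> \<le> 2 powr (- \<sigma>)" using n2 \<sigma> by (intro powr_mono2') auto
      finally have "norm (kfull_G_term k n s - 1) \<le> C * norm (of_nat n powr (- s)) ^ (2 * k + 2)"
        using True C(2)[of "of_nat n powr (- s)"] nu by (simp only: kfull_G_term_def if_True)
      also have "\<dots> \<le> C * (real n powr (- \<sigma>)) ^ (2 * k + 2)"
        unfolding nu using C(1) le by (intro mult_left_mono power_mono) auto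
      also have "(real n powr (- \<sigma>)) ^ (2 * k + 2) = real n powr (- (real (2 * k + 2) * \<sigma>))"
        using n2 by (subst powr_realpow[symmetric]) (simp_all add: powr_powr mult.commute)
      finally show ?thesis .
    qed (use C in \<open>auto simp: kfull_G_term_def\<close>)
  qed
qed

lemma holomorphic_kfull_G_term: "kfull_G_term k n holomorphic_on {s. Re s > 0}"
proof (cases "prime n")
  case True
  have "1 - of_nat n powr (- s) \<noteq> (0::complex)" if "Re s > 0" for s
    using norm_prime_powr_less_1[OF True that] by auto
  moreover have "(\<lambda>s. of_nat n powr (- s) :: complex) holomorphic_on {s. Re s > 0}"
    using prime_gt_0_nat[OF True] by (intro holomorphic_intros) (auto simp: complex_nonpos_Reals_iff)
  ultimately show ?thesis
    unfolding kfull_G_term_def [abs_def] local_factor_def using True by (auto intro!: holomorphic_intros)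
qed (simp add: kfull_G_term_def [abs_def])

lemma kfull_G_uniform:
  assumes k: "k \<ge> 2" and \<sigma>: "real (2 * k + 2) * \<sigma> > 1" and K: "compact K" "K \<subseteq> {s. Re s \<ge> \<sigma>}"
  shows "uniform_limit K (\<lambda>N s. \<Prod>n<N. kfull_G_term k n s) (kfull_G k) sequentially"
proof -
  have \<sigma>0: "\<sigma> > 0" using \<sigma> by (rule pos_if_mult_gt_one[rotated]) simp
  obtain C where C: "C \<ge> 0" "\<And>n s. Re s \<ge> \<sigma> \<Longrightarrow> norm (kfull_G_term k n s - 1) \<le> C * real n powr (- (real (2 * k + 2) * \<sigma>))"
    using kfull_G_term_bound[OF k \<sigma>0] by blast
  have "uniformly_convergent_on K (\<lambda>N s. \<Prod>n<N. kfull_G_term k n s)"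
  proof (rule uniformly_convergent_on_prod'[OF _ K(1)])
    show "continuous_on K (kfull_G_term k n)" for n
      by (rule continuous_on_subset[OF holomorphic_on_imp_continuous_on[OF holomorphic_kfull_G_term]])
         (use K(2) \<sigma>0 in auto)
    show "uniformly_convergent_on K (\<lambda>N s. \<Sum>n<N. norm (kfull_G_term k n s - 1))"
    proof (rule Weierstrass_m_test')
      show "norm (norm (kfull_G_term k n s - 1)) \<le> C * real n powr (- (real (2 * k + 2) * \<sigma>))" if "s \<in> K" for n s
        using C(2)[of s n] that K(2) by auto
      show "summable (\<lambda>n. C * real n powr (- (real (2 * k + 2) * \<sigma>)))"
        using \<sigma> by (intro summable_mult) (simp add: summable_real_powr_iff)
    qed
  qed
  thus ?thesis unfolding uniformly_convergent_uniform_limit_iff kfull_G_def [abs_def] .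
qed

lemma kfull_G_LIMSEQ:
  assumes k: "k \<ge> 2" and s: "real (2 * k + 2) * Re s > 1"
  shows "(\<lambda>N. \<Prod>n<N. kfull_G_term k n s) \<longlonglongrightarrow> kfull_G k s"
  by (rule tendsto_uniform_limitI[OF kfull_G_uniform[OF k s, of "{s}"]]) auto

lemma holomorphic_kfull_G:
  assumes k: "k \<ge> 2"
  shows "kfull_G k holomorphic_on {s. Re s > 1 / real (2 * k + 2)}"
proof (rule holomorphic_uniform_sequence[OF open_Re_gt])
  show "(\<lambda>s. \<Prod>n<N. kfull_G_term k n s) holomorphic_on {s. Re s > 1 / real (2 * k + 2)}" for N
  proof (intro holomorphic_intros holomorphic_on_subset[OF holomorphic_kfull_G_term] subsetI)
    fix s :: complex assume "s \<in> {s. Re s > 1 / real (2 * k + 2)}"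
    moreover have "1 / real (2 * k + 2) > 0" by simp
    ultimately show "s \<in> {s. Re s > 0}" by (simp only: mem_Collect_eq)
  qed
  fix z :: complex assume z: "z \<in> {s. Re s > 1 / real (2 * k + 2)}"
  define c where "c = 1 / real (2 * k + 2)"
  define d where "d = (Re z - c) / 2"
  have d: "d > 0" using z by (simp add: d_def c_def)
  have "Re z - d > c" using z d by (simp add: d_def field_simps)
  hence zd: "Re z - d > 1 / real (2 * k + 2)" by (simp only: c_def)
  have Rew: "Re w \<ge> Re z - d" if "w \<in> cball z d" for w
    using that complex_Re_le_cmod[of "z - w"] by (simp add: dist_norm)
  show "\<exists>d>0. cball z d \<subseteq> {s. Re s > 1 / real (2 * k + 2)} \<and>
      uniform_limit (cball z d) (\<lambda>N s. \<Prod>n<N. kfull_G_term k n s) (kfull_G k) sequentially"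
  proof (intro exI[of _ d] conjI d)
    show "cball z d \<subseteq> {s. Re s > 1 / real (2 * k + 2)}" using Rew zd by force
    show "uniform_limit (cball z d) (\<lambda>N s. \<Prod>n<N. kfull_G_term k n s) (kfull_G k) sequentially"
    proof (rule kfull_G_uniform[OF k])
      show "real (2 * k + 2) * (Re z - d) > 1" using zd by (subst (asm) pos_divide_less_eq) (auto simp: mult.commute)
      show "cball z d \<subseteq> {s. Re z - d \<le> Re s}" using Rew by auto
    qed auto
  qed
qed

text \<open>Locally uniform convergence gives no bound along a vertical line. The majorant of the
  factors depends on \<open>Re s\<close> only, so it bounds the product on the whole closed
  half-plane.\<close>

lemma kfull_G_bounded:
  assumes k: "k \<ge> 2" and \<sigma>: "real (2 * k + 2) * \<sigma> > 1"
  obtains M where "M > 0" "\<And>s. Re s \<ge> \<sigma> \<Longrightarrow> norm (kfull_G k s) \<le> M"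
proof -
  have \<sigma>0: "\<sigma> > 0" using \<sigma> by (rule pos_if_mult_gt_one[rotated]) simp
  obtain C where C: "C \<ge> 0" "\<And>n s. Re s \<ge> \<sigma> \<Longrightarrow> norm (kfull_G_term k n s - 1) \<le> C * real n powr (- (real (2 * k + 2) * \<sigma>))"
    using kfull_G_term_bound[OF k \<sigma>0] by blast
  define b where "b = (\<lambda>n::nat. C * real n powr (- (real (2 * k + 2) * \<sigma>)))"
  have b: "summable b" "\<And>n. b n \<ge> 0" unfolding b_def
    using \<sigma> C(1) by (auto simp: summable_real_powr_iff intro!: summable_mult)
  show ?thesis
  proof (rule that[of "exp (suminf b)"])
    fix s assume s: "Re s \<ge> \<sigma>"
    have "real (2 * k + 2) * \<sigma> \<le> real (2 * k + 2) * Re s" using s by (intro mult_left_mono) auto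
    hence "real (2 * k + 2) * Re s > 1" using \<sigma> by linarith
    from tendsto_norm[OF kfull_G_LIMSEQ[OF k this]]
    show "norm (kfull_G k s) \<le> exp (suminf b)"
    proof (rule tendsto_upperbound)
      have "norm (\<Prod>n<N. kfull_G_term k n s) \<le> exp (suminf b)" for N
      proof -
        have "norm (\<Prod>n<N. kfull_G_term k n s) = (\<Prod>n<N. norm (kfull_G_term k n s))" by (rule prod_norm[symmetric])
        also have "\<dots> \<le> (\<Prod>n<N. 1 + b n)"
        proof (intro prod_mono conjI)
          fix n
          show "norm (kfull_G_term k n s) \<le> 1 + b n"
            using norm_triangle_ineq[of 1 "kfull_G_term k n s - 1"] C(2)[OF s, of n] by (simp add: b_def)
        qed auto
        also have "\<dots> \<le> exp (\<Sum>n<N. b n)" by (rule prod_le_exp_sum) (use b in auto)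
        also have "(\<Sum>n<N. b n) \<le> suminf b" by (rule sum_le_suminf) (use b in auto)
        finally show ?thesis by simp
      qed
      thus "eventually (\<lambda>N. norm (\<Prod>n<N. kfull_G_term k n s) \<le> exp (suminf b)) sequentially" by simp
    qed simp
  qed simp
qed

theorem kfull_series_factorization:
  assumes k: "k \<ge> 2" and s: "Re s > 1 / real k"
  shows "kfull_series k s = kfull_G k s * (\<Prod>j\<in>{k..<2*k}. zeta (of_nat j * s))"
proof -
  define u where "u = (\<lambda>p::nat. of_nat p powr (- s) :: complex)"
  have ks: "real k * Re s > 1" using k s by (simp add: field_simps)
  have s0: "Re s > 0" using ks by (rule pos_if_mult_gt_one[rotated]) simp
  have js: "Re (of_nat j * s) > 1" if "j \<in> {k..<2*k}" for j
  proof -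
    have "real k * Re s \<le> real j * Re s" using that s0 by (intro mult_right_mono) auto
    thus ?thesis using ks by simp
  qed
  \<comment> \<open>Shifted by one so that the range \<open>n < Suc N\<close> matches the primes
    \<open>p \<le> N\<close> of the Euler products; the three products can then be compared prime by
    prime before the limit.\<close>
  have G: "(\<lambda>N. \<Prod>n<Suc N. kfull_G_term k n s) \<longlonglongrightarrow> kfull_G k s"
  proof (rule LIMSEQ_Suc[OF kfull_G_LIMSEQ])
    have "real k * Re s \<le> real (2 * k + 2) * Re s" using s0 by (intro mult_right_mono) auto
    thus "real (2 * k + 2) * Re s > 1" using ks by linarith
  qed fact
  have Z: "(\<lambda>N. \<Prod>j\<in>{k..<2*k}. \<Prod>p | prime p \<and> p \<le> N. 1 / (1 - of_nat p powr (- (of_nat j * s)))) \<longlonglongrightarrow> (\<Prod>j\<in>{k..<2*k}. zeta (of_nat j * s))"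
    by (intro tendsto_prod euler_product_zeta js)
  have "(\<lambda>N. (\<Prod>n<Suc N. kfull_G_term k n s) * (\<Prod>j\<in>{k..<2*k}. \<Prod>p | prime p \<and> p \<le> N. 1 / (1 - of_nat p powr (- (of_nat j * s)))))
     \<longlonglongrightarrow> kfull_G k s * (\<Prod>j\<in>{k..<2*k}. zeta (of_nat j * s))"
    by (rule tendsto_mult[OF G Z])
  moreover have "(\<Prod>n<Suc N. kfull_G_term k n s) * (\<Prod>j\<in>{k..<2*k}. \<Prod>p | prime p \<and> p \<le> N. 1 / (1 - of_nat p powr (- (of_nat j * s))))
      = (\<Prod>p | prime p \<and> p \<le> N. 1 + (of_nat p powr (- s)) ^ k / (1 - of_nat p powr (- s)))" for N
  proof -
    have "(\<Prod>n<Suc N. kfull_G_term k n s) = (\<Prod>p | prime p \<and> p \<le> N. local_factor k (u p))"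
      by (rule prod.mono_neutral_cong_right) (auto simp: kfull_G_term_def u_def)
    moreover have "(\<Prod>j\<in>{k..<2*k}. \<Prod>p | prime p \<and> p \<le> N. 1 / (1 - of_nat p powr (- (of_nat j * s))))
        = (\<Prod>p | prime p \<and> p \<le> N. \<Prod>j\<in>{k..<2*k}. 1 / (1 - u p ^ j))"
    proof (subst prod.swap, intro prod.cong refl)
      fix p j assume "p \<in> {p. prime p \<and> p \<le> N}"
      hence "p > 0" by (auto dest: prime_gt_0_nat)
      thus "1 / (1 - of_nat p powr (- (of_nat j * s))) = 1 / (1 - u p ^ j)"
        using of_nat_powr_power(2)[of p j "- s"] by (simp add: u_def)
    qed
    moreover have "local_factor k (u p) * (\<Prod>j\<in>{k..<2*k}. 1 / (1 - u p ^ j)) = 1 + u p ^ k / (1 - u p)"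
      if "p \<in> {p. prime p \<and> p \<le> N}" for p
    proof -
      have "1 - u p ^ j \<noteq> 0" if "j \<in> {k..<2*k}" for j
      proof -
        have "norm (u p) < 1" using norm_prime_powr_less_1[of p s] \<open>p \<in> _\<close> s0 by (simp add: u_def)
        moreover from this have "norm (u p) ^ j \<le> norm (u p) ^ 1"
          using that k by (intro power_decreasing) auto
        ultimately have "norm (u p ^ j) < 1" by (simp add: norm_power)
        thus ?thesis by auto
      qed
      hence "(\<Prod>j\<in>{k..<2*k}. 1 - u p ^ j) * (\<Prod>j\<in>{k..<2*k}. 1 / (1 - u p ^ j)) = 1"
        by (subst prod.distrib[symmetric]) (simp add: prod.neutral)
      thus ?thesis by (simp add: local_factor_def mult.assoc)
    qed
    ultimately have "(\<Prod>n<Suc N. kfull_G_term k n s) * (\<Prod>j\<in>{k..<2*k}. \<Prod>p | prime p \<and> p \<le> N. 1 / (1 - of_nat p powr (- (of_nat j * s))))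
        = (\<Prod>p | prime p \<and> p \<le> N. 1 + u p ^ k / (1 - u p))"
      by (simp only: prod.distrib[symmetric]) (intro prod.cong refl, blast)
    thus ?thesis by (simp only: u_def)
  qed
  ultimately have "(\<lambda>N. \<Prod>p | prime p \<and> p \<le> N. 1 + (of_nat p powr (- s)) ^ k / (1 - of_nat p powr (- s)))
     \<longlonglongrightarrow> kfull_G k s * (\<Prod>j\<in>{k..<2*k}. zeta (of_nat j * s))" by simp
  moreover have "k > 0" using k by simp
  ultimately show ?thesis using euler_product_kfull[OF _ s] LIMSEQ_unique by blast
qed

section \<open>The continued Dirichlet series\<close>

definition kfull_cont :: "nat \<Rightarrow> complex \<Rightarrow> complex" where
  "kfull_cont k s = kfull_G k s * (\<Prod>j\<in>{k..<2*k}. zeta (of_nat j * s))"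

lemma kfull_cont_meromorphic:
  assumes k: "k \<ge> 2"
  shows "kfull_cont k meromorphic_on {s. Re s > 1 / (2 * real k + 2)}"
proof -
  let ?A = "{s. Re s > 1 / (2 * real k + 2)}"
  obtain Z where Z: "Z holomorphic_on UNIV" "\<And>s. zeta s = Z s / (s - 1)"
    by (rule zeta_entire_numerator) blast
  have "kfull_G k holomorphic_on ?A" using holomorphic_kfull_G[OF k] by (simp add: algebra_simps)
  hence "kfull_G k meromorphic_on ?A"
    by (intro analytic_on_imp_meromorphic_on) (simp add: analytic_on_open open_Re_gt)
  moreover have "(\<lambda>s. zeta (of_nat j * s)) meromorphic_on ?A" for j
  proof -
    have "(\<lambda>s. Z (of_nat j * s)) holomorphic_on UNIV"
      by (rule holomorphic_on_compose_gen[OF _ Z(1), unfolded o_def]) (auto intro!: holomorphic_intros)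
    hence "(\<lambda>s. Z (of_nat j * s)) analytic_on ?A"
      using analytic_on_holomorphic by blast
    moreover have "(\<lambda>s. of_nat j * s - 1 :: complex) analytic_on ?A" by (intro analytic_intros)
    ultimately show ?thesis unfolding Z(2) by (intro meromorphic_on_divide analytic_on_imp_meromorphic_on)
  qed
  ultimately show ?thesis unfolding kfull_cont_def [abs_def]
    by (intro meromorphic_intros)
qed

text \<open>The difference of the chosen continuation and the explicit product vanishes for
  \<open>Re s > 1 / k\<close>. After its removable singularities are filled in, the identity theorem
  on the connected half-plane makes it zero everywhere. Near \<open>p\<close> the two functions
  therefore agree except possibly at \<open>p\<close> itself, which is enough for residues.\<close>

lemma kfull_F_eventually_eq:
  assumes k: "k \<ge> 2" and p: "Re p > 1 / (2 * real k + 2)"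
  shows "eventually (\<lambda>s. kfull_F k s = kfull_cont k s) (at p)"
proof -
  let ?A = "{s. Re s > 1 / (2 * real k + 2)}"
  have ex: "\<exists>F. F meromorphic_on ?A \<and> (\<forall>s. Re s > 1 / real k \<longrightarrow> F s = kfull_series k s)"
    using kfull_cont_meromorphic[OF k] kfull_series_factorization[OF k]
    by (intro exI[of _ "kfull_cont k"]) (auto simp: kfull_cont_def)
  have F: "kfull_F k meromorphic_on ?A" "\<And>s. Re s > 1 / real k \<Longrightarrow> kfull_F k s = kfull_series k s"
    using someI_ex[OF ex] unfolding kfull_F_def by blast+
  define h where "h = (\<lambda>s. kfull_F k s - kfull_cont k s)"
  have h: "h meromorphic_on ?A" unfolding h_def by (intro meromorphic_intros F kfull_cont_meromorphic k)
  have h0: "h s = 0" if "Re s > 1 / real k" for s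
    using F(2)[OF that] kfull_series_factorization[OF k that] by (simp add: h_def kfull_cont_def)
  have sing: "isolated_singularity_at h z" "not_essential h z" if "z \<in> ?A" for z
    using h that by (auto intro: meromorphic_on_isolated_singularity meromorphic_on_not_essential meromorphic_on_subset)
  have "eventually (\<lambda>s. s \<in> {s. Re s > 1 / real k}) (at 1)"
    using k by (intro eventually_at_in_open' open_Re_gt) auto
  hence "eventually (\<lambda>s. h s = 0) (at 1)" by eventually_elim (auto intro: h0)
  moreover have "1 \<in> ?A" using k by auto
  hence "eventually (\<lambda>s. remove_sings h s = h s) (at 1)"
    by (intro eventually_remove_sings_eq_at sing)
  ultimately have "eventually (\<lambda>s. remove_sings h s = 0) (at 1)" by eventually_elim simp
  hence "frequently (\<lambda>s. remove_sings h s = 0) (at 1)" by (intro eventually_frequently) auto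
  from frequently_eq_meromorphic_imp_constant[OF this remove_sings_nicely_meromorphic[OF h] open_Re_gt connected_Re_gt]
  have "remove_sings h s = 0" if "s \<in> ?A" for s
    using that \<open>1 \<in> ?A\<close> by blast
  moreover have "eventually (\<lambda>s. s \<in> ?A) (at p)"
    using p by (intro eventually_at_in_open' open_Re_gt) auto
  moreover have "eventually (\<lambda>s. remove_sings h s = h s) (at p)"
    by (intro eventually_remove_sings_eq_at sing) (use p in auto)
  ultimately show ?thesis by (force elim: eventually_elim2 simp: h_def)
qed

lemma kfull_coeff_eq:
  assumes k: "k \<ge> 2" and j: "j < k"
  shows "kfull_coeff j k = residue (\<lambda>s. kfull_cont k s / s) (1 / of_nat (k + j))"
  unfolding kfull_coeff_def
proof (rule residue_cong[OF _ refl])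
  have "1 / (2 * real k + 2) < 1 / real (k + j)" using k j by (intro divide_strict_left_mono) auto
  also have "1 / real (k + j) = Re (1 / of_nat (k + j))"
    by (metis Re_complex_of_real of_real_1 of_real_divide of_real_of_nat_eq)
  finally have "eventually (\<lambda>s. kfull_F k s = kfull_cont k s) (at (1 / of_nat (k + j)))"
    by (rule kfull_F_eventually_eq[OF k])
  thus "eventually (\<lambda>s. kfull_F k s / s = kfull_cont k s / s) (at (1 / of_nat (k + j)))"
    by (rule eventually_mono) simp
qed

lemma Re_one_divide_nat: "Re (1 / of_nat n) = 1 / real n"
  by (metis Re_complex_of_real of_real_1 of_real_divide of_real_of_nat_eq)

text \<open>The index set is arbitrary so that it serves both the full product, with all its poles,
  and the product with the factor responsible for one pole taken out.\<close>

lemma holomorphic_kfull_cont_factor: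
  assumes k: "k \<ge> 2" and I: "I \<subseteq> {k..<2*k}"
  shows "(\<lambda>s. kfull_G k s * (\<Prod>j\<in>I. zeta (of_nat j * s)))
     holomorphic_on {s. Re s > 1 / (2 * real k + 2)} - (\<lambda>n. 1 / of_nat n) ` I"
proof -
  have G: "kfull_G k holomorphic_on {s. Re s > 1 / (2 * real k + 2)}"
    using holomorphic_kfull_G[OF k] by (simp add: algebra_simps)
  show ?thesis
  proof (intro holomorphic_on_mult holomorphic_on_prod holomorphic_on_subset[OF G])
    fix j assume j: "j \<in> I"
    hence j0: "j > 0" using I k by auto
    show "(\<lambda>s. zeta (of_nat j * s)) holomorphic_on {s. Re s > 1 / (2 * real k + 2)} - (\<lambda>n. 1 / of_nat n) ` I"
    proof (rule holomorphic_on_compose_gen[OF _ holomorphic_zeta, unfolded o_def])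
      have "s = 1 / of_nat j" if "of_nat j * s = (1::complex)" for s
        using that j0 by (simp add: field_simps)
      thus "(*) (of_nat j) ` ({s. Re s > 1 / (2 * real k + 2)} - (\<lambda>n. 1 / of_nat n) ` I) \<subseteq> - {1}"
        using j by (intro image_subsetI) blast
    qed (intro holomorphic_intros)
  qed auto
qed

text \<open>All poles of \<open>F\<^sub>k(s) / s\<close> to the right of \<open>1 / (2k + 2)\<close> are at most simple, so residues
  of a product with a holomorphic factor are obtained by evaluating that factor.\<close>

lemma residue_kfull_cont_mult:
  assumes k: "k \<ge> 2" and j: "j < k" and h: "h holomorphic_on {s. Re s > 1 / (2 * real k + 2)}"
  shows "residue (\<lambda>s. kfull_cont k s / s * h s) (1 / of_nat (k + j)) = kfull_coeff j k * h (1 / of_nat (k + j))"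
proof -
  define n where "n = k + j"
  have n: "n \<in> {k..<2*k}" "n > 0" using k j by (auto simp: n_def)
  define p :: complex where "p = 1 / of_nat n"
  define I where "I = {k..<2*k} - {n}"
  define S where "S = {s. Re s > 1 / (2 * real k + 2)} - (\<lambda>n. 1 / of_nat n) ` I"
  have opS: "open S" unfolding S_def I_def by (intro open_Diff open_Re_gt finite_imp_closed) auto
  have "1 / (2 * real k + 2) < 1 / real n" using n by (intro divide_strict_left_mono) auto
  hence pS: "p \<in> S"
    using n by (auto simp: S_def p_def Re_one_divide_nat I_def divide_simps)
  obtain Z where Z: "Z holomorphic_on UNIV" "\<And>s. zeta s = Z s / (s - 1)"
    by (rule zeta_entire_numerator) blast
  \<comment> \<open>\<open>F_k(s) / s\<close> with its pole at \<open>p\<close> divided out: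
    \<open>zeta (n s) = Z (n s) / (n (s - p))\<close>, where \<open>Z\<close> is entire, and the
    remaining factors are holomorphic at \<open>p\<close>.\<close>
  define q where "q = (\<lambda>s. kfull_G k s * (\<Prod>i\<in>I. zeta (of_nat i * s)) * (Z (of_nat n * s) / of_nat n) / s)"
  have nz: "s \<noteq> 0" if "s \<in> S" for s
  proof
    assume "s = 0"
    with that have "1 / (2 * real k + 2) < 0" by (simp add: S_def)
    moreover have "1 / (2 * real k + 2) > 0" by (intro divide_pos_pos) auto
    ultimately show False by linarith
  qed
  have Zn: "(\<lambda>s. Z (of_nat n * s)) holomorphic_on S"
    by (rule holomorphic_on_compose_gen[OF _ Z(1), unfolded o_def]) (auto intro!: holomorphic_intros)
  have hq: "q holomorphic_on S"
    unfolding q_def using nz n(2) by (intro holomorphic_intros Zn holomorphic_kfull_cont_factor[OF k, of I, folded S_def]) (auto simp: I_def)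
  have eq: "kfull_cont k s / s = q s / (s - p)" for s
  proof -
    have 1: "(\<Prod>i\<in>{k..<2*k}. zeta (of_nat i * s)) = zeta (of_nat n * s) * (\<Prod>i\<in>I. zeta (of_nat i * s))"
      unfolding I_def using n by (intro prod.remove) auto
    have "of_nat n * s - 1 = of_nat n * (s - p)" using n by (simp add: p_def field_simps)
    hence 2: "zeta (of_nat n * s) = Z (of_nat n * s) / (of_nat n * (s - p))" using Z(2)[of "of_nat n * s"] by simp
    show ?thesis unfolding kfull_cont_def q_def 1 2 by (simp add: mult_ac)
  qed
  have 1: "residue (\<lambda>s. kfull_cont k s / s * h s) p = q p * h p"
  proof -
    have "(\<lambda>s. kfull_cont k s / s * h s) = (\<lambda>s. (q s * h s) / (s - p))" by (simp add: eq)
    moreover have "(\<lambda>s. q s * h s) holomorphic_on S"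
      by (intro holomorphic_intros hq holomorphic_on_subset[OF h]) (auto simp: S_def)
    ultimately show ?thesis using residue_simple[OF opS pS, of "\<lambda>s. q s * h s"] by simp
  qed
  have "kfull_coeff j k = q p"
    unfolding kfull_coeff_eq[OF k j] n_def[symmetric] p_def[symmetric] eq by (rule residue_simple[OF opS pS hq])
  thus ?thesis using 1 by (simp add: p_def n_def)
qed

text \<open>Integration term by term is legitimate because on a vertical line the modulus of each
  Dirichlet term is independent of \<open>t\<close>, while the averaged kernel is integrable;
  absolute convergence of the series at \<open>c\<close> is all that is required.\<close>

lemma smoothed_dirichlet_series:
  fixes a :: "nat \<Rightarrow> complex"
  assumes c: "c > 0" and \<delta>: "\<delta> > 0" "\<delta> \<le> 1"
    and sm: "summable (\<lambda>n. norm (a n * of_nat (Suc n) powr (- of_real c)))"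
  shows "(\<lambda>n. a n * of_real (2 * pi * smooth_step \<delta> m (y - ln (real (Suc n))))) sums
    (LINT t|lborel. (\<Sum>n. a n * of_nat (Suc n) powr (- Complex c t)) * (exp (of_real y * Complex c t) * step_factor \<delta> (Complex c t) ^ Suc m / Complex c t))"
proof -
  define g where "g = (\<lambda>t. exp (of_real y * Complex c t) * step_factor \<delta> (Complex c t) ^ Suc m / Complex c t)"
  define f where "f = (\<lambda>n t. a n * of_nat (Suc n) powr (- Complex c t) * g t)"
  have f_eq: "f n t = a n * (exp (of_real (y - ln (real (Suc n))) * Complex c t) * step_factor \<delta> (Complex c t) ^ Suc m / Complex c t)" for n t
  proof -
    have "of_nat (Suc n) powr (- Complex c t) = exp (- (of_real (ln (real (Suc n))) * Complex c t))"
      by (simp add: powr_def Ln_of_nat mult.commute del: of_nat_Suc)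
    moreover have "exp (of_real (y - ln (real (Suc n))) * Complex c t)
        = exp (of_real y * Complex c t) * exp (- (of_real (ln (real (Suc n))) * Complex c t))"
      by (simp add: left_diff_distrib flip: exp_add del: of_nat_Suc)
    ultimately show ?thesis unfolding f_def g_def by (simp only: times_divide_eq_right mult_ac)
  qed
  have nf: "norm (f n t) = norm (a n * of_nat (Suc n) powr (- of_real c)) * norm (g t)" for n t
    by (simp add: f_def norm_mult norm_of_nat_powr del: of_nat_Suc)
  have "(\<lambda>n. integral\<^sup>L lborel (f n)) sums (LINT t|lborel. (\<Sum>n. f n t))"
  proof (rule sums_integral)
    show "integrable lborel (f n)" for n
      unfolding f_eq [abs_def] by (intro integrable_mult_right integrable_step_kernel c \<delta>)
    show "AE t in lborel. summable (\<lambda>n. norm (f n t))"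
      unfolding nf by (intro AE_I2 summable_mult2 sm)
    show "summable (\<lambda>n. LINT t|lborel. norm (f n t))"
      unfolding nf by (simp only: integral_mult_right_zero) (intro summable_mult2 sm)
  qed
  also have "(\<lambda>n. integral\<^sup>L lborel (f n)) = (\<lambda>n. a n * of_real (2 * pi * smooth_step \<delta> m (y - ln (real (Suc n)))))"
    unfolding f_eq [abs_def] by (simp only: integral_mult_right_zero smooth_step_perron[OF c \<delta>])
  also have "(\<lambda>t. \<Sum>n. f n t) = (\<lambda>t. (\<Sum>n. a n * of_nat (Suc n) powr (- Complex c t)) * g t)"
  proof
    fix t
    have "summable (\<lambda>n. a n * of_nat (Suc n) powr (- Complex c t))"
    proof (rule summable_norm_cancel)
      show "summable (\<lambda>n. norm (a n * of_nat (Suc n) powr (- Complex c t)))"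
        using sm by (simp add: norm_mult norm_of_nat_powr del: of_nat_Suc)
    qed
    thus "(\<Sum>n. f n t) = (\<Sum>n. a n * of_nat (Suc n) powr (- Complex c t)) * g t"
      unfolding f_def by (rule suminf_mult2[symmetric])
  qed
  finally show ?thesis by (simp only: g_def)
qed

text \<open>With \<open>A = 0\<close> each of the \<open>k\<close> zeta factors is of degree
  \<open>3\<close> to the right of \<open>Re s = 0\<close>, and \<open>G_k\<close> is bounded. The
  total degree \<open>3k\<close> determines how many averages the contour shift needs.\<close>

lemma kfull_cont_strip_bound:
  assumes k: "k \<ge> 2" and \<sigma>: "\<sigma> > 1 / (2 * real k + 2)"
  obtains C where "C > 0" "\<And>s. \<sigma> \<le> Re s \<Longrightarrow> Re s \<le> 1 \<Longrightarrow> \<bar>Im s\<bar> \<ge> 1 \<Longrightarrow> norm (kfull_cont k s) \<le> C * (1 + \<bar>Im s\<bar>) ^ (3 * k)"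
proof -
  have \<sigma>': "real (2 * k + 2) * \<sigma> > 1" using \<sigma> by (simp add: field_simps)
  have \<sigma>0: "\<sigma> > 0" using pos_if_mult_gt_one[OF _ \<sigma>'] by simp
  obtain M where M: "M > 0" "\<And>s. Re s \<ge> \<sigma> \<Longrightarrow> norm (kfull_G k s) \<le> M"
    using kfull_G_bounded[OF k \<sigma>'] by blast
  obtain K where K: "K > 0" "\<And>s. Re s \<ge> - real 0 \<Longrightarrow> \<bar>Im s\<bar> \<ge> 1 \<or> Re s \<le> 0 \<Longrightarrow> Re s \<le> 2 * real k \<Longrightarrow> norm (zeta s) \<le> K * (1 + \<bar>Im s\<bar>) ^ (0 + 3)"
    by (rule zeta_strip_bound[of 0 "2 * real k"]) blast
  show ?thesis
  proof (rule that[of "M * (K * (2 * real k) ^ 3) ^ k"])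
    show "M * (K * (2 * real k) ^ 3) ^ k > 0" using M K k by simp
    fix s :: complex assume s: "\<sigma> \<le> Re s" "Re s \<le> 1" "\<bar>Im s\<bar> \<ge> 1"
    have z: "norm (zeta (of_nat j * s)) \<le> K * (2 * real k) ^ 3 * (1 + \<bar>Im s\<bar>) ^ 3" if j: "j \<in> {k..<2*k}" for j
    proof -
      have j1: "real j \<ge> 1" "real j \<le> 2 * real k" using j k by auto
      have "1 * 1 \<le> real j * \<bar>Im s\<bar>" using j1 s by (intro mult_mono) auto
      moreover have "real j * Re s \<le> 2 * real k * 1" using j1 s \<sigma>0 by (intro mult_mono) auto
      moreover have "0 \<le> real j * Re s" using s \<sigma>0 by simp
      ultimately have "norm (zeta (of_nat j * s)) \<le> K * (1 + \<bar>Im (of_nat j * s)\<bar>) ^ (0 + 3)"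
        by (intro K(2)) (auto simp: abs_mult)
      also have "1 + \<bar>Im (of_nat j * s)\<bar> \<le> 2 * real k * (1 + \<bar>Im s\<bar>)"
      proof -
        have "1 + real j * \<bar>Im s\<bar> \<le> real j * (1 + \<bar>Im s\<bar>)" using j1 by (simp add: algebra_simps)
        also have "\<dots> \<le> 2 * real k * (1 + \<bar>Im s\<bar>)" using j1 by (intro mult_right_mono) auto
        finally show ?thesis by (simp add: abs_mult)
      qed
      hence "K * (1 + \<bar>Im (of_nat j * s)\<bar>) ^ (0 + 3) \<le> K * (2 * real k * (1 + \<bar>Im s\<bar>)) ^ 3"
        using K(1) unfolding add_0 by (intro mult_left_mono power_mono) auto
      finally show ?thesis by (simp add: power_mult_distrib)
    qed
    have "norm (kfull_cont k s) = norm (kfull_G k s) * (\<Prod>j\<in>{k..<2*k}. norm (zeta (of_nat j * s)))"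
      by (simp add: kfull_cont_def norm_mult prod_norm)
    also have "\<dots> \<le> M * (\<Prod>j\<in>{k..<2*k}. K * (2 * real k) ^ 3 * (1 + \<bar>Im s\<bar>) ^ 3)"
    proof (rule mult_mono)
      show "(\<Prod>j\<in>{k..<2*k}. norm (zeta (of_nat j * s))) \<le> (\<Prod>j\<in>{k..<2*k}. K * (2 * real k) ^ 3 * (1 + \<bar>Im s\<bar>) ^ 3)"
        by (intro prod_mono conjI z norm_ge_zero)
    qed (use M s in \<open>auto intro!: prod_nonneg\<close>)
    also have "\<dots> = M * (K * (2 * real k) ^ 3) ^ k * (1 + \<bar>Im s\<bar>) ^ (3 * k)"
    proof -
      have 1: "(\<Prod>j\<in>{k..<2*k}. Q * p ^ 3) = Q ^ k * p ^ (3 * k)" for Q p :: real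
        by (simp add: power_mult_distrib power_mult)
      show ?thesis unfolding 1 by (rule mult.assoc[symmetric])
    qed
    finally show "norm (kfull_cont k s) \<le> M * (K * (2 * real k) ^ 3) ^ k * (1 + \<bar>Im s\<bar>) ^ (3 * k)" .
  qed
qed

text \<open>Because \<open>\<sigma>\<close> lies just to the right of \<open>1 / (2k + 2)\<close>,
  all factors with \<open>j \<ge> k + 1\<close> satisfy \<open>j \<sigma> > 1/2\<close> and cost
  only \<open>e\<close> each. The factor \<open>j = k\<close> costs
  \<open>1/2 - k \<sigma> + e = 1 / (2k + 2) - k e + e\<close>. Adding \<open>(k - 1) e\<close> for
  the others cancels every \<open>e\<close>, so the exponent is exactly \<open>1 / (2k + 2)\<close>,
  strictly below \<open>\<sigma>\<close>.\<close>

lemma kfull_cont_line_bound: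
  assumes LH: "Lindelof_Hypothesis" and k: "k \<ge> 2" and e: "e > 0" "real k * (1 / (2 * real k + 2) + e) < 1/2"
  defines "\<sigma> \<equiv> 1 / (2 * real k + 2) + e"
  obtains C where "C > 0" "\<And>t. norm (kfull_cont k (Complex \<sigma> t)) \<le> C * (1 + \<bar>t\<bar>) powr (1 / (2 * real k + 2))"
proof -
  define \<mu> where "\<mu> = (\<lambda>j. if j = k then 1/2 - real k * \<sigma> + e else e)"
  have \<sigma>1: "\<sigma> > 1 / (2 * real k + 2)" using e by (simp add: \<sigma>_def)
  have \<sigma>': "real (2 * k + 2) * \<sigma> > 1" using \<sigma>1 by (simp add: field_simps)
  have \<sigma>0: "\<sigma> > 0" using pos_if_mult_gt_one[OF _ \<sigma>'] by simp
  have k\<sigma>: "real k * \<sigma> < 1/2" using e by (simp add: \<sigma>_def)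
  have e1: "e \<le> 1"
  proof -
    have "1 * e \<le> real k * e" using k e by (intro mult_right_mono) auto
    also have "\<dots> \<le> real k * \<sigma>" using e by (intro mult_left_mono) (auto simp: \<sigma>_def)
    finally show ?thesis using k\<sigma> by simp
  qed
  have ex: "\<exists>C>0. \<forall>t. norm (zeta (Complex (real j * \<sigma>) t)) \<le> C * (\<bar>t\<bar> + 10) powr \<mu> j" if j: "j \<in> {k..<2*k}" for j
  proof (cases "j = k")
    case True
    have "0 < real k * \<sigma>" using k \<sigma>0 by simp
    from Lindelof_left_of_critical_line[OF LH this k\<sigma> e(1) e1]
    show ?thesis using True by (auto simp: \<mu>_def)
  next
    case False
    hence "real (k + 1) \<le> real j" using j by auto
    hence "real (k + 1) * \<sigma> \<le> real j * \<sigma>" using \<sigma>0 by (intro mult_right_mono) auto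
    moreover have "real (k + 1) * \<sigma> > 1/2" using \<sigma>' by (simp add: algebra_simps)
    ultimately have half: "real j * \<sigma> \<ge> 1/2" by linarith
    \<comment> \<open>\<open>j \<sigma> < 2k \<sigma> < 1\<close> keeps the line of evaluation to
      the left of the pole of zeta.\<close>
    have "real j * \<sigma> < 2 * real k * \<sigma>" using j \<sigma>0 by (intro mult_strict_right_mono) auto
    hence ne: "real j * \<sigma> \<noteq> 1" using k\<sigma> by simp
    show ?thesis using Lindelof_all_t[OF LH half ne e(1)] False by (auto simp: \<mu>_def)
  qed
  then obtain D where D: "\<And>j. j \<in> {k..<2*k} \<Longrightarrow> D j > 0"
     "\<And>j t. j \<in> {k..<2*k} \<Longrightarrow> norm (zeta (Complex (real j * \<sigma>) t)) \<le> D j * (\<bar>t\<bar> + 10) powr \<mu> j"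
    by metis
  obtain M where M: "M > 0" "\<And>s. Re s \<ge> \<sigma> \<Longrightarrow> norm (kfull_G k s) \<le> M"
    using kfull_G_bounded[OF k \<sigma>'] by blast
  have \<mu>0: "\<mu> j \<ge> 0" for j using k\<sigma> e by (auto simp: \<mu>_def)
  define L where "L = 2 * real k + 9"
  have sum\<mu>: "(\<Sum>j\<in>{k..<2*k}. \<mu> j) = 1 / (2 * real k + 2)"
  proof -
    have "(\<Sum>j\<in>{k..<2*k}. \<mu> j) = \<mu> k + (\<Sum>j\<in>{k..<2*k} - {k}. \<mu> j)"
      using k by (intro sum.remove) auto
    also have "(\<Sum>j\<in>{k..<2*k} - {k}. \<mu> j) = (\<Sum>j\<in>{k..<2*k} - {k}. e)"
      by (intro sum.cong) (auto simp: \<mu>_def)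
    also have "\<dots> = (real k - 1) * e" using k by (simp add: of_nat_diff)
    also have "\<mu> k + (real k - 1) * e = 1 / (2 * real k + 2)"
      using k by (simp add: \<mu>_def \<sigma>_def field_simps)
    finally show ?thesis .
  qed
  have z: "norm (zeta (of_nat j * Complex \<sigma> t)) \<le> D j * (L * (1 + \<bar>t\<bar>)) powr \<mu> j" if j: "j \<in> {k..<2*k}" for j t
  proof -
    have "of_nat j * Complex \<sigma> t = Complex (real j * \<sigma>) (real j * t)" by (simp add: complex_eq_iff)
    hence "norm (zeta (of_nat j * Complex \<sigma> t)) \<le> D j * (\<bar>real j * t\<bar> + 10) powr \<mu> j"
      using D(2)[OF j] by simp
    also have "\<bar>real j * t\<bar> + 10 \<le> L * (1 + \<bar>t\<bar>)"
    proof -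
      have "real j * \<bar>t\<bar> \<le> (2 * real k) * \<bar>t\<bar>" using j by (intro mult_right_mono) auto
      moreover have "real k \<ge> 2" using k by simp
      ultimately show ?thesis by (simp add: L_def abs_mult algebra_simps)
    qed
    hence "D j * (\<bar>real j * t\<bar> + 10) powr \<mu> j \<le> D j * (L * (1 + \<bar>t\<bar>)) powr \<mu> j"
      using D(1)[OF j] \<mu>0 by (intro mult_left_mono powr_mono2) auto
    finally show ?thesis .
  qed
  show ?thesis
  proof (rule that[of "M * (\<Prod>j\<in>{k..<2*k}. D j) * L powr (1 / (2 * real k + 2))"])
    show "M * (\<Prod>j\<in>{k..<2*k}. D j) * L powr (1 / (2 * real k + 2)) > 0"
      using M D(1) by (intro mult_pos_pos prod_pos) (auto simp: L_def)
    fix t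
    have "norm (kfull_cont k (Complex \<sigma> t)) = norm (kfull_G k (Complex \<sigma> t)) * (\<Prod>j\<in>{k..<2*k}. norm (zeta (of_nat j * Complex \<sigma> t)))"
      by (simp add: kfull_cont_def norm_mult prod_norm)
    also have "\<dots> \<le> M * (\<Prod>j\<in>{k..<2*k}. D j * (L * (1 + \<bar>t\<bar>)) powr \<mu> j)"
    proof (rule mult_mono)
      show "(\<Prod>j\<in>{k..<2*k}. norm (zeta (of_nat j * Complex \<sigma> t))) \<le> (\<Prod>j\<in>{k..<2*k}. D j * (L * (1 + \<bar>t\<bar>)) powr \<mu> j)"
        by (intro prod_mono conjI z norm_ge_zero)
    qed (use M in \<open>auto intro!: prod_nonneg\<close>)
    also have "(\<Prod>j\<in>{k..<2*k}. D j * (L * (1 + \<bar>t\<bar>)) powr \<mu> j) = (\<Prod>j\<in>{k..<2*k}. D j) * (L * (1 + \<bar>t\<bar>)) powr (\<Sum>j\<in>{k..<2*k}. \<mu> j)"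
    proof -
      have "L * (1 + \<bar>t\<bar>) \<noteq> 0" by (auto simp: L_def)
      thus ?thesis by (simp add: prod.distrib powr_sum)
    qed
    also have "M * \<dots> = M * (\<Prod>j\<in>{k..<2*k}. D j) * L powr (1 / (2 * real k + 2)) * (1 + \<bar>t\<bar>) powr (1 / (2 * real k + 2))"
      unfolding sum\<mu> powr_mult by (simp only: mult.assoc)
    finally show "norm (kfull_cont k (Complex \<sigma> t)) \<le> M * (\<Prod>j\<in>{k..<2*k}. D j) * L powr (1 / (2 * real k + 2)) * (1 + \<bar>t\<bar>) powr (1 / (2 * real k + 2))" .
  qed
qed

section \<open>The smoothed counting function\<close>

text \<open>At the real poles each average changes the residue by a relative amount
  \<open>O(\<delta>)\<close> only: the quotient lies between \<open>1\<close> and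
  \<open>1 + \<delta>\<close>, and \<open>(1 + \<delta>) ^ M\<close> stays below the chord from
  \<open>1\<close> to \<open>2 ^ M\<close> on \<open>[0, 1]\<close>.\<close>

lemma step_factor_of_real:
  assumes \<delta>: "\<delta> > 0" "\<delta> \<le> 1" and p: "p > 0" "p \<le> 1"
  shows "norm (step_factor \<delta> (of_real p) ^ M - 1) \<le> 2 ^ M * \<delta>"
proof -
  define w where "w = (exp (\<delta> * p) - 1) / (\<delta> * p)"
  have \<delta>p: "\<delta> * p > 0" "\<delta> * p \<le> 1" "\<delta> * p \<le> \<delta>"
    using \<delta> p mult_mono[of \<delta> 1 p 1] mult_left_le[of p \<delta>] by auto
  have "exp (\<delta> * p) \<le> 1 + \<delta> * p + (\<delta> * p) ^ 2" using \<delta>p by (intro exp_bound) auto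
  hence "w \<le> 1 + \<delta> * p" using \<delta>p by (simp add: w_def field_simps power2_eq_square)
  hence w2: "w \<le> 1 + \<delta>" using \<delta>p by simp
  have "\<delta> * p \<le> exp (\<delta> * p) - 1" using exp_ge_add_one_self[of "\<delta> * p"] by linarith
  hence w1: "w \<ge> 1" unfolding w_def le_divide_eq_1_pos[OF \<delta>p(1)] .
  have "(1 + \<delta>) ^ M \<le> 1 + (2 ^ M - 1) * \<delta>"
  proof (induction M)
    case (Suc M)
    have "(2 ^ M - 1) * \<delta> * \<delta> \<le> (2 ^ M - 1) * \<delta> * 1" using \<delta> by (intro mult_left_mono) auto
    moreover have "(1 + \<delta>) ^ Suc M \<le> (1 + \<delta>) * (1 + (2 ^ M - 1) * \<delta>)"
      using Suc \<delta> by (simp add: mult_left_mono)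
    ultimately show ?case by (simp add: algebra_simps)
  qed auto
  moreover have "w ^ M \<le> (1 + \<delta>) ^ M" using w1 w2 by (intro power_mono) auto
  moreover have "w ^ M \<ge> 1" using w1 by simp
  ultimately have "\<bar>w ^ M - 1\<bar> \<le> 2 ^ M * \<delta>" using \<delta> by (simp add: algebra_simps)
  moreover have "step_factor \<delta> (of_real p) ^ M - 1 = of_real (w ^ M - 1)"
    by (simp add: step_factor_def w_def exp_of_real flip: of_real_mult)
  ultimately show ?thesis by (simp only: norm_of_real)
qed

definition smoothed_count :: "nat \<Rightarrow> real \<Rightarrow> nat \<Rightarrow> real \<Rightarrow> real" where
  "smoothed_count k \<delta> m y = (\<Sum>n. of_bool (kfull k (Suc n)) * smooth_step \<delta> m (y - ln (real (Suc n))))"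

lemma smoothed_count_summable:
  assumes "\<delta> > 0"
  shows "summable (\<lambda>n. of_bool (kfull k (Suc n)) * smooth_step \<delta> m (y - ln (real (Suc n))))"
proof (rule summable_finite)
  define B where "B = exp (y + (real m + 1) * \<delta>)"
  show "finite {n. real (Suc n) \<le> B}"
  proof (rule finite_subset)
    show "{n. real (Suc n) \<le> B} \<subseteq> {..nat \<lceil>B\<rceil>}" by (auto simp: le_nat_iff) linarith
  qed auto
  fix n assume "n \<notin> {n. real (Suc n) \<le> B}"
  hence "ln B < ln (real (Suc n))" by (intro ln_less_cancel_iff[THEN iffD2]) (auto simp: B_def)
  hence "y - ln (real (Suc n)) \<le> - (real m + 1) * \<delta>" by (simp add: B_def algebra_simps)
  thus "of_bool (kfull k (Suc n)) * smooth_step \<delta> m (y - ln (real (Suc n))) = 0"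
    using smooth_step_eq_0[OF assms] by simp
qed

definition kfull_count :: "nat \<Rightarrow> real \<Rightarrow> real" where
  "kfull_count k x = (\<Sum>n | 1 \<le> n \<and> real n \<le> x. of_bool (kfull k n))"

lemma kfull_count_sums:
  "(\<lambda>n. of_bool (kfull k (Suc n)) * of_bool (real (Suc n) \<le> x)) sums kfull_count k x"
proof -
  have fin: "finite {n. real (Suc n) \<le> x}"
  proof (rule finite_subset)
    show "{n. real (Suc n) \<le> x} \<subseteq> {..nat \<lceil>x\<rceil>}" by (auto simp: le_nat_iff) linarith
  qed auto
  have "(\<lambda>n. of_bool (kfull k (Suc n)) * of_bool (real (Suc n) \<le> x)) sums
      (\<Sum>n\<in>{n. real (Suc n) \<le> x}. of_bool (kfull k (Suc n)) * of_bool (real (Suc n) \<le> x) :: real)"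
    by (rule sums_finite[OF fin]) auto
  also have "(\<Sum>n\<in>{n. real (Suc n) \<le> x}. of_bool (kfull k (Suc n)) * of_bool (real (Suc n) \<le> x)) = kfull_count k x"
    unfolding kfull_count_def
    by (rule sum.reindex_bij_witness[of _ "\<lambda>n. n - 1" Suc]) auto
  finally show ?thesis .
qed

text \<open>The averages look only to the right, so the smoothed step is already \<open>1\<close>
  from \<open>0\<close> on and vanishes below \<open>- (m + 1) * \<delta>\<close>. At
  \<open>y\<close> it dominates the sharp cutoff; moved by the full width of the window it lies
  below it.\<close>

lemma smoothed_count_sandwich:
  assumes \<delta>: "\<delta> > 0"
  shows "smoothed_count k \<delta> m (y - (real m + 1) * \<delta>) \<le> kfull_count k (exp y)"
    "kfull_count k (exp y) \<le> smoothed_count k \<delta> m y"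
proof -
  have iff: "real (Suc n) \<le> exp y \<longleftrightarrow> ln (real (Suc n)) \<le> y" for n
    by (metis exp_le_cancel_iff exp_ln of_nat_0_less_iff zero_less_Suc)
  show "smoothed_count k \<delta> m (y - (real m + 1) * \<delta>) \<le> kfull_count k (exp y)"
    unfolding smoothed_count_def sums_unique[OF kfull_count_sums]
  proof (intro suminf_le smoothed_count_summable \<delta> sums_summable[OF kfull_count_sums])
    fix n
    have "smooth_step \<delta> m (y - (real m + 1) * \<delta> - ln (real (Suc n))) \<le> of_bool (real (Suc n) \<le> exp y)"
    proof (cases "ln (real (Suc n)) \<le> y")
      case True thus ?thesis using smooth_step_range[OF \<delta>] iff by simp
    next
      case False
      hence "smooth_step \<delta> m (y - (real m + 1) * \<delta> - ln (real (Suc n))) = 0"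
        by (intro smooth_step_eq_0 \<delta>) (simp add: algebra_simps)
      thus ?thesis by simp
    qed
    thus "of_bool (kfull k (Suc n)) * smooth_step \<delta> m (y - (real m + 1) * \<delta> - ln (real (Suc n)))
      \<le> of_bool (kfull k (Suc n)) * of_bool (real (Suc n) \<le> exp y)"
      by (intro mult_left_mono) auto
  qed
  show "kfull_count k (exp y) \<le> smoothed_count k \<delta> m y"
    unfolding smoothed_count_def sums_unique[OF kfull_count_sums]
  proof (intro suminf_le smoothed_count_summable \<delta> sums_summable[OF kfull_count_sums])
    fix n
    have "of_bool (real (Suc n) \<le> exp y) \<le> smooth_step \<delta> m (y - ln (real (Suc n)))"
    proof (cases "ln (real (Suc n)) \<le> y")
      case True thus ?thesis using smooth_step_eq_1[OF \<delta>, of "y - ln (real (Suc n))" m] by simp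
    next
      case False thus ?thesis using smooth_step_range[OF \<delta>] iff by simp
    qed
    thus "of_bool (kfull k (Suc n)) * of_bool (real (Suc n) \<le> exp y)
       \<le> of_bool (kfull k (Suc n)) * smooth_step \<delta> m (y - ln (real (Suc n)))"
      by (intro mult_left_mono) auto
  qed
qed

definition kfull_integrand :: "nat \<Rightarrow> real \<Rightarrow> real \<Rightarrow> complex \<Rightarrow> complex" where
  "kfull_integrand k \<delta> y s = kfull_cont k s / s * (exp (of_real y * s) * step_factor \<delta> s ^ Suc (3 * k))"

lemma smoothed_count_integral:
  assumes k: "k \<ge> 2" and \<delta>: "\<delta> > 0" "\<delta> \<le> 1"
  shows "of_real (2 * pi * smoothed_count k \<delta> (3 * k) y) = (LINT t|lborel. kfull_integrand k \<delta> y (Complex 1 t))"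
proof -
  have "1 / real k < 1" using k by simp
  hence s: "Re (Complex 1 t) > 1 / real k" for t by simp
  have "summable (\<lambda>n. norm (kfull_ind k (Suc n) * of_nat (Suc n) powr (- of_real 1)))"
    by (rule kfull_series_abs_summable) (use k in auto)
  from smoothed_dirichlet_series[OF _ \<delta> this, of "3 * k" y]
  have "(\<lambda>n. kfull_ind k (Suc n) * of_real (2 * pi * smooth_step \<delta> (3 * k) (y - ln (real (Suc n))))) sums
     (LINT t|lborel. kfull_series k (Complex 1 t) * (exp (of_real y * Complex 1 t) * step_factor \<delta> (Complex 1 t) ^ Suc (3 * k) / Complex 1 t))"
    by (simp only: kfull_series_def)
  also have "(\<lambda>t. kfull_series k (Complex 1 t) * (exp (of_real y * Complex 1 t) * step_factor \<delta> (Complex 1 t) ^ Suc (3 * k) / Complex 1 t))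
      = (\<lambda>t. kfull_integrand k \<delta> y (Complex 1 t))"
    unfolding kfull_series_factorization[OF k s] kfull_cont_def[symmetric] kfull_integrand_def by simp
  also have "(\<lambda>n. kfull_ind k (Suc n) * of_real (2 * pi * smooth_step \<delta> (3 * k) (y - ln (real (Suc n)))))
      = (\<lambda>n. of_real (2 * pi * (of_bool (kfull k (Suc n)) * smooth_step \<delta> (3 * k) (y - ln (real (Suc n))))))"
    by (auto simp: kfull_ind_def)
  finally have 1: "(\<lambda>n. complex_of_real (2 * pi * (of_bool (kfull k (Suc n)) * smooth_step \<delta> (3 * k) (y - ln (real (Suc n)))))) sums
      (LINT t|lborel. kfull_integrand k \<delta> y (Complex 1 t))" .
  have "(\<lambda>n. complex_of_real (2 * pi * (of_bool (kfull k (Suc n)) * smooth_step \<delta> (3 * k) (y - ln (real (Suc n)))))) sums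
      of_real (2 * pi * smoothed_count k \<delta> (3 * k) y)"
    unfolding smoothed_count_def by (intro sums_of_real sums_mult summable_sums smoothed_count_summable \<delta>)
  thus ?thesis using 1 by (rule sums_unique2)
qed

text \<open>Power count: \<open>3k\<close> from \<open>F_k\<close>, minus \<open>1\<close> from
  \<open>1 / s\<close>, minus \<open>3k + 1\<close> from the averages leaves exactly
  \<open>- 2\<close>. The constant depends badly on \<open>\<delta>\<close> and \<open>y\<close>,
  which is harmless because it serves only the contour shift.\<close>

lemma kfull_integrand_decay:
  assumes k: "k \<ge> 2" and \<sigma>: "\<sigma> > 1 / (2 * real k + 2)" and \<delta>: "\<delta> > 0" "\<delta> \<le> 1"
  obtains C where "\<And>s. \<sigma> \<le> Re s \<Longrightarrow> Re s \<le> 1 \<Longrightarrow> \<bar>Im s\<bar> \<ge> 1 \<Longrightarrow> norm (kfull_integrand k \<delta> y s) \<le> C / Im s ^ 2"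
proof -
  obtain C where C: "C > 0" "\<And>s. \<sigma> \<le> Re s \<Longrightarrow> Re s \<le> 1 \<Longrightarrow> \<bar>Im s\<bar> \<ge> 1 \<Longrightarrow> norm (kfull_cont k s) \<le> C * (1 + \<bar>Im s\<bar>) ^ (3 * k)"
    by (rule kfull_cont_strip_bound[OF k \<sigma>]) blast
  have "1 / (2 * real k + 2) > 0" by (intro divide_pos_pos) auto
  hence \<sigma>0: "\<sigma> > 0" using \<sigma> by linarith
  show ?thesis
  proof (rule that)
    fix s assume s: "\<sigma> \<le> Re s" "Re s \<le> 1" "\<bar>Im s\<bar> \<ge> 1"
    define v where "v = \<bar>Im s\<bar>"
    have v: "v \<ge> 1" "v \<le> norm s" using s abs_Im_le_cmod[of s] by (auto simp: v_def)
    have s0: "s \<noteq> 0" using v by auto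
    have "norm (kfull_cont k s) \<le> C * (1 + v) ^ (3 * k)" using C s by (simp add: v_def)
    also have "\<dots> \<le> C * (2 * v) ^ (3 * k)" using C v by (intro mult_left_mono power_mono) auto
    finally have "norm (kfull_cont k s) / norm s \<le> C * (2 * v) ^ (3 * k) / v" using v C by (intro frac_le) auto
    moreover have "norm (exp (of_real y * s)) \<le> exp \<bar>y\<bar>"
    proof -
      have "y * Re s \<le> \<bar>y\<bar> * \<bar>Re s\<bar>" by (metis abs_ge_self abs_mult)
      also have "\<dots> \<le> \<bar>y\<bar> * 1" using s \<sigma>0 by (intro mult_left_mono) auto
      finally show ?thesis by (simp add: norm_exp_eq_Re)
    qed
    moreover have "norm (step_factor \<delta> s) \<le> 2 * exp 1 / (\<delta> * v)"
    proof -
      have "norm (step_factor \<delta> s) \<le> 2 * exp 1 / (\<delta> * norm s)"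
        by (rule norm_step_factor_le) (use \<delta> s0 s \<sigma>0 in auto)
      also have "\<dots> \<le> 2 * exp 1 / (\<delta> * v)" using v \<delta> s0 by (intro divide_left_mono mult_left_mono mult_pos_pos) auto
      finally show ?thesis .
    qed
    hence "norm (step_factor \<delta> s) ^ Suc (3 * k) \<le> (2 * exp 1 / (\<delta> * v)) ^ Suc (3 * k)" by (intro power_mono) auto
    ultimately have "norm (kfull_integrand k \<delta> y s) \<le> C * (2 * v) ^ (3 * k) / v * (exp \<bar>y\<bar> * (2 * exp 1 / (\<delta> * v)) ^ Suc (3 * k))"
      unfolding kfull_integrand_def norm_mult norm_divide norm_power using C v \<delta> by (intro mult_mono) auto
    also have "\<dots> = (C * 2 ^ (3 * k) * exp \<bar>y\<bar> * (2 * exp 1 / \<delta>) ^ Suc (3 * k)) / Im s ^ 2"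
    proof -
      have "Im s ^ 2 = v ^ 2" by (simp add: v_def)
      moreover have "(2 * exp 1 / (\<delta> * v)) ^ Suc (3 * k) = (2 * exp 1 / \<delta>) ^ Suc (3 * k) / (v ^ (3 * k) * v)"
      proof -
        have "(a / v) ^ Suc n = a ^ Suc n / (v ^ n * v)" for a and n :: nat
          by (simp add: power_divide)
        from this[of "2 * exp 1 / \<delta>"] show ?thesis by (simp only: divide_divide_eq_left)
      qed
      moreover have "(2 * v) ^ (3 * k) = 2 ^ (3 * k) * v ^ (3 * k)" by (rule power_mult_distrib)
      ultimately show ?thesis using v by (simp add: power2_eq_square del: power_Suc)
    qed
    finally show "norm (kfull_integrand k \<delta> y s) \<le> (C * 2 ^ (3 * k) * exp \<bar>y\<bar> * (2 * exp 1 / \<delta>) ^ Suc (3 * k)) / Im s ^ 2" .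
  qed
qed

text \<open>The bound \<open>\<sigma> < 1 / (2k)\<close> puts all poles \<open>1 / n\<close> with
  \<open>k \<le> n < 2k\<close> to the right of the new line, while the singularity at
  \<open>0\<close> stays to the left. Each residue is the coefficient times the value of the
  smoothed kernel at the pole.\<close>

lemma smoothed_count_explicit_formula:
  assumes k: "k \<ge> 2" and \<delta>: "\<delta> > 0" "\<delta> \<le> 1" and \<sigma>: "\<sigma> > 1 / (2 * real k + 2)" "\<sigma> < 1 / (2 * real k)"
  shows "of_real (smoothed_count k \<delta> (3 * k) y) =
     (\<Sum>j<k. kfull_coeff j k * exp (of_real (y / real (k + j))) * step_factor \<delta> (of_real (1 / real (k + j))) ^ Suc (3 * k))
     + (LINT t|lborel. kfull_integrand k \<delta> y (Complex \<sigma> t)) / (2 * pi)"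
proof -
  define h where "h = (\<lambda>s. exp (of_real y * s) * step_factor \<delta> s ^ Suc (3 * k))"
  let ?A = "{s. Re s > 1 / (2 * real k + 2)}"
  have pos: "1 / (2 * real k + 2) > 0" by (intro divide_pos_pos) auto
  have h: "h holomorphic_on ?A"
    unfolding h_def step_factor_def using \<delta> pos by (intro holomorphic_intros) auto
  define P where "P = (\<lambda>n. 1 / of_nat n :: complex) ` {k..<2*k}"
  have inj: "inj_on (\<lambda>n. 1 / of_nat n :: complex) {k..<2*k}"
    using k by (auto simp: inj_on_def)
  obtain C where C: "\<And>s. \<sigma> \<le> Re s \<Longrightarrow> Re s \<le> 1 \<Longrightarrow> \<bar>Im s\<bar> \<ge> 1 \<Longrightarrow> norm (kfull_integrand k \<delta> y s) \<le> C / Im s ^ 2"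
    by (rule kfull_integrand_decay[OF k \<sigma>(1) \<delta>]) blast
  have "1 / (2 * real k) \<le> 1 / 4" using k by (intro divide_left_mono) auto
  hence \<sigma>1: "\<sigma> < 1" using \<sigma> by linarith
  have "(LINT t|lborel. kfull_integrand k \<delta> y (Complex 1 t)) - (LINT t|lborel. kfull_integrand k \<delta> y (Complex \<sigma> t))
     = 2 * pi * (\<Sum>p\<in>P. residue (kfull_integrand k \<delta> y) p)"
  proof (rule vertical_line_shift(3)[where a' = "1 / (2 * real k + 2)" and b' = 2 and ?T0.0 = 1])
    show "\<sigma> < Re p \<and> Re p < 1" if p: "p \<in> P" for p
    proof -
      obtain n where n: "n \<in> {k..<2*k}" "p = 1 / of_nat n" using p by (auto simp: P_def)
      have "1 / (2 * real k) < 1 / real n" using n k by (intro divide_strict_left_mono) auto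
      moreover have "1 / real n < 1" using n k by simp
      ultimately show ?thesis using \<sigma> by (simp add: n Re_one_divide_nat)
    qed
    have "kfull_cont k holomorphic_on ?A - P"
      unfolding kfull_cont_def [abs_def] P_def by (rule holomorphic_kfull_cont_factor[OF k]) auto
    hence "kfull_integrand k \<delta> y holomorphic_on ?A - P"
      unfolding kfull_integrand_def [abs_def] h_def[symmetric] using pos
      by (intro holomorphic_intros holomorphic_on_subset[OF h[unfolded h_def]]) auto
    thus "kfull_integrand k \<delta> y holomorphic_on {s. 1 / (2 * real k + 2) < Re s \<and> Re s < 2} - P"
      by (rule holomorphic_on_subset) auto
  qed (use \<sigma> \<sigma>1 C in \<open>auto simp: P_def\<close>)
  also have "(\<Sum>p\<in>P. residue (kfull_integrand k \<delta> y) p) = (\<Sum>n\<in>{k..<2*k}. residue (kfull_integrand k \<delta> y) (1 / of_nat n))"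
    unfolding P_def by (rule sum.reindex[OF inj, unfolded o_def])
  also have "\<dots> = (\<Sum>j<k. residue (kfull_integrand k \<delta> y) (1 / of_nat (k + j)))"
    by (rule sum.reindex_bij_witness[of _ "\<lambda>j. k + j" "\<lambda>n. n - k"]) auto
  also have "\<dots> = (\<Sum>j<k. kfull_coeff j k * exp (of_real (y / real (k + j))) * step_factor \<delta> (of_real (1 / real (k + j))) ^ Suc (3 * k))"
  proof (rule sum.cong)
    fix j assume j: "j \<in> {..<k}"
    have "residue (kfull_integrand k \<delta> y) (1 / of_nat (k + j)) = kfull_coeff j k * h (1 / of_nat (k + j))"
      unfolding kfull_integrand_def [abs_def] h_def[symmetric]
      using residue_kfull_cont_mult[OF k _ h, of j] j by (simp add: h_def)
    thus "residue (kfull_integrand k \<delta> y) (1 / of_nat (k + j)) =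
       kfull_coeff j k * exp (of_real (y / real (k + j))) * step_factor \<delta> (of_real (1 / real (k + j))) ^ Suc (3 * k)"
      by (simp add: h_def)
  qed simp
  finally have "complex_of_real (2 * pi * smoothed_count k \<delta> (3 * k) y) - (LINT t|lborel. kfull_integrand k \<delta> y (Complex \<sigma> t)) =
     2 * pi * (\<Sum>j<k. kfull_coeff j k * exp (of_real (y / real (k + j))) * step_factor \<delta> (of_real (1 / real (k + j))) ^ Suc (3 * k))"
    unfolding smoothed_count_integral[OF k \<delta>] .
  moreover have "a = X + b / (2 * pi)" if "of_real (2 * pi) * a - b = 2 * pi * X" for a b X :: complex
    using that by (simp add: field_simps)
  ultimately show ?thesis by (simp only: of_real_mult)
qed

section \<open>The error term\<close>

lemma le_geometric_interpolation:
  fixes x :: real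
  assumes "0 \<le> x" "x \<le> A" "x \<le> B" "0 \<le> r" "r \<le> 1"
  shows "x \<le> A powr (1 - r) * B powr r"
proof (cases "x = 0")
  case False
  hence "x = x powr (1 - r) * x powr r" using assms by (simp flip: powr_add)
  also have "\<dots> \<le> A powr (1 - r) * B powr r" using assms by (intro mult_mono powr_mono2) auto
  finally show ?thesis .
qed simp

text \<open>Of the \<open>3k + 1\<close> averages all but one are bounded trivially. For the last
  one the two bounds of \<open>norm_step_factor_le\<close> are interpolated with weight
  \<open>\<sigma>\<close>, which yields \<open>\<delta>^(-\<sigma>) (1 + |t|)^(-\<sigma>)\<close>.
  With \<open>(1 + |t|)^\<theta>\<close> from \<open>F_k\<close> and one power from
  \<open>1 / s\<close> the integrand is of size
  \<open>(1 + |t|)^(\<theta> - \<sigma> - 1) = (1 + |t|)^(-1 - e)\<close>, and the constant is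
  uniform in \<open>\<delta>\<close> and \<open>y\<close>.\<close>

lemma kfull_integrand_line_bound:
  assumes LH: "Lindelof_Hypothesis" and k: "k \<ge> 2" and e: "e > 0" "real k * (1 / (2 * real k + 2) + e) < 1/2"
  defines "\<sigma> \<equiv> 1 / (2 * real k + 2) + e"
  obtains C where "C > 0" "\<And>\<delta> y. 0 < \<delta> \<Longrightarrow> \<delta> \<le> 1 \<Longrightarrow>
     norm (LINT t|lborel. kfull_integrand k \<delta> y (Complex \<sigma> t)) \<le> C * (exp (\<sigma> * y) * \<delta> powr - \<sigma>)"
proof -
  define \<theta> where "\<theta> = 1 / (2 * real k + 2)"
  have \<theta>: "\<theta> > 0" unfolding \<theta>_def by (intro divide_pos_pos) auto
  have \<sigma>\<theta>: "\<sigma> = \<theta> + e" by (simp add: \<sigma>_def \<theta>_def)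
  have \<sigma>0: "\<sigma> > 0" using \<theta> e by (simp add: \<sigma>\<theta>)
  have \<sigma>1: "\<sigma> \<le> 1"
  proof -
    have "1 * \<sigma> \<le> real k * \<sigma>" using k \<sigma>0 by (intro mult_right_mono) auto
    moreover have "real k * \<sigma> < 1/2" using e(2) unfolding \<sigma>_def .
    ultimately show ?thesis by linarith
  qed
  obtain C where C: "C > 0" "\<And>t. norm (kfull_cont k (Complex \<sigma> t)) \<le> C * (1 + \<bar>t\<bar>) powr \<theta>"
    using kfull_cont_line_bound[OF LH k e] unfolding \<sigma>_def \<theta>_def by blast
  \<comment> \<open>Adding \<open>\<sigma> \<le> |s|\<close> and
    \<open>\<sigma> |t| \<le> \<sigma> |s|\<close> gives \<open>c0 (1 + |t|) \<le> |s|\<close> on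
    the line.\<close>
  define c0 where "c0 = \<sigma> / (1 + \<sigma>)"
  have c0: "c0 > 0" using \<sigma>0 by (simp add: c0_def)
  define I where "I = (LINT t|lborel. (1 + \<bar>t\<bar>) powr (- 1 - e))"
  have I: "I \<ge> 0" unfolding I_def by (intro Bochner_Integration.integral_nonneg) auto
  define K where "K = C / c0 * (exp 1 ^ (3 * k) * (exp 1 powr (1 - \<sigma>) * (2 * exp 1 / c0) powr \<sigma>))"
  have K: "K \<ge> 0" unfolding K_def using C c0 by (intro mult_nonneg_nonneg divide_nonneg_nonneg) auto
  have bound: "norm (LINT t|lborel. kfull_integrand k \<delta> y (Complex \<sigma> t)) \<le> (K * (exp (\<sigma> * y) * \<delta> powr - \<sigma>)) * I"
    if \<delta>: "0 < \<delta>" "\<delta> \<le> 1" for \<delta> y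
    unfolding I_def
  proof (rule norm_integral_powr_tail_le[OF e(1), where u = 0])
    fix t
    define s where "s = Complex \<sigma> t"
    define v where "v = 1 + \<bar>t\<bar>"
    have v: "v \<ge> 1" by (simp add: v_def)
    have sv: "c0 * v \<le> norm s"
    proof -
      have "\<sigma> \<le> norm s" using abs_Re_le_cmod[of s] \<sigma>0 by (simp add: s_def)
      moreover have "\<sigma> * \<bar>t\<bar> \<le> \<sigma> * norm s" using abs_Im_le_cmod[of s] \<sigma>0 by (simp add: s_def)
      ultimately have "\<sigma> * v \<le> (1 + \<sigma>) * norm s" by (simp add: v_def algebra_simps)
      thus ?thesis using \<sigma>0 by (simp add: c0_def field_simps)
    qed
    have cv: "c0 * v > 0" using c0 v by simp
    have s0: "s \<noteq> 0" using sv cv by auto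
    have 1: "norm (kfull_cont k s) / norm s \<le> C * v powr \<theta> / (c0 * v)"
      using C sv cv by (intro frac_le) (auto simp: s_def v_def)
    have sf: "norm (step_factor \<delta> s) \<le> exp 1" "norm (step_factor \<delta> s) \<le> 2 * exp 1 / (\<delta> * norm s)"
      by (intro norm_step_factor_le; use \<delta> s0 \<sigma>0 \<sigma>1 in \<open>simp add: s_def\<close>)+
    have "2 * exp 1 / (\<delta> * norm s) \<le> 2 * exp 1 / (\<delta> * (c0 * v))"
      using sv cv \<delta> s0 c0 v by (intro divide_left_mono mult_left_mono mult_pos_pos) auto
    also have "\<dots> = (2 * exp 1 / c0) * (1 / \<delta>) * (1 / v)" by simp
    finally have sf2: "norm (step_factor \<delta> s) \<le> (2 * exp 1 / c0) * (1 / \<delta>) * (1 / v)" using sf by linarith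
    have "norm (step_factor \<delta> s) \<le> exp 1 powr (1 - \<sigma>) * ((2 * exp 1 / c0) * (1 / \<delta>) * (1 / v)) powr \<sigma>"
      by (rule le_geometric_interpolation) (use sf sf2 \<sigma>0 \<sigma>1 in auto)
    also have "((2 * exp 1 / c0) * (1 / \<delta>) * (1 / v)) powr \<sigma> = (2 * exp 1 / c0) powr \<sigma> * \<delta> powr - \<sigma> * v powr - \<sigma>"
      by (simp only: powr_mult powr_divide powr_minus_divide powr_one_eq_one)
    finally have 2: "norm (step_factor \<delta> s) \<le> exp 1 powr (1 - \<sigma>) * ((2 * exp 1 / c0) powr \<sigma> * \<delta> powr - \<sigma> * v powr - \<sigma>)" .
    have "norm (kfull_integrand k \<delta> y s) = (norm (kfull_cont k s) / norm s) * (exp (\<sigma> * y) * (norm (step_factor \<delta> s) ^ (3 * k) * norm (step_factor \<delta> s)))"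
      by (simp add: kfull_integrand_def norm_mult norm_divide norm_power norm_exp_eq_Re s_def mult_ac)
    also have "\<dots> \<le> (C * v powr \<theta> / (c0 * v)) * (exp (\<sigma> * y) * (exp 1 ^ (3 * k) * (exp 1 powr (1 - \<sigma>) * ((2 * exp 1 / c0) powr \<sigma> * \<delta> powr - \<sigma> * v powr - \<sigma>))))"
      using 1 2 sf(1) C(1) c0 v by (intro mult_mono power_mono) auto
    also have "\<dots> = K * (exp (\<sigma> * y) * \<delta> powr - \<sigma>) * (v powr \<theta> * v powr - \<sigma> / v)"
      by (simp add: K_def)
    also have "v powr \<theta> * v powr - \<sigma> / v = v powr (- 1 - e)"
    proof -
      have "v powr \<theta> * v powr - \<sigma> / v = v powr \<theta> * v powr - \<sigma> * v powr (- 1)"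
        using v by (simp add: powr_minus_divide)
      also have "\<dots> = v powr (\<theta> + - \<sigma> + - 1)" by (simp only: powr_add)
      also have "\<theta> + - \<sigma> + - 1 = - 1 - e" by (simp add: \<sigma>\<theta>)
      finally show ?thesis .
    qed
    finally show "norm (kfull_integrand k \<delta> y (Complex \<sigma> t)) \<le> K * (exp (\<sigma> * y) * \<delta> powr - \<sigma>) * (1 + \<bar>t - 0\<bar>) powr (- 1 - e)"
      by (simp only: s_def v_def diff_zero)
  qed
  show ?thesis
  proof (rule that[of "K * I + 1"])
    show "K * I + 1 > 0" using K I by (simp add: add_nonneg_pos)
    fix \<delta> y :: real assume \<delta>: "0 < \<delta>" "\<delta> \<le> 1"
    have "(K * (exp (\<sigma> * y) * \<delta> powr - \<sigma>)) * I = K * I * (exp (\<sigma> * y) * \<delta> powr - \<sigma>)" by simp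
    also have "\<dots> \<le> (K * I + 1) * (exp (\<sigma> * y) * \<delta> powr - \<sigma>)" by (intro mult_right_mono) auto
    finally show "norm (LINT t|lborel. kfull_integrand k \<delta> y (Complex \<sigma> t)) \<le> (K * I + 1) * (exp (\<sigma> * y) * \<delta> powr - \<sigma>)"
      using bound[OF \<delta>, of y] by linarith
  qed
qed

section \<open>The main term in the variable \<open>y = ln x\<close> and the choice of
  \<open>\<delta>\<close>\<close>

definition kfull_main_term :: "nat \<Rightarrow> real \<Rightarrow> complex" where
  "kfull_main_term k y = (\<Sum>j<k. kfull_coeff j k * exp (of_real (y / real (k + j))))"

lemma exp_quotient_le:
  assumes "y' \<le> y" "0 \<le> y" "k > 0"
  shows "exp (y' / real (k + j)) \<le> exp (y / real k)"
proof -
  have "y' / real (k + j) \<le> y / real (k + j)" using assms by (intro divide_right_mono) auto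
  also have "\<dots> \<le> y / real k" using assms by (intro divide_left_mono) auto
  finally show ?thesis by simp
qed

text \<open>Uses \<open>1 - exp (- a) \<le> a\<close>, and bounds every exponential by the largest
  one, \<open>exp (y / k)\<close>. This is the price \<open>\<delta> x^(1 / k)\<close> of comparing
  the upper and the lower smoothed count, whose arguments differ by a multiple of
  \<open>\<delta>\<close>.\<close>

lemma kfull_main_term_lipschitz:
  assumes "h \<ge> 0" "0 \<le> y" "k > 0"
  shows "norm (kfull_main_term k y - kfull_main_term k (y - h)) \<le> (\<Sum>j<k. norm (kfull_coeff j k)) * exp (y / real k) * h"
proof -
  have "kfull_main_term k y - kfull_main_term k (y - h)
     = (\<Sum>j<k. kfull_coeff j k * of_real (exp (y / real (k + j)) * (1 - exp (- (h / real (k + j))))))"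
    unfolding kfull_main_term_def sum_subtractf[symmetric] right_diff_distrib[symmetric]
  proof (intro sum.cong refl arg_cong2[of _ _ _ _ "(*)"])
    fix j
    have "exp ((y - h) / real (k + j)) = exp (y / real (k + j)) * exp (- (h / real (k + j)))"
      by (simp add: diff_divide_distrib flip: exp_add)
    thus "exp (complex_of_real (y / real (k + j))) - exp (of_real ((y - h) / real (k + j))) =
        of_real (exp (y / real (k + j)) * (1 - exp (- (h / real (k + j)))))"
      by (simp only: exp_of_real of_real_diff[symmetric] right_diff_distrib mult_1_right)
  qed
  also have "norm \<dots> \<le> (\<Sum>j<k. norm (kfull_coeff j k) * (exp (y / real k) * h))"
  proof (rule sum_norm_le)
    fix j
    have "1 - exp (- (h / real (k + j))) \<le> h / real (k + j)" using exp_ge_add_one_self[of "- (h / real (k + j))"] by linarith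
    also have "\<dots> \<le> h / 1" using assms by (intro divide_left_mono) auto
    finally have "exp (y / real (k + j)) * (1 - exp (- (h / real (k + j)))) \<le> exp (y / real k) * h"
      using exp_quotient_le[of y y k j] assms by (intro mult_mono) auto
    moreover have "0 \<le> exp (y / real (k + j)) * (1 - exp (- (h / real (k + j))))" using assms by simp
    ultimately show "norm (kfull_coeff j k * of_real (exp (y / real (k + j)) * (1 - exp (- (h / real (k + j)))))) \<le> norm (kfull_coeff j k) * (exp (y / real k) * h)"
      unfolding norm_mult norm_of_real by (intro mult_left_mono) auto
  qed
  finally show ?thesis by (simp add: sum_distrib_right[symmetric])
qed

lemma kfull_count_main:
  assumes LH: "Lindelof_Hypothesis" and k: "k \<ge> 2" and e: "e > 0" "real k * (1 / (2 * real k + 2) + e) < 1/2"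
  defines "\<sigma> \<equiv> 1 / (2 * real k + 2) + e"
  obtains C where "C > 0" "\<And>\<delta> y. 0 < \<delta> \<Longrightarrow> \<delta> \<le> 1 \<Longrightarrow> y \<ge> 0 \<Longrightarrow>
     norm (of_real (kfull_count k (exp y)) - kfull_main_term k y) \<le> C * (exp (y / real k) * \<delta> + exp (\<sigma> * y) * \<delta> powr - \<sigma>)"
proof -
  obtain C1 where C1: "C1 > 0" "\<And>\<delta> y. 0 < \<delta> \<Longrightarrow> \<delta> \<le> 1 \<Longrightarrow>
     norm (LINT t|lborel. kfull_integrand k \<delta> y (Complex \<sigma> t)) \<le> C1 * (exp (\<sigma> * y) * \<delta> powr - \<sigma>)"
    using kfull_integrand_line_bound[OF LH k e] unfolding \<sigma>_def by blast
  have \<sigma>: "\<sigma> > 1 / (2 * real k + 2)" using e by (simp add: \<sigma>_def)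
  moreover have "1 / (2 * real k + 2) > 0" by (intro divide_pos_pos) auto
  ultimately have \<sigma>0: "\<sigma> > 0" by linarith
  have \<sigma>2: "\<sigma> < 1 / (2 * real k)"
  proof -
    have "real k * \<sigma> < 1/2" using e(2) unfolding \<sigma>_def .
    thus ?thesis using k by (simp add: field_simps)
  qed
  define D where "D = (\<Sum>j<k. norm (kfull_coeff j k))"
  have D: "D \<ge> 0" unfolding D_def by (intro sum_nonneg) auto
  define A where "A = (\<lambda>\<delta> y. complex_of_real (smoothed_count k \<delta> (3 * k) y))"
  define M where "M = kfull_main_term k"
  define Q where "Q = D * 2 ^ Suc (3 * k) + C1"
  \<comment> \<open>Allowing \<open>y' \<le> y\<close> on the left while the bound uses only
    \<open>y\<close> lets one estimate serve both ends of the sandwich; the lower end may even be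
    negative.\<close>
  have close: "norm (A \<delta> y' - M y') \<le> Q * (exp (y / real k) * \<delta> + exp (\<sigma> * y) * \<delta> powr - \<sigma>)"
    if \<delta>: "0 < \<delta>" "\<delta> \<le> 1" and y: "y' \<le> y" "0 \<le> y" for \<delta> y y'
  proof -
    define R where "R = (LINT t|lborel. kfull_integrand k \<delta> y' (Complex \<sigma> t)) / (2 * pi)"
    have "A \<delta> y' - M y' = (\<Sum>j<k. kfull_coeff j k * exp (of_real (y' / real (k + j))) * (step_factor \<delta> (of_real (1 / real (k + j))) ^ Suc (3 * k) - 1)) + R"
      unfolding A_def M_def kfull_main_term_def smoothed_count_explicit_formula[OF k \<delta> \<sigma> \<sigma>2] R_def
      by (simp add: right_diff_distrib sum_subtractf del: power_Suc)
    also have "norm \<dots> \<le> norm (\<Sum>j<k. kfull_coeff j k * exp (of_real (y' / real (k + j))) * (step_factor \<delta> (of_real (1 / real (k + j))) ^ Suc (3 * k) - 1)) + norm R"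
      by (rule norm_triangle_ineq)
    also have "norm (\<Sum>j<k. kfull_coeff j k * exp (of_real (y' / real (k + j))) * (step_factor \<delta> (of_real (1 / real (k + j))) ^ Suc (3 * k) - 1))
       \<le> (\<Sum>j<k. norm (kfull_coeff j k) * (exp (y / real k) * (2 ^ Suc (3 * k) * \<delta>)))"
    proof (rule sum_norm_le)
      fix j
      have "norm (exp (complex_of_real (y' / real (k + j)))) \<le> exp (y / real k)"
        using exp_quotient_le[of y' y k j] y k by (simp add: norm_exp_eq_Re del: of_nat_add)
      moreover have "norm (step_factor \<delta> (of_real (1 / real (k + j))) ^ Suc (3 * k) - 1) \<le> 2 ^ Suc (3 * k) * \<delta>"
        using k by (intro step_factor_of_real \<delta>) auto
      ultimately show "norm (kfull_coeff j k * exp (of_real (y' / real (k + j))) * (step_factor \<delta> (of_real (1 / real (k + j))) ^ Suc (3 * k) - 1))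
          \<le> norm (kfull_coeff j k) * (exp (y / real k) * (2 ^ Suc (3 * k) * \<delta>))"
        unfolding norm_mult mult.assoc by (intro mult_left_mono mult_mono) auto
    qed
    also have "\<dots> = D * 2 ^ Suc (3 * k) * (exp (y / real k) * \<delta>)"
      unfolding sum_distrib_right[symmetric] D_def by (simp only: mult_ac)
    also have "norm R \<le> C1 * (exp (\<sigma> * y) * \<delta> powr - \<sigma>)"
    proof -
      have "norm R = norm (LINT t|lborel. kfull_integrand k \<delta> y' (Complex \<sigma> t)) / (2 * pi)"
        by (simp add: R_def norm_divide norm_mult)
      also have "\<dots> \<le> norm (LINT t|lborel. kfull_integrand k \<delta> y' (Complex \<sigma> t)) / 1"
        using pi_gt3 by (intro divide_left_mono) auto
      also have "\<dots> \<le> C1 * (exp (\<sigma> * y') * \<delta> powr - \<sigma>)" using C1(2)[OF \<delta>] by simp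
      also have "\<dots> \<le> C1 * (exp (\<sigma> * y) * \<delta> powr - \<sigma>)"
        using C1(1) \<sigma>0 y by (intro mult_left_mono mult_right_mono) auto
      finally show ?thesis .
    qed
    also have "D * 2 ^ Suc (3 * k) * (exp (y / real k) * \<delta>) + C1 * (exp (\<sigma> * y) * \<delta> powr - \<sigma>)
       \<le> Q * (exp (y / real k) * \<delta>) + Q * (exp (\<sigma> * y) * \<delta> powr - \<sigma>)"
      using C1(1) D \<delta> by (intro add_mono mult_right_mono) (auto simp: Q_def)
    finally show ?thesis by (simp only: distrib_left)
  qed
  have Q: "Q \<ge> 0" using C1 D by (simp add: Q_def)
  define L where "L = real (3 * k) + 1"
  show ?thesis
  \<comment> \<open>The sharp count lies between the smoothed counts at \<open>y'\<close> and
    \<open>y\<close>. Its distance to \<open>M y\<close> uses \<open>close\<close> twice at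
    \<open>y\<close> and once at \<open>y'\<close>, and \<open>D * L\<close> comes from
    \<open>M y - M y'\<close>. The \<open>1\<close> secures positivity.\<close>
  proof (rule that[of "3 * Q + D * L + 1"])
    show "3 * Q + D * L + 1 > 0" using Q D by (intro add_nonneg_pos add_nonneg_nonneg mult_nonneg_nonneg) (auto simp: L_def)
    fix \<delta> y :: real assume \<delta>: "0 < \<delta>" "\<delta> \<le> 1" and y: "y \<ge> 0"
    define X where "X = exp (y / real k) * \<delta> + exp (\<sigma> * y) * \<delta> powr - \<sigma>"
    define y' where "y' = y - L * \<delta>"
    have y': "y' \<le> y" using \<delta> by (simp add: y'_def L_def)
    define S where "S = kfull_count k (exp y)"
    have sw: "smoothed_count k \<delta> (3 * k) y' \<le> S" "S \<le> smoothed_count k \<delta> (3 * k) y"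
      using smoothed_count_sandwich[OF \<delta>(1), where k = k and m = "3 * k" and y = y] by (simp_all add: S_def y'_def L_def)
    have "norm (of_real S - A \<delta> y) \<le> norm (A \<delta> y - A \<delta> y')"
      using sw unfolding A_def of_real_diff[symmetric] norm_of_real by simp
    also have "\<dots> \<le> norm (A \<delta> y - M y) + norm (M y - M y') + norm (A \<delta> y' - M y')"
    proof -
      have *: "A \<delta> y - A \<delta> y' = (A \<delta> y - M y) + (M y - M y') - (A \<delta> y' - M y')" by simp
      show ?thesis unfolding * using norm_triangle_ineq4[of "(A \<delta> y - M y) + (M y - M y')" "A \<delta> y' - M y'"]
          norm_triangle_ineq[of "A \<delta> y - M y" "M y - M y'"] by linarith
    qed
    finally have "norm (of_real S - M y) \<le> 2 * norm (A \<delta> y - M y) + norm (M y - M y') + norm (A \<delta> y' - M y')"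
      using norm_triangle_ineq[of "of_real S - A \<delta> y" "A \<delta> y - M y"] by simp
    moreover have "norm (A \<delta> y - M y) \<le> Q * X" unfolding X_def by (rule close) (use \<delta> y in auto)
    moreover have "norm (A \<delta> y' - M y') \<le> Q * X" unfolding X_def by (rule close) (use \<delta> y y' in auto)
    moreover have "norm (M y - M y') \<le> D * L * X"
    proof -
      have "norm (M y - M y') \<le> D * exp (y / real k) * (L * \<delta>)"
        unfolding M_def D_def y'_def by (rule kfull_main_term_lipschitz) (use \<delta> y k in \<open>auto simp: L_def\<close>)
      also have "\<dots> = D * L * (exp (y / real k) * \<delta>)" by simp
      also have "\<dots> \<le> D * L * X" using D by (intro mult_left_mono) (auto simp: X_def L_def)
      finally show ?thesis .
    qed
    moreover have "X \<ge> 0" using \<delta> by (auto simp: X_def)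
    ultimately have "norm (of_real S - M y) \<le> (3 * Q + D * L + 1) * X"
      by (simp add: algebra_simps)
    thus "norm (of_real (kfull_count k (exp y)) - kfull_main_term k y)
        \<le> (3 * Q + D * L + 1) * (exp (y / real k) * \<delta> + exp (\<sigma> * y) * \<delta> powr - \<sigma>)"
      by (simp only: S_def M_def X_def)
  qed
qed

lemma kfull_error_bigo:
  assumes LH: "Lindelof_Hypothesis" and k: "k \<ge> 2" and \<epsilon>: "\<epsilon> > 0"
  shows "kfull_error k \<in> O[at_top](\<lambda>x. of_real (x powr ((real k + 1) / (real k * (2 * real k + 3)) + \<epsilon>)))"
proof -
  define \<eta> where "\<eta> = (real k + 1) / (real k * (2 * real k + 3))"
  \<comment> \<open>The solution of \<open>1 / k - \<tau> = (1 + \<tau>) / (2k + 2)\<close>, whose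
    common value is \<open>\<eta>\<close>; these are \<open>ex1\<close> and \<open>ex2\<close>, with
    \<open>\<delta> = x powr - \<tau>\<close>.\<close>
  define \<tau> where "\<tau> = (real k + 2) / (real k * (2 * real k + 3))"
  \<comment> \<open>The first bound makes the loss \<open>(1 + \<tau>) e \<le> 2 e\<close> at most
    \<open>\<epsilon>\<close>. The second is half of the distance \<open>1 / (2k (k + 1))\<close>
    from \<open>1 / (2k + 2)\<close> to \<open>1 / (2k)\<close>, so that
    \<open>k \<sigma> < 1/2\<close>.\<close>
  define e where "e = min (\<epsilon> / 2) (1 / (4 * (real k * (real k + 1))))"
  define \<sigma> where "\<sigma> = 1 / (2 * real k + 2) + e"
  have k2: "real k \<ge> 2" using k by simp
  have e: "e > 0" using \<epsilon> k2 by (simp add: e_def)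
  have e2: "real k * \<sigma> < 1/2"
  proof -
    have "real k * e \<le> real k * (1 / (4 * (real k * (real k + 1))))" by (intro mult_left_mono) (auto simp: e_def)
    also have "\<dots> < real k * (1 / (2 * (real k * (real k + 1))))"
      using k2 by (intro mult_strict_left_mono divide_strict_left_mono) auto
    also have "\<dots> = 1 / (2 * (real k + 1))" using k2 by simp
    also have "\<dots> = 1/2 - real k * (1 / (2 * real k + 2))" using k2 by (simp add: field_simps)
    finally show ?thesis by (simp add: \<sigma>_def distrib_left)
  qed
  have \<tau>: "0 < \<tau>" "\<tau> \<le> 1"
  proof -
    show "0 < \<tau>" unfolding \<tau>_def using k2 by (intro divide_pos_pos mult_pos_pos) auto
    have "1 * (2 * real k + 3) \<le> real k * (2 * real k + 3)" using k2 by (intro mult_right_mono) auto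
    moreover have "real k + 2 \<le> 1 * (2 * real k + 3)" using k2 by simp
    ultimately have "real k + 2 \<le> real k * (2 * real k + 3)" by (rule order_trans[rotated])
    thus "\<tau> \<le> 1" unfolding \<tau>_def using k2 by (subst divide_le_eq_1_pos) (auto intro!: mult_pos_pos)
  qed
  have ex1: "1 / real k - \<tau> = \<eta>"
  proof -
    have "1 / real k = (2 * real k + 3) / (real k * (2 * real k + 3))" using k2 by simp
    thus ?thesis by (simp only: \<tau>_def \<eta>_def diff_divide_distrib[symmetric]) simp
  qed
  have ex2: "(1 + \<tau>) * (1 / (2 * real k + 2)) = \<eta>"
  proof -
    have nz: "real k * (2 * real k + 3) \<noteq> 0" "2 * real k + 2 \<noteq> 0" using k2 by auto
    have "1 + \<tau> = (real k * (2 * real k + 3) + (real k + 2)) / (real k * (2 * real k + 3))"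
      unfolding \<tau>_def add_divide_distrib[of "real k * (2 * real k + 3)" "real k + 2"] using nz by simp
    also have "real k * (2 * real k + 3) + (real k + 2) = (2 * real k + 2) * (real k + 1)"
      by (simp add: algebra_simps)
    finally show ?thesis using nz by (simp add: \<eta>_def)
  qed
  have ex3: "\<sigma> + \<tau> * \<sigma> \<le> \<eta> + \<epsilon>"
  proof -
    have "\<sigma> + \<tau> * \<sigma> = (1 + \<tau>) * \<sigma>" by (simp add: distrib_right)
    also have "\<dots> = (1 + \<tau>) * (1 / (2 * real k + 2)) + (1 + \<tau>) * e" unfolding \<sigma>_def by (rule distrib_left)
    also have "(1 + \<tau>) * e \<le> 2 * (\<epsilon> / 2)" using \<tau> e by (intro mult_mono) (auto simp: e_def)
    finally show ?thesis unfolding ex2 by simp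
  qed
  obtain C where C: "C > 0" "\<And>\<delta> y. 0 < \<delta> \<Longrightarrow> \<delta> \<le> 1 \<Longrightarrow> y \<ge> 0 \<Longrightarrow>
     norm (of_real (kfull_count k (exp y)) - kfull_main_term k y) \<le> C * (exp (y / real k) * \<delta> + exp (\<sigma> * y) * \<delta> powr - \<sigma>)"
    using kfull_count_main[OF LH k e e2[unfolded \<sigma>_def]] unfolding \<sigma>_def by blast
  show ?thesis unfolding \<eta>_def[symmetric]
  proof (rule bigoI[where c = "2 * C"], rule eventually_mono[OF eventually_ge_at_top[of 1]])
    fix x :: real assume x: "x \<ge> 1"
    define y where "y = ln x"
    have y: "y \<ge> 0" "exp y = x" using x by (auto simp: y_def)
    have px: "exp (a * y) = x powr a" for a using x by (simp add: y_def powr_def)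
    have "kfull_error k x = of_real (kfull_count k (exp y)) - kfull_main_term k y"
    proof -
      have "(\<Sum>n | 1 \<le> n \<and> real n \<le> x. kfull_ind k n) = of_real (kfull_count k x)"
        unfolding kfull_count_def kfull_ind_def of_real_sum by (intro sum.cong refl) (simp add: of_bool_def)
      moreover have "exp (complex_of_real (y / real (k + j))) = of_real (x powr (1 / real (k + j)))" for j
        using px[of "1 / real (k + j)"] by (simp add: exp_of_real flip: of_real_divide of_nat_add)
      ultimately show ?thesis by (simp only: kfull_error_def kfull_main_term_def y(2))
    qed
    also have "norm \<dots> \<le> C * (exp (y / real k) * x powr - \<tau> + exp (\<sigma> * y) * (x powr - \<tau>) powr - \<sigma>)"
    proof (rule C(2))
      show "x powr - \<tau> > 0" using x by simp
      have "x powr - \<tau> \<le> x powr 0" using x \<tau> by (intro powr_mono) auto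
      thus "x powr - \<tau> \<le> 1" using x by simp
    qed fact
    also have "exp (y / real k) * x powr - \<tau> = x powr \<eta>"
      using px[of "1 / real k"] by (simp add: ex1[symmetric] diff_conv_add_uminus powr_add del: add_uminus_conv_diff)
    also have "exp (\<sigma> * y) * (x powr - \<tau>) powr - \<sigma> = x powr (\<sigma> + \<tau> * \<sigma>)"
      unfolding px powr_powr powr_add by simp
    also have "C * (x powr \<eta> + x powr (\<sigma> + \<tau> * \<sigma>)) \<le> C * (x powr (\<eta> + \<epsilon>) + x powr (\<eta> + \<epsilon>))"
    proof (intro mult_left_mono add_mono)
      show "x powr \<eta> \<le> x powr (\<eta> + \<epsilon>)" using x \<epsilon> by (intro powr_mono) auto
      show "x powr (\<sigma> + \<tau> * \<sigma>) \<le> x powr (\<eta> + \<epsilon>)" using x ex3 by (rule powr_mono[rotated])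
    qed (use C(1) in auto)
    finally show "norm (kfull_error k x) \<le> 2 * C * norm (complex_of_real (x powr (\<eta> + \<epsilon>)))"
      by simp
  qed
qed

theorem theorem4p1:
  fixes k :: nat
  assumes "k \<ge> 4"
    and "Lindelof_Hypothesis"
  shows "kfull_eta k \<le> (real k + 1) / (real k * (2 * real k + 3))"
proof (rule field_le_epsilon)
  fix \<epsilon> :: real assume \<epsilon>: "\<epsilon> > 0"
  have "(real k + 1) / (real k * (2 * real k + 3)) > 0"
    using assms by (intro divide_pos_pos mult_pos_pos) auto
  with \<epsilon> have pos: "(real k + 1) / (real k * (2 * real k + 3)) + \<epsilon> > 0" by linarith
  show "kfull_eta k \<le> (real k + 1) / (real k * (2 * real k + 3)) + \<epsilon>"
    unfolding kfull_eta_def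
  proof (intro cInf_lower bdd_belowI[of _ 0] CollectI conjI pos)
    show "kfull_error k \<in> O[at_top](\<lambda>x. of_real (x powr ((real k + 1) / (real k * (2 * real k + 3)) + \<epsilon>)))"
      by (rule kfull_error_bigo) (use assms \<epsilon> in auto)
  qed auto
qed

end
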